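(* There are one-sided error Monte-Carlo algorithms that, given a $k$-expression for a graph $G$, solve (i) \textsc{Connected Vertex Cover} in time $\mathcal{O}^*(6^k)$, and (ii) \textsc{Connected Dominating Set} in time $\mathcal{O}^*(5^k)$.
   Context: $\mathcal{O}^*(\cdot)$ hides factors polynomial in the input size. A labeled graph is a graph with a label function $\mathtt{lab}\colon V\to\mathbb{N}$. Clique-expressions are built from four operations: introduce $\ell(v)$ (a single vertex $v$ with label $\ell$), disjoint union $G_1\oplus G_2$, relabel $\rho_{i\to j}$ (all vertices with label $i$ get label $j$), and join $\eta_{i,j}$ with $i\neq j$ (add all edges between vertices of label $i$ and vertices of label $j$). A $k$-expression is a clique-expression in which every intermediate labeled graph uses only labels in $\{1,\dots,k\}$; it is a $k$-expression for $G$ if it constructs $G$. \textsc{Connected Vertex Cover}: given a graph $G=(V,E)$, a cost function $\mathbf{c}\colon V\to\mathbb{Z}_{>0}$ and an integer budget $\overline{b}\ge 0$, decide whether there is $X\subseteq V$ such that $G-X$ has no edges, $G[X]$ is connected, and $\mathbf{c}(X)\le\overline{b}$. \textsc{Connected Dominating Set}: same input, decide whether there is $X\subseteq V$ with $N[X]=V$, $G[X]$ connected, and $\mathbf{c}(X)\le \overline{b}$. Standing assumptions: costs are polynomially bounded in the input size, and $G$ is connected with at least two vertices. A one-sided error Monte-Carlo algorithm here never returns false positives and returns false negatives with probability at most $1/2$. *)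

theory Defs
  imports "HOL-Probability.SPMF" "HOL-Computational_Algebra.Polynomial"
begin

section \<open>Graphs\<close>

record 'v graph =
  verts :: "'v set"
  edges :: "'v set set"

definition induce :: "'v graph \<Rightarrow> 'v set \<Rightarrow> 'v graph" where
  "induce G X = \<lparr>verts = verts G \<inter> X, edges = {e \<in> edges G. e \<subseteq> X}\<rparr>"

definition delete :: "'v graph \<Rightarrow> 'v set \<Rightarrow> 'v graph" where
  "delete G X = induce G (verts G - X)"

definition adjacency :: "'v graph \<Rightarrow> ('v \<times> 'v) set" where
  "adjacency G = {(u, v). {u, v} \<in> edges G}"

definition connected_graph :: "'v graph \<Rightarrow> bool" where
  "connected_graph G \<longleftrightarrow> (\<forall>u \<in> verts G. \<forall>v \<in> verts G. (u, v) \<in> (adjacency G)\<^sup>*)"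

definition closed_nbh :: "'v graph \<Rightarrow> 'v set \<Rightarrow> 'v set" where
  "closed_nbh G X = X \<union> {v. \<exists>u \<in> X. {u, v} \<in> edges G}"

definition connected_vertex_cover :: "'v graph \<Rightarrow> ('v \<Rightarrow> nat) \<Rightarrow> nat \<Rightarrow> bool" where
  "connected_vertex_cover G c b \<longleftrightarrow>
     (\<exists>X \<subseteq> verts G. edges (delete G X) = {} \<and> connected_graph (induce G X) \<and> sum c X \<le> b)"

definition connected_dominating_set :: "'v graph \<Rightarrow> ('v \<Rightarrow> nat) \<Rightarrow> nat \<Rightarrow> bool" where
  "connected_dominating_set G c b \<longleftrightarrow>
     (\<exists>X \<subseteq> verts G. closed_nbh G X = verts G \<and> connected_graph (induce G X) \<and> sum c X \<le> b)"


section \<open>Clique-expressions\<close>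

text \<open>Only the values of \<open>lab\<close> on \<open>verts\<close> are meaningful.\<close>

record 'v lgraph = "'v graph" +
  lab :: "'v \<Rightarrow> nat"

datatype 'v cexpr =
    Introduce nat 'v
  | Disj_Union "'v cexpr" "'v cexpr"
  | Relabel nat nat "'v cexpr"
  | Join nat nat "'v cexpr"

fun lgraph_of :: "'v cexpr \<Rightarrow> 'v lgraph" where
  "lgraph_of (Introduce l v) = \<lparr>verts = {v}, edges = {}, lab = (\<lambda>_. l)\<rparr>"
| "lgraph_of (Disj_Union a b) =
     (let G = lgraph_of a; H = lgraph_of b in
      \<lparr>verts = verts G \<union> verts H, edges = edges G \<union> edges H,
       lab = (\<lambda>v. if v \<in> verts G then lab G v else lab H v)\<rparr>)"
| "lgraph_of (Relabel i j a) =
     (let G = lgraph_of a in G\<lparr>lab := (\<lambda>v. if lab G v = i then j else lab G v)\<rparr>)"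
| "lgraph_of (Join i j a) =
     (let G = lgraph_of a in
      G\<lparr>edges := edges G \<union>
         {{u, v} | u v. u \<in> verts G \<and> v \<in> verts G \<and> lab G u = i \<and> lab G v = j}\<rparr>)"

fun wf_cexpr :: "'v cexpr \<Rightarrow> bool" where
  "wf_cexpr (Introduce l v) \<longleftrightarrow> True"
| "wf_cexpr (Disj_Union a b) \<longleftrightarrow>
     wf_cexpr a \<and> wf_cexpr b \<and> verts (lgraph_of a) \<inter> verts (lgraph_of b) = {}"
| "wf_cexpr (Relabel i j a) \<longleftrightarrow> wf_cexpr a"
| "wf_cexpr (Join i j a) \<longleftrightarrow> i \<noteq> j \<and> wf_cexpr a"

fun subexprs :: "'v cexpr \<Rightarrow> 'v cexpr set" where
  "subexprs (Introduce l v) = {Introduce l v}"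
| "subexprs (Disj_Union a b) = insert (Disj_Union a b) (subexprs a \<union> subexprs b)"
| "subexprs (Relabel i j a) = insert (Relabel i j a) (subexprs a)"
| "subexprs (Join i j a) = insert (Join i j a) (subexprs a)"

text \<open>The constraint is on the labels carried by vertices of the intermediate graphs; an operation
  that changes nothing may mention labels outside \<open>{1..k}\<close>.\<close>

definition k_expression :: "nat \<Rightarrow> 'v cexpr \<Rightarrow> bool" where
  "k_expression k e \<longleftrightarrow> wf_cexpr e \<and>
     (\<forall>s \<in> subexprs e. \<forall>v \<in> verts (lgraph_of s). lab (lgraph_of s) v \<in> {1..k})"

definition k_expression_for :: "nat \<Rightarrow> 'v cexpr \<Rightarrow> 'v graph \<Rightarrow> bool" where
  "k_expression_for k e G \<longleftrightarrow> k_expression k e \<and> G = graph.truncate (lgraph_of e)"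

fun vertex_list :: "'v cexpr \<Rightarrow> 'v list" where
  "vertex_list (Introduce l v) = [v]"
| "vertex_list (Disj_Union a b) = vertex_list a @ vertex_list b"
| "vertex_list (Relabel i j a) = vertex_list a"
| "vertex_list (Join i j a) = vertex_list a"


section \<open>Randomized algorithms and their running time\<close>

text \<open>
  The model of computation is a first-order functional language with recursion and fair coin
  flips over binary trees (pure Lisp; compare the tree languages WHILE and F in N. D. Jones,
  Computability and Complexity from a Programming Perspective). A program is a list of unary
  function bodies, and variables are de Bruijn indices.

  There are no arithmetic operations and no equality test on trees: each evaluation step allocates
  or follows a bounded number of pointers or flips one coin, so \<open>T\<close> steps take \<open>O(T)\<close> unit-cost
  operations on a RAM with words of \<open>O(log (T + n))\<close> bits for input size \<open>n\<close>. Conversely, a memory of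
  such a RAM can be kept in a balanced tree, so that it is simulated with a factor polynomial in
  \<open>log T\<close> and the word length. For time bounds of the form \<open>a ^ k\<close> times a polynomial in the input
  size this overhead is polynomial in the input size, and the base \<open>a\<close> is the same in both models.
\<close>

datatype sexp = Atom | Cell sexp sexp

datatype expr =
    EVar nat
  | EAtom
  | EPair expr expr
  | ECase expr expr expr
  | ELet expr expr
  | ECall nat expr
  | EFlip

type_synonym program = "expr list"

fun enc_bool :: "bool \<Rightarrow> sexp" where
  "enc_bool False = Atom"
| "enc_bool True = Cell Atom Atom"

text \<open>The distribution of (value, number of evaluation steps); the missing probability mass is that
  of divergence and of calls to undefined functions. In \<open>ECase e0 e1 e2\<close> the two components of a
  \<open>Cell\<close> are bound to the indices \<open>0\<close> and \<open>1\<close> of \<open>e2\<close>.\<close>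

partial_function (spmf) eval :: "program \<Rightarrow> sexp list \<Rightarrow> expr \<Rightarrow> (sexp \<times> nat) spmf" where
  "eval P env e = (case e of
     EVar i \<Rightarrow> return_spmf (if i < length env then env ! i else Atom, 1)
   | EAtom \<Rightarrow> return_spmf (Atom, 1)
   | EPair e1 e2 \<Rightarrow> do {
       (x, s) \<leftarrow> eval P env e1;
       (y, t) \<leftarrow> eval P env e2;
       return_spmf (Cell x y, s + t + 1) }
   | ECase e0 e1 e2 \<Rightarrow> do {
       (x, s) \<leftarrow> eval P env e0;
       (y, t) \<leftarrow> (case x of Atom \<Rightarrow> eval P env e1 | Cell u v \<Rightarrow> eval P (u # v # env) e2);
       return_spmf (y, s + t + 1) }
   | ELet e1 e2 \<Rightarrow> do {
       (x, s) \<leftarrow> eval P env e1;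
       (y, t) \<leftarrow> eval P (x # env) e2;
       return_spmf (y, s + t + 1) }
   | ECall f e1 \<Rightarrow> do {
       (x, s) \<leftarrow> eval P env e1;
       (y, t) \<leftarrow> (if f < length P then eval P [x] (P ! f) else return_pmf None);
       return_spmf (y, s + t + 1) }
   | EFlip \<Rightarrow> do {
       b \<leftarrow> coin_spmf;
       return_spmf (enc_bool b, 1) })"

definition run :: "program \<Rightarrow> sexp \<Rightarrow> (sexp \<times> nat) spmf" where
  "run P x = eval P [x] (ECall 0 (EVar 0))"

text \<open>On input \<open>x\<close>, whose correct answer is \<open>ans\<close>, the program always halts within \<open>T\<close> steps with
  answer yes or no, never gives a false positive, and gives a false negative with probability at
  most one half.\<close>

definition one_sided_monte_carlo :: "program \<Rightarrow> sexp \<Rightarrow> bool \<Rightarrow> nat \<Rightarrow> bool" where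
  "one_sided_monte_carlo P x ans T \<longleftrightarrow>
     lossless_spmf (run P x) \<and>
     (\<forall>(y, t) \<in> set_spmf (run P x). t \<le> T \<and> y \<in> range enc_bool) \<and>
     (\<not> ans \<longrightarrow> (\<forall>(y, t) \<in> set_spmf (run P x). y \<noteq> enc_bool True)) \<and>
     (ans \<longrightarrow> measure (measure_spmf (run P x)) {(y, t). y = enc_bool False} \<le> 1 / 2)"


section \<open>Encoding of instances\<close>

fun enc_list :: "sexp list \<Rightarrow> sexp" where
  "enc_list [] = Atom"
| "enc_list (x # xs) = Cell x (enc_list xs)"

text \<open>Binary, least significant bit first.\<close>

fun bits_of_nat :: "nat \<Rightarrow> bool list" where
  "bits_of_nat n = (if n = 0 then [] else odd n # bits_of_nat (n div 2))"

declare bits_of_nat.simps [simp del]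

definition enc_nat :: "nat \<Rightarrow> sexp" where
  "enc_nat n = enc_list (map enc_bool (bits_of_nat n))"

fun enc_cexpr :: "nat cexpr \<Rightarrow> sexp" where
  "enc_cexpr (Introduce l v) = enc_list [enc_nat 0, enc_nat l, enc_nat v]"
| "enc_cexpr (Disj_Union a b) = enc_list [enc_nat 1, enc_cexpr a, enc_cexpr b]"
| "enc_cexpr (Relabel i j a) = enc_list [enc_nat 2, enc_nat i, enc_nat j, enc_cexpr a]"
| "enc_cexpr (Join i j a) = enc_list [enc_nat 3, enc_nat i, enc_nat j, enc_cexpr a]"

definition enc_costs :: "nat cexpr \<Rightarrow> (nat \<Rightarrow> nat) \<Rightarrow> sexp" where
  "enc_costs e c = enc_list (map (\<lambda>v. Cell (enc_nat v) (enc_nat (c v))) (vertex_list e))"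

text \<open>The graph itself is not a separate part of the input, being determined by the expression. Its
  size is polynomial in that of the expression.\<close>

definition enc_instance :: "nat cexpr \<Rightarrow> (nat \<Rightarrow> nat) \<Rightarrow> nat \<Rightarrow> sexp" where
  "enc_instance e c b = enc_list [enc_cexpr e, enc_costs e c, enc_nat b]"

text \<open>The number of \<open>Cell\<close> nodes of the encoding.\<close>

definition input_size :: "nat cexpr \<Rightarrow> (nat \<Rightarrow> nat) \<Rightarrow> nat \<Rightarrow> nat" where
  "input_size e c b = size (enc_instance e c b)"

text \<open>Solvability in time \<open>a ^ k\<close> times a polynomial in the input size, given a \<open>k\<close>-expression. That
  costs are polynomially bounded means that some fixed polynomial \<open>p\<close> bounds them on all instances;
  the algorithm and the hidden polynomial factor \<open>q\<close> may depend on \<open>p\<close>.\<close>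

definition monte_carlo_solvable_cw ::
    "(nat graph \<Rightarrow> (nat \<Rightarrow> nat) \<Rightarrow> nat \<Rightarrow> bool) \<Rightarrow> nat \<Rightarrow> bool" where
  "monte_carlo_solvable_cw problem a \<longleftrightarrow>
     (\<forall>p :: nat poly. \<exists>(P :: program) (q :: nat poly).
        \<forall>k e G c b.
          k_expression_for k e G \<longrightarrow>
          connected_graph G \<longrightarrow>
          card (verts G) \<ge> 2 \<longrightarrow>
          (\<forall>v \<in> verts G. 0 < c v \<and> c v \<le> poly p (input_size e c b)) \<longrightarrow>
          one_sided_monte_carlo P (enc_instance e c b) (problem G c b)
            (a ^ k * poly q (input_size e c b)))"

end

theory Submission
  imports Defs
begin

text \<open>
  Both problems are solved by Cut \<open>&\<close> Count. A solution together with a cut of it that is crossed by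
  no edge is an assignment of states to vertices, and modulo two the number of cuts that keep a fixed
  vertex \<open>r\<close> on the left is one if the solution is connected and zero otherwise (flip everything that
  is not connected to \<open>r\<close>). For dominating sets, undominated vertices are cancelled in the same way
  by a further state. The assignments are counted modulo two, graded by weight, bottom-up along the
  expression. A table has, for each label, one entry per \<^emph>\<open>test\<close>, that is, a set of states to which
  the vertices of the label are confined; unions are then pointwise products, and a join is a
  fixed linear combination of entries. For vertex covers the states out, left and right give
  seven nonempty tests, but the full one is needed only for labels that take part in no later join,
  and these need no other test: six entries per label suffice. For dominating sets a join cannot
  distinguish two label classes that both contain two conflicting states, so five tests suffice.
  Random weights make the lightest solution unique with probability at least one half.
\<close>

section \<open>Programs with named functions and binders\<close>

text \<open>Six tests suffice for vertex covers because a class in which all three states occur is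
  compatible with no state: \<open>Out\<close> conflicts with \<open>Out\<close>, and
  \<open>Lft\<close> with \<open>Rgt\<close>. Such an assignment dies in a join with a nonempty
  class, so entries below the join never need the full test. Liveness must therefore be known while
  tables are built: it is passed down from the root, whose only entry has the full test at every
  label, while the tables travel up. Tests ask for containment in a set of states, not for the exact
  set, because containment splits over a disjoint union. The identity for joins, in contrast, is
  stated for the exact sets of states in the two classes; there are finitely many, so it is checked
  by evaluation. The vertex on the left has to be guessed, hence every vertex is tried; a unique
  lightest solution is detected from any of its vertices. The machine has no arithmetic. Numbers
  that are computed with are unary and polynomials over GF(2) are bit lists; both stay short because
  costs are polynomially bounded and the budget is capped. All time bounds are powers of one
  quantity \<open>K\<close>, times the number of table entries.\<close>

inductive steps :: "program \<Rightarrow> sexp list \<Rightarrow> expr \<Rightarrow> sexp \<Rightarrow> nat \<Rightarrow> bool" for P where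
  steps_Var: "steps P env (EVar i) (if i < length env then env ! i else Atom) 1"
| steps_Atom: "steps P env EAtom Atom 1"
| steps_Pair: "steps P env e1 x s \<Longrightarrow> steps P env e2 y t \<Longrightarrow> steps P env (EPair e1 e2) (Cell x y) (s + t + 1)"
| steps_Case_Atom: "steps P env e0 Atom s \<Longrightarrow> steps P env e1 y t \<Longrightarrow> steps P env (ECase e0 e1 e2) y (s + t + 1)"
| steps_Case_Cell: "steps P env e0 (Cell u v) s \<Longrightarrow> steps P (u # v # env) e2 y t \<Longrightarrow>
    steps P env (ECase e0 e1 e2) y (s + t + 1)"
| steps_Let: "steps P env e1 x s \<Longrightarrow> steps P (x # env) e2 y t \<Longrightarrow> steps P env (ELet e1 e2) y (s + t + 1)"
| steps_Call: "steps P env e x s \<Longrightarrow> f < length P \<Longrightarrow> steps P [x] (P ! f) y t \<Longrightarrow>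
    steps P env (ECall f e) y (s + t + 1)"

inductive_simps steps_simps:
  "steps P env (EVar i) v t" "steps P env EAtom v t" "steps P env (EPair e1 e2) v t"
  "steps P env (ECase e0 e1 e2) v t" "steps P env (ELet e1 e2) v t" "steps P env (ECall f e) v t"

text \<open>\<open>steps\<close> has no rule for \<open>EFlip\<close>, so flip-free code is reasoned
  about as a deterministic big-step relation; distributions are met only where \<open>FFlip\<close>
  is run.\<close>

lemma eval_steps: "steps P env e v t \<Longrightarrow> eval P env e = return_spmf (v, t)"
  by (induction rule: steps.induct; subst eval.simps) simp_all

text \<open>A term depends on the depth of its context, so that a binder can be a function on terms:
  \<open>Var k\<close> denotes the variable bound at depth \<open>k\<close>.\<close>

type_synonym tm = "nat \<Rightarrow> expr"

definition Var :: "nat \<Rightarrow> tm" where "Var k d = EVar (d - Suc k)"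
definition NIL :: tm where "NIL d = EAtom"
definition PAIR :: "tm \<Rightarrow> tm \<Rightarrow> tm" (infixr \<open>\<triangleright>\<close> 65) where "(x \<triangleright> y) d = EPair (x d) (y d)"
text \<open>The head is in front of the tail in the environment, so it has the larger depth
  \<open>Suc d\<close>.\<close>

definition CASE :: "tm \<Rightarrow> tm \<Rightarrow> (tm \<Rightarrow> tm \<Rightarrow> tm) \<Rightarrow> tm" where
  "CASE x y f d = ECase (x d) (y d) (f (Var (Suc d)) (Var d) (Suc (Suc d)))"
definition LET :: "tm \<Rightarrow> (tm \<Rightarrow> tm) \<Rightarrow> tm" where
  "LET x f d = ELet (x d) (f (Var d) (Suc d))"
definition APP :: "nat \<Rightarrow> tm \<Rightarrow> tm" where "APP f x d = ECall f (x d)"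
definition FLIP :: tm where "FLIP d = EFlip"

abbreviation TT :: tm where "TT \<equiv> NIL \<triangleright> NIL"
abbreviation IF :: "tm \<Rightarrow> tm \<Rightarrow> tm \<Rightarrow> tm" where "IF c x y \<equiv> CASE c y (\<lambda>_ _. x)"
abbreviation SPLIT :: "tm \<Rightarrow> (tm \<Rightarrow> tm \<Rightarrow> tm) \<Rightarrow> tm" where "SPLIT x f \<equiv> CASE x NIL f"

primrec quote :: "sexp \<Rightarrow> expr" where
  "quote Atom = EAtom"
| "quote (Cell x y) = EPair (quote x) (quote y)"

definition QUOTE :: "sexp \<Rightarrow> tm" where "QUOTE s d = quote s"

text \<open>A weakest precondition in continuation form. The rules below are equivalences, so the
  simplifier executes a term symbolically and hands the value and step count of each subterm to the
  next one.\<close>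

definition RUN :: "program \<Rightarrow> sexp list \<Rightarrow> tm \<Rightarrow> (sexp \<Rightarrow> nat \<Rightarrow> bool) \<Rightarrow> bool" where
  "RUN P env h \<Phi> \<longleftrightarrow> (\<exists>v t. steps P env (h (length env)) v t \<and> \<Phi> v t)"

text \<open>Kept apart from \<open>RUN\<close> so that symbolic execution stops at a call, which is
  then discharged by the specification of the called function.\<close>

definition CALLS :: "program \<Rightarrow> nat \<Rightarrow> sexp \<Rightarrow> (sexp \<Rightarrow> nat \<Rightarrow> bool) \<Rightarrow> bool" where
  "CALLS P f x \<Phi> \<longleftrightarrow> f < length P \<and> (\<exists>v t. steps P [x] (P ! f) v t \<and> \<Phi> v t)"

lemma RUN_Var [simp]: "k < length env \<Longrightarrow> RUN P env (Var k) \<Phi> \<longleftrightarrow> \<Phi> (env ! (length env - Suc k)) 1"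
  by (auto simp: RUN_def Var_def steps_simps)

lemma RUN_NIL [simp]: "RUN P env NIL \<Phi> \<longleftrightarrow> \<Phi> Atom 1"
  by (auto simp: RUN_def NIL_def steps_simps)

lemma RUN_PAIR [simp]:
  "RUN P env (x \<triangleright> y) \<Phi> \<longleftrightarrow> RUN P env x (\<lambda>u s. RUN P env y (\<lambda>v t. \<Phi> (Cell u v) (s + t + 1)))"
  unfolding RUN_def PAIR_def steps_simps One_nat_def add_Suc_right add_0_right by blast

lemma RUN_LET [simp]:
  "RUN P env (LET x f) \<Phi> \<longleftrightarrow>
    RUN P env x (\<lambda>u s. RUN P (u # env) (f (Var (length env))) (\<lambda>v t. \<Phi> v (s + t + 1)))"
  unfolding RUN_def LET_def steps_simps One_nat_def add_Suc_right add_0_right list.size by blast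

lemma RUN_APP [simp]:
  "RUN P env (APP f x) \<Phi> \<longleftrightarrow> RUN P env x (\<lambda>u s. CALLS P f u (\<lambda>v t. \<Phi> v (s + t + 1)))"
  unfolding RUN_def CALLS_def APP_def steps_simps One_nat_def add_Suc_right add_0_right by blast

lemma RUN_CASE [simp]:
  "RUN P env (CASE x y f) \<Phi> \<longleftrightarrow>
    RUN P env x (\<lambda>w s. case w of
        Atom \<Rightarrow> RUN P env y (\<lambda>v t. \<Phi> v (s + t + 1))
      | Cell a b \<Rightarrow> RUN P (a # b # env) (f (Var (Suc (length env))) (Var (length env)))
          (\<lambda>v t. \<Phi> v (s + t + 1)))" (is "?l = ?r")
proof -
  have l: "?l \<longleftrightarrow> (\<exists>w s. steps P env (x (length env)) w s \<and> (case w of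
        Atom \<Rightarrow> \<exists>v t. steps P env (y (length env)) v t \<and> \<Phi> v (Suc (s + t))
      | Cell a b \<Rightarrow> \<exists>v t. steps P (a # b # env)
          (f (Var (Suc (length env))) (Var (length env)) (Suc (Suc (length env)))) v t \<and> \<Phi> v (Suc (s + t))))"
    (is "_ \<longleftrightarrow> (\<exists>w s. _ \<and> ?Q w s)")
  proof
    assume ?l
    then show "\<exists>w s. steps P env (x (length env)) w s \<and> ?Q w s"
      unfolding RUN_def CASE_def steps_simps by (elim exE conjE disjE) (force simp: ac_simps)+
  next
    assume "\<exists>w s. steps P env (x (length env)) w s \<and> ?Q w s"
    then obtain w s where *: "steps P env (x (length env)) w s" "?Q w s" by blast
    then show ?l unfolding RUN_def CASE_def steps_simps by (cases w) (auto, blast+)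
  qed
  show ?thesis unfolding l unfolding RUN_def by (simp cong: sexp.case_cong)
qed

lemma steps_quote: "steps P env (quote s) s (2 * size s + 1)"
proof (induction s)
  case Atom
  then show ?case by (simp add: steps_simps)
next
  case (Cell x y)
  from steps_Pair[OF this] show ?case by (simp add: algebra_simps)
qed

lemma steps_quote_unique: "steps P env (quote s) v t \<Longrightarrow> v = s \<and> t = 2 * size s + 1"
  by (induction s arbitrary: v t) (fastforce simp: steps_simps)+

lemma RUN_QUOTE [simp]: "RUN P env (QUOTE s) \<Phi> \<longleftrightarrow> \<Phi> s (2 * size s + 1)"
  unfolding RUN_def QUOTE_def using steps_quote steps_quote_unique by blast

definition RES :: "sexp \<Rightarrow> nat \<Rightarrow> sexp \<Rightarrow> nat \<Rightarrow> bool" where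
  "RES y T v t \<longleftrightarrow> v = y \<and> t \<le> T"

lemma RES_I [intro!]: "v = y \<Longrightarrow> t \<le> T \<Longrightarrow> RES y T v t"
  by (simp add: RES_def)

text \<open>Hides an expected result until the symbolic execution has finished, lest the simplifier
  splits its conditionals too early.\<close>

definition HID :: "'a \<Rightarrow> 'a \<Rightarrow> bool" where "HID x y \<longleftrightarrow> x = y"

lemma HID_cong [cong]: "HID x y = HID x y" ..

definition computes :: "program \<Rightarrow> nat \<Rightarrow> sexp \<Rightarrow> sexp \<Rightarrow> nat \<Rightarrow> bool" where
  "computes P f x y T \<longleftrightarrow> CALLS P f x (RES y T)"

text \<open>An introduction rule for a pending call: it forgets the exact step count and keeps the
  bound, so that only bounds are added up along a body.\<close>

lemma computes_CALLS:
  "computes P f x y T \<Longrightarrow> (\<And>t. t \<le> T \<Longrightarrow> \<Phi> y t) \<Longrightarrow> CALLS P f x \<Phi>"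
  unfolding computes_def CALLS_def RES_def by blast

lemma computes_mono: "computes P f x y T \<Longrightarrow> T \<le> T' \<Longrightarrow> computes P f x y T'"
  unfolding computes_def CALLS_def RES_def using order_trans by blast

lemma computes_eval:
  "computes P f x y T \<Longrightarrow> f < length P \<and> (\<exists>t \<le> T. eval P [x] (P ! f) = return_spmf (y, t))"
  unfolding computes_def CALLS_def RES_def using eval_steps by blast


section \<open>Encodings\<close>

lemma case_enc_bool [simp]:
  "(case enc_bool q of Atom \<Rightarrow> x | Cell u v \<Rightarrow> f u v) = (if q then f Atom Atom else x)"
  by (cases q) auto

lemma enc_bool_eq_iff [simp]: "enc_bool p = enc_bool q \<longleftrightarrow> p = q"
  by (cases p; cases q) auto

lemma enc_bool_eq_simps [simp]: "Cell Atom Atom = enc_bool p \<longleftrightarrow> p" "Atom = enc_bool p \<longleftrightarrow> \<not> p"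
  "enc_bool p = Cell Atom Atom \<longleftrightarrow> p" "enc_bool p = Atom \<longleftrightarrow> \<not> p"
  by (cases p; simp)+

definition elist :: "('a \<Rightarrow> sexp) \<Rightarrow> 'a list \<Rightarrow> sexp" where
  "elist f xs = enc_list (map f xs)"

lemma elist_simps [simp]: "elist f [] = Atom" "elist f (x # xs) = Cell (f x) (elist f xs)"
  by (simp_all add: elist_def)

lemma case_elist [simp]:
  "(case elist f xs of Atom \<Rightarrow> x | Cell u v \<Rightarrow> g u v) =
   (case xs of [] \<Rightarrow> x | y # ys \<Rightarrow> g (f y) (elist f ys))"
  by (cases xs) auto

primrec unary :: "nat \<Rightarrow> sexp" where
  "unary 0 = Atom"
| "unary (Suc n) = Cell Atom (unary n)"

lemma case_unary [simp]:
  "(case unary n of Atom \<Rightarrow> x | Cell u v \<Rightarrow> g u v) =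
   (case n of 0 \<Rightarrow> x | Suc m \<Rightarrow> g Atom (unary m))"
  by (cases n) auto

abbreviation ebits :: "bool list \<Rightarrow> sexp" where "ebits \<equiv> elist enc_bool"
abbreviation elabs :: "nat list \<Rightarrow> sexp" where "elabs \<equiv> elist enc_nat"
abbreviation eassoc :: "(nat \<times> nat) list \<Rightarrow> sexp" where
  "eassoc \<equiv> elist (\<lambda>(l, t). Cell (enc_nat l) (unary t))"

text \<open>A unary number and the zero polynomial of that length are the same tree, so the computed
  degree bound directly serves as the zero polynomial.\<close>

lemma unary_ebits: "unary n = ebits (replicate n False)"
  by (induction n) (auto simp: elist_def)

lemma enc_nat_ebits: "enc_nat n = ebits (bits_of_nat n)"
  by (simp add: enc_nat_def elist_def)

fun val :: "bool list \<Rightarrow> nat" where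
  "val [] = 0"
| "val (b # p) = of_bool b + 2 * val p"

lemma val_bits_of_nat [simp]: "val (bits_of_nat n) = n"
  by (induction n rule: bits_of_nat.induct) (subst bits_of_nat.simps, auto elim: oddE)

lemma ebits_inject: "ebits p = ebits q \<Longrightarrow> p = q"
proof (induction p arbitrary: q)
  case Nil
  then show ?case by (cases q) auto
next
  case (Cons a p)
  then show ?case by (cases q) auto
qed

text \<open>Labels and vertices can be compared by structural equality of trees.\<close>

lemma enc_nat_inject [simp]: "enc_nat m = enc_nat n \<longleftrightarrow> m = n"
  using ebits_inject val_bits_of_nat unfolding enc_nat_ebits by metis

lemma enc_nat_numerals:
  "enc_nat 0 = Atom" "enc_nat (Suc 0) = Cell (Cell Atom Atom) Atom"
  "enc_nat 2 = Cell Atom (Cell (Cell Atom Atom) Atom)"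
  "enc_nat 3 = Cell (Cell Atom Atom) (Cell (Cell Atom Atom) Atom)"
  by (simp_all add: enc_nat_def bits_of_nat.simps)

section \<open>The program\<close>

datatype fn = FMain | FEq | FMem | FApp | FRpl | FLabs | FAll | FDist | FGet | FNth | FLk | FPadd
  | FButl | FPmul | FMono | FJsum | FLeaf | FTab | FTabs | FDp | FOr | FAny | FLen | FMul | FMin
  | FVal | FCap | FHalf | FLg | FExp | FTake | FDrop | FTot | FWts | FShape | FFlip | FDec

definition fns :: "fn list" where
  "fns = [FMain, FEq, FMem, FApp, FRpl, FLabs, FAll, FDist, FGet, FNth, FLk, FPadd,
    FButl, FPmul, FMono, FJsum, FLeaf, FTab, FTabs, FDp, FOr, FAny, FLen, FMul, FMin,
    FVal, FCap, FHalf, FLg, FExp, FTake, FDrop, FTot, FWts, FShape, FFlip, FDec]"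

definition ix :: "fn \<Rightarrow> nat" where "ix f = length (takeWhile ((\<noteq>) f) fns)"

lemma length_takeWhile_neq:
  "x \<in> set xs \<Longrightarrow> length (takeWhile ((\<noteq>) x) xs) < length xs \<and> xs ! length (takeWhile ((\<noteq>) x) xs) = x"
  by (induction xs) auto

lemma ix: "ix f < length fns" "fns ! ix f = f"
proof -
  have "f \<in> set fns" by (cases f) (simp_all add: fns_def)
  from length_takeWhile_neq[OF this] show "ix f < length fns" "fns ! ix f = f"
    unfolding ix_def by auto
qed

abbreviation CALL :: "fn \<Rightarrow> tm \<Rightarrow> tm" where "CALL f x \<equiv> APP (ix f) x"

text \<open>The tags 0 to 3 have the bits \<open>[]\<close>, \<open>[1]\<close>,
  \<open>[0, 1]\<close>, \<open>[1, 1]\<close>: no bit means introduce, a single bit means union,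
  and with two bits the first one tells join from relabel. Every node has at least two arguments, so
  these are read before the tag is inspected.\<close>

definition MATCH ::
    "tm \<Rightarrow> (tm \<Rightarrow> tm \<Rightarrow> tm) \<Rightarrow> (tm \<Rightarrow> tm \<Rightarrow> tm) \<Rightarrow> (tm \<Rightarrow> tm \<Rightarrow> tm \<Rightarrow> tm) \<Rightarrow> (tm \<Rightarrow> tm \<Rightarrow> tm \<Rightarrow> tm) \<Rightarrow> tm" where
  "MATCH e fi fu fr fj =
    SPLIT e (\<lambda>tag e. SPLIT e (\<lambda>p e. SPLIT e (\<lambda>q e. CASE tag (fi p q) (\<lambda>b bs. CASE bs (fu p q) (\<lambda>_ _.
      SPLIT e (\<lambda>r _. IF b (fj p q r) (fr p q r)))))))"

text \<open>\<open>a\<close> is the number of tests of a live label. \<open>jt s s'\<close> lists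
  the pairs of tests whose entries below a join sum up, modulo two, to the entry with tests
  \<open>s\<close> and \<open>s'\<close> above it. \<open>wt s\<close> describes a single vertex
  under test \<open>s\<close>: the parity of the number of unselected states, that of the selected
  ones, and whether the left side is allowed.\<close>

locale tables =
  fixes a :: nat and jt :: "nat \<Rightarrow> nat \<Rightarrow> (nat \<times> nat) list" and wt :: "nat \<Rightarrow> bool \<times> bool \<times> bool"
begin

definition live_opts :: "nat list" where "live_opts = [0..<a]"
definition dead_opts :: "nat list" where "dead_opts = [a]"

definition "epairs = elist (\<lambda>(u, v). Cell (unary u) (unary v))"
definition "jtab = elist (\<lambda>s. elist (\<lambda>s'. epairs (jt s s')) [0..<Suc a]) [0..<Suc a]"
definition "ewt = (\<lambda>(x, y, z). Cell (enc_bool x) (Cell (enc_bool y) (enc_bool z)))"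
definition "wtab = elist (\<lambda>s. ewt (wt s)) [0..<Suc a]"

text \<open>\<open>FShape\<close> computes how many random bits are needed and \<open>FFlip\<close>
  draws them all in advance, so that \<open>FDec\<close> is a deterministic function of the instance
  and a uniform bit string.\<close>

primrec code :: "fn \<Rightarrow> tm \<Rightarrow> tm" where
  "code FMain = (\<lambda>x. LET (CALL FShape x) (\<lambda>s. LET (CALL FFlip s) (\<lambda>r. CALL FDec (x \<triangleright> r))))"
| "code FEq = (\<lambda>x. SPLIT x (\<lambda>p q.
     CASE p (CASE q TT (\<lambda>_ _. NIL)) (\<lambda>p1 p2. CASE q NIL (\<lambda>q1 q2.
       IF (CALL FEq (p1 \<triangleright> q1)) (CALL FEq (p2 \<triangleright> q2)) NIL))))"
| "code FMem = (\<lambda>x. SPLIT x (\<lambda>l ls. CASE ls NIL (\<lambda>y ys.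
     IF (CALL FEq (l \<triangleright> y)) TT (CALL FMem (l \<triangleright> ys)))))"
| "code FApp = (\<lambda>x. SPLIT x (\<lambda>xs ys. CASE xs ys (\<lambda>u us. u \<triangleright> CALL FApp (us \<triangleright> ys))))"
| "code FRpl = (\<lambda>x. SPLIT x (\<lambda>i r. SPLIT r (\<lambda>j ls. CASE ls NIL (\<lambda>u us.
     IF (CALL FEq (u \<triangleright> i)) j u \<triangleright> CALL FRpl (i \<triangleright> j \<triangleright> us)))))"
| "code FLabs = (\<lambda>x. MATCH x
     (\<lambda>l v. l \<triangleright> NIL)
     (\<lambda>p q. CALL FApp (CALL FLabs p \<triangleright> CALL FLabs q))
     (\<lambda>i j p. CALL FRpl (i \<triangleright> j \<triangleright> CALL FLabs p))
     (\<lambda>i j p. CALL FLabs p))"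
| "code FAll = (\<lambda>x. MATCH x
     (\<lambda>l v. l \<triangleright> NIL)
     (\<lambda>p q. CALL FApp (CALL FAll p \<triangleright> CALL FAll q))
     (\<lambda>i j p. IF (CALL FMem (i \<triangleright> CALL FLabs p)) (j \<triangleright> CALL FAll p) (CALL FAll p))
     (\<lambda>i j p. CALL FAll p))"
| "code FDist = (\<lambda>x. CASE x NIL (\<lambda>u us.
     IF (CALL FMem (u \<triangleright> us)) (CALL FDist us) (u \<triangleright> CALL FDist us)))"
| "code FGet = (\<lambda>x. SPLIT x (\<lambda>l s. CASE s NIL (\<lambda>h s. SPLIT h (\<lambda>y t.
     IF (CALL FEq (l \<triangleright> y)) t (CALL FGet (l \<triangleright> s))))))"
| "code FNth = (\<lambda>x. SPLIT x (\<lambda>ts n. SPLIT ts (\<lambda>h tl. CASE n h (\<lambda>_ n.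
     CASE tl h (\<lambda>_ _. CALL FNth (tl \<triangleright> n))))))"
| "code FLk = (\<lambda>x. SPLIT x (\<lambda>t r. SPLIT r (\<lambda>ls s. CASE ls t (\<lambda>l ls.
     CALL FLk (CALL FNth (t \<triangleright> CALL FGet (l \<triangleright> s)) \<triangleright> ls \<triangleright> s)))))"
| "code FPadd = (\<lambda>x. SPLIT x (\<lambda>p q. CASE p NIL (\<lambda>b bs. CASE q NIL (\<lambda>c cs.
     IF b (IF c NIL TT) c \<triangleright> CALL FPadd (bs \<triangleright> cs)))))"
| "code FButl = (\<lambda>x. CASE x NIL (\<lambda>u us. CASE us NIL (\<lambda>_ _. u \<triangleright> CALL FButl us)))"
| "code FPmul = (\<lambda>x. SPLIT x (\<lambda>z r. SPLIT r (\<lambda>p q. CASE p z (\<lambda>c p.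
     CALL FPadd (IF c q z \<triangleright> CALL FButl (NIL \<triangleright> CALL FPmul (z \<triangleright> p \<triangleright> q)))))))"
| "code FMono = (\<lambda>x. SPLIT x (\<lambda>w z. CASE z NIL (\<lambda>_ z. CASE w (TT \<triangleright> z) (\<lambda>_ w.
     NIL \<triangleright> CALL FMono (w \<triangleright> z)))))"
| "code FJsum = (\<lambda>x. SPLIT x (\<lambda>g r. SPLIT r (\<lambda>i r. SPLIT r (\<lambda>j us. SPLIT g (\<lambda>z g'. CASE us z (\<lambda>u us.
     SPLIT u (\<lambda>u u'. SPLIT g' (\<lambda>t g'. SPLIT g' (\<lambda>ls s.
       CALL FPadd (CALL FLk (t \<triangleright> ls \<triangleright> (i \<triangleright> u) \<triangleright> (j \<triangleright> u') \<triangleright> s) \<triangleright> CALL FJsum (g \<triangleright> i \<triangleright> j \<triangleright> us)))))))))))"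
| "code FLeaf = (\<lambda>x. SPLIT x (\<lambda>job s. SPLIT job (\<lambda>ctx r. SPLIT r (\<lambda>e r. SPLIT r (\<lambda>ta tb.
     SPLIT ctx (\<lambda>z r. SPLIT r (\<lambda>ls r. SPLIT r (\<lambda>w rt. MATCH e
       (\<lambda>l v. LET (CALL FNth (QUOTE wtab \<triangleright> CALL FGet (l \<triangleright> s))) (\<lambda>b. SPLIT b (\<lambda>b0 b. SPLIT b (\<lambda>b1 bl.
         IF (CALL FEq (v \<triangleright> rt))
           (IF bl (CALL FMono (CALL FGet (v \<triangleright> w) \<triangleright> z)) z)
           (CALL FPadd (IF b0 (CALL FMono (NIL \<triangleright> z)) z \<triangleright>
              IF b1 (CALL FMono (CALL FGet (v \<triangleright> w) \<triangleright> z)) z))))))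
       (\<lambda>p q. CALL FPmul (z \<triangleright> CALL FLk (ta \<triangleright> ls \<triangleright> s) \<triangleright> CALL FLk (tb \<triangleright> ls \<triangleright> s)))
       (\<lambda>i j p. CALL FLk (ta \<triangleright> ls \<triangleright>
          IF (CALL FMem (i \<triangleright> CALL FLabs p)) ((i \<triangleright> CALL FGet (j \<triangleright> s)) \<triangleright> s) s))
       (\<lambda>i j p. LET (CALL FLabs p) (\<lambda>lp. IF (IF (CALL FMem (i \<triangleright> lp)) (CALL FMem (j \<triangleright> lp)) NIL)
          (CALL FJsum ((z \<triangleright> ta \<triangleright> ls \<triangleright> s) \<triangleright> i \<triangleright> j \<triangleright>
             CALL FNth (CALL FNth (QUOTE jtab \<triangleright> CALL FGet (i \<triangleright> s)) \<triangleright> CALL FGet (j \<triangleright> s))))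
          (CALL FLk (ta \<triangleright> ls \<triangleright> s))))))))))))"
| "code FTab = (\<lambda>x. SPLIT x (\<lambda>job r. SPLIT r (\<lambda>ls r. SPLIT r (\<lambda>lv s.
     CASE ls (CALL FLeaf (job \<triangleright> s)) (\<lambda>l ls. CALL FTabs (job \<triangleright> ls \<triangleright> lv \<triangleright> s \<triangleright> l \<triangleright>
       IF (CALL FGet (l \<triangleright> lv)) (QUOTE (elist unary live_opts)) (QUOTE (elist unary dead_opts))))))))"
| "code FTabs = (\<lambda>x. SPLIT x (\<lambda>job r. SPLIT r (\<lambda>ls r. SPLIT r (\<lambda>lv r. SPLIT r (\<lambda>s r. SPLIT r (\<lambda>l ts.
     CASE ts NIL (\<lambda>t ts. CALL FTab (job \<triangleright> ls \<triangleright> lv \<triangleright> (l \<triangleright> t) \<triangleright> s) \<triangleright>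
       CALL FTabs (job \<triangleright> ls \<triangleright> lv \<triangleright> s \<triangleright> l \<triangleright> ts))))))))"
| "code FDp = (\<lambda>x. SPLIT x (\<lambda>ctx r. SPLIT r (\<lambda>e lv. SPLIT ctx (\<lambda>z r. SPLIT r (\<lambda>ls _.
     CALL FTab ((ctx \<triangleright> e \<triangleright> MATCH e
       (\<lambda>_ _. NIL \<triangleright> NIL)
       (\<lambda>p q. CALL FDp (ctx \<triangleright> p \<triangleright> lv) \<triangleright> CALL FDp (ctx \<triangleright> q \<triangleright> lv))
       (\<lambda>i j p. CALL FDp (ctx \<triangleright> p \<triangleright>
          IF (CALL FMem (i \<triangleright> CALL FLabs p)) ((i \<triangleright> CALL FGet (j \<triangleright> lv)) \<triangleright> lv) lv) \<triangleright> NIL)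
       (\<lambda>i j p. LET (CALL FLabs p) (\<lambda>lp. CALL FDp (ctx \<triangleright> p \<triangleright>
          IF (IF (CALL FMem (i \<triangleright> lp)) (CALL FMem (j \<triangleright> lp)) NIL)
            ((i \<triangleright> TT) \<triangleright> (j \<triangleright> TT) \<triangleright> lv) lv) \<triangleright> NIL)))
       \<triangleright> ls \<triangleright> lv \<triangleright> NIL))))))"
| "code FOr = (\<lambda>x. CASE x NIL (\<lambda>b bs. IF b TT (CALL FOr bs)))"
| "code FAny = (\<lambda>x. SPLIT x (\<lambda>vs g. SPLIT g (\<lambda>e r. SPLIT r (\<lambda>z r. SPLIT r (\<lambda>ls w. CASE vs NIL (\<lambda>h vs. SPLIT h (\<lambda>v _.
     IF (CALL FOr (CALL FLk (CALL FDp ((z \<triangleright> ls \<triangleright> w \<triangleright> v) \<triangleright> e \<triangleright> NIL) \<triangleright> ls \<triangleright> NIL)))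
       TT (CALL FAny (vs \<triangleright> g)))))))))"
| "code FLen = (\<lambda>x. CASE x NIL (\<lambda>_ us. NIL \<triangleright> CALL FLen us))"
| "code FMul = (\<lambda>x. SPLIT x (\<lambda>m n. CASE m NIL (\<lambda>_ m. CALL FApp (n \<triangleright> CALL FMul (m \<triangleright> n)))))"
| "code FMin = (\<lambda>x. SPLIT x (\<lambda>m n. CASE m NIL (\<lambda>_ m. CASE n NIL (\<lambda>_ n. NIL \<triangleright> CALL FMin (m \<triangleright> n)))))"
| "code FVal = (\<lambda>x. CASE x NIL (\<lambda>b bs. LET (CALL FVal bs) (\<lambda>r. LET (CALL FApp (r \<triangleright> r)) (\<lambda>d.
     IF b (NIL \<triangleright> d) d))))"
| "code FCap = (\<lambda>x. SPLIT x (\<lambda>u bs. CASE bs NIL (\<lambda>b bs. LET (CALL FCap (u \<triangleright> bs)) (\<lambda>r.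
     LET (CALL FApp (r \<triangleright> r)) (\<lambda>d. CALL FMin (u \<triangleright> IF b (NIL \<triangleright> d) d))))))"
| "code FHalf = (\<lambda>x. CASE x NIL (\<lambda>_ us. CASE us NIL (\<lambda>_ us. NIL \<triangleright> CALL FHalf us)))"
| "code FLg = (\<lambda>x. CASE x NIL (\<lambda>_ _. NIL \<triangleright> CALL FLg (CALL FHalf x)))"
| "code FExp = (\<lambda>x. CASE x TT (\<lambda>_ m. LET (CALL FExp m) (\<lambda>r. CALL FApp (r \<triangleright> r))))"
| "code FTake = (\<lambda>x. SPLIT x (\<lambda>m r. CASE m NIL (\<lambda>_ m. CASE r NIL (\<lambda>b bs. b \<triangleright> CALL FTake (m \<triangleright> bs)))))"
| "code FDrop = (\<lambda>x. SPLIT x (\<lambda>m r. CASE m r (\<lambda>_ m. CASE r NIL (\<lambda>_ bs. CALL FDrop (m \<triangleright> bs)))))"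
| "code FTot = (\<lambda>x. CASE x NIL (\<lambda>h t. SPLIT h (\<lambda>_ c. CALL FApp (CALL FVal c \<triangleright> CALL FTot t))))"
| "code FWts = (\<lambda>x. SPLIT x (\<lambda>cs r. SPLIT r (\<lambda>r g. SPLIT g (\<lambda>m mm. CASE cs NIL (\<lambda>h cs. SPLIT h (\<lambda>v c.
     (v \<triangleright> CALL FApp (CALL FMul (mm \<triangleright> CALL FVal c) \<triangleright> CALL FVal (CALL FTake (m \<triangleright> r)))) \<triangleright>
       CALL FWts (cs \<triangleright> CALL FDrop (m \<triangleright> r) \<triangleright> g)))))))"
| "code FShape = (\<lambda>x. SPLIT x (\<lambda>_ y. SPLIT y (\<lambda>cs _. LET (CALL FLen cs) (\<lambda>n.
     CALL FMul (n \<triangleright> NIL \<triangleright> CALL FLg n)))))"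
| "code FFlip = (\<lambda>x. CASE x NIL (\<lambda>_ t. FLIP \<triangleright> CALL FFlip t))"
| "code FDec = (\<lambda>x. SPLIT x (\<lambda>i r. SPLIT i (\<lambda>e i. SPLIT i (\<lambda>cs i. SPLIT i (\<lambda>b _.
     LET (CALL FLen cs) (\<lambda>n. LET (NIL \<triangleright> CALL FLg n) (\<lambda>m. LET (CALL FMul (n \<triangleright> CALL FExp m)) (\<lambda>mm.
     LET (CALL FMul (mm \<triangleright> NIL \<triangleright> CALL FCap (CALL FTot cs \<triangleright> b))) (\<lambda>z.
     LET (CALL FWts (cs \<triangleright> r \<triangleright> m \<triangleright> mm)) (\<lambda>w.
     CALL FAny (w \<triangleright> e \<triangleright> z \<triangleright> CALL FDist (CALL FAll e) \<triangleright> w)))))))))))"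

definition prog :: program where "prog = map (\<lambda>f. code f (Var 0) 1) fns"

lemma prog_ix: "ix f < length prog" "prog ! ix f = code f (Var 0) 1"
  by (simp_all add: prog_def ix)

lemma computesI:
  assumes "\<And>y' T'. HID y' y \<Longrightarrow> HID T' T \<Longrightarrow> RUN prog [x] (code f (Var 0)) (RES y' T')"
  shows "computes prog (ix f) x y T"
  using assms[of y T] unfolding computes_def CALLS_def RUN_def by (auto simp: prog_ix HID_def)

end

section \<open>The functions computed by the program\<close>

fun labs :: "nat cexpr \<Rightarrow> nat list" where
  "labs (Introduce l v) = [l]"
| "labs (Disj_Union p q) = labs p @ labs q"
| "labs (Relabel i j p) = map (\<lambda>l. if l = i then j else l) (labs p)"
| "labs (Join i j p) = labs p"

text \<open>Only labels carried by a vertex of some intermediate graph are collected: relabelling an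
  absent label contributes nothing. This matters because the parameter \<open>k\<close> bounds
  carried labels, not mentioned ones.\<close>

fun all_labs :: "nat cexpr \<Rightarrow> nat list" where
  "all_labs (Introduce l v) = [l]"
| "all_labs (Disj_Union p q) = all_labs p @ all_labs q"
| "all_labs (Relabel i j p) = (if i \<in> set (labs p) then [j] else []) @ all_labs p"
| "all_labs (Join i j p) = all_labs p"

fun nodes :: "'v cexpr \<Rightarrow> nat" where
  "nodes (Introduce l v) = 1"
| "nodes (Disj_Union p q) = nodes p + nodes q + 1"
| "nodes (Relabel i j p) = nodes p + 1"
| "nodes (Join i j p) = nodes p + 1"

text \<open>Shadowing association lists. The default value \<open>0\<close> of \<open>get\<close> marks a label that takes part in
  no later join; its table level is a list of length one, for which \<open>sel\<close> ignores the index.\<close>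

fun get :: "(nat \<times> nat) list \<Rightarrow> nat \<Rightarrow> nat" where
  "get [] l = 0"
| "get ((y, t) # s) l = (if l = y then t else get s l)"

fun sel :: "'a list \<Rightarrow> nat \<Rightarrow> 'a" where
  "sel (t # ts) n = (case n of 0 \<Rightarrow> t | Suc n \<Rightarrow> if ts = [] then t else sel ts n)"

datatype tbl = Leaf "bool list" | Node "tbl list"

primrec etbl :: "tbl \<Rightarrow> sexp" where
  "etbl (Leaf p) = ebits p"
| "etbl (Node ts) = enc_list (map etbl ts)"

lemma etbl_Node: "etbl (Node ts) = elist etbl ts"
  by (simp add: elist_def)

fun shape :: "nat \<Rightarrow> tbl \<Rightarrow> nat list \<Rightarrow> bool" where
  "shape d (Leaf p) [] \<longleftrightarrow> length p = d"
| "shape d (Node ts) (l # ls) \<longleftrightarrow> ts \<noteq> [] \<and> (\<forall>t \<in> set ts. shape d t ls)"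
| "shape d _ _ \<longleftrightarrow> False"

fun lk :: "tbl \<Rightarrow> nat list \<Rightarrow> (nat \<times> nat) list \<Rightarrow> bool list" where
  "lk (Leaf p) ls s = p"
| "lk (Node ts) (l # ls) s = lk (sel ts (get s l)) ls s"

text \<open>Bit lists of length \<open>d\<close> are polynomials over GF(2) modulo the
  \<open>d\<close>-th power of the variable. The coefficient at \<open>k\<close> is the parity of
  the number of assignments of weight \<open>k\<close>.\<close>

fun padd :: "bool list \<Rightarrow> bool list \<Rightarrow> bool list" where
  "padd (b # p) (c # q) = (b \<noteq> c) # padd p q"
| "padd _ _ = []"

abbreviation zeros :: "nat \<Rightarrow> bool list" where "zeros d \<equiv> replicate d False"

text \<open>Horner's scheme; \<open>butlast (False # _)\<close> multiplies by the variable and drops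
  the coefficient that overflows.\<close>

fun pmul :: "nat \<Rightarrow> bool list \<Rightarrow> bool list \<Rightarrow> bool list" where
  "pmul d [] q = zeros d"
| "pmul d (c # p) q = padd (if c then q else zeros d) (butlast (False # pmul d p q))"

text \<open>The monomial of degree \<open>w\<close>, which is zero after truncation if
  \<open>w\<close> is at least \<open>d\<close>.\<close>

fun zpow :: "nat \<Rightarrow> nat \<Rightarrow> bool list" where
  "zpow w 0 = []"
| "zpow 0 (Suc d) = True # zeros d"
| "zpow (Suc w) (Suc d) = False # zpow w d"

fun jsum :: "nat \<Rightarrow> tbl \<Rightarrow> nat list \<Rightarrow> (nat \<times> nat) list \<Rightarrow> nat \<Rightarrow> nat \<Rightarrow> (nat \<times> nat) list \<Rightarrow> bool list" where
  "jsum d t ls s i j [] = zeros d"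
| "jsum d t ls s i j ((u, v) # us) = padd (lk t ls ((i, u) # (j, v) # s)) (jsum d t ls s i j us)"

definition scaled :: "bool \<Rightarrow> nat \<Rightarrow> nat \<Rightarrow> bool list" where
  "scaled b w d = (if b then zpow w d else zeros d)"

lemma length_padd [simp]: "length (padd p q) = min (length p) (length q)"
  by (induction p q rule: padd.induct) auto

lemma length_pmul [simp]: "length q = d \<Longrightarrow> length (pmul d p q) = d"
  by (induction p) auto

lemma length_zpow [simp]: "length (zpow w d) = d"
  by (induction w d rule: zpow.induct) auto

lemma length_scaled [simp]: "length (scaled b w d) = d"
  by (simp add: scaled_def)

lemma sel_in: "ts \<noteq> [] \<Longrightarrow> sel ts n \<in> set ts"
  by (induction ts n rule: sel.induct) (auto split: nat.splits)

lemma sel_nth: "n < length ts \<Longrightarrow> sel ts n = ts ! n"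
  by (induction ts n rule: sel.induct) (auto split: nat.splits)

lemma length_lk [simp]: "shape d t ls \<Longrightarrow> length (lk t ls s) = d"
  by (induction d t ls rule: shape.induct) (auto simp: sel_in)

lemma length_jsum [simp]: "shape d t ls \<Longrightarrow> length (jsum d t ls s i j us) = d"
  by (induction us) auto

lemma length_labs: "length (labs e) \<le> nodes e"
  by (induction e) auto

lemma length_all_labs: "length (all_labs e) \<le> nodes e"
  by (induction e) auto

lemma nodes_le: "nodes e \<le> size (enc_cexpr e)"
  by (induction e) auto

lemma size_labs: "l \<in> set (labs e) \<Longrightarrow> size (enc_nat l) \<le> size (enc_cexpr e)"
  by (induction e arbitrary: l) (fastforce split: if_splits)+

lemma size_all_labs: "l \<in> set (all_labs e) \<Longrightarrow> size (enc_nat l) \<le> size (enc_cexpr e)"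
  by (induction e arbitrary: l) (fastforce split: if_splits)+

section \<open>Running times of functions on labels and lists\<close>

abbreviation (input) small :: "nat \<Rightarrow> nat \<Rightarrow> bool" where "small K l \<equiv> size (enc_nat l) \<le> K"

text \<open>\<open>K\<close> is a common bound for the tables wired into the program and, in the
  lemmas below, for all sizes of the instance. Being at least 1000, it lets one further power of
  \<open>K\<close> absorb every constant that arises.\<close>

locale bounded = tables +
  fixes K :: nat
  assumes K_ge: "1000 + 10 * a + 10 * size jtab + 10 * size wtab +
    10 * size (elist unary live_opts) + 10 * size (elist unary dead_opts) \<le> K"
    and a_pos: "0 < a"
    and jt_le: "\<lbrakk>s \<le> a; s' \<le> a; (u, v) \<in> set (jt s s')\<rbrakk> \<Longrightarrow> u \<le> a \<and> v \<le> a"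
begin

lemma K1000: "1000 \<le> K" using K_ge by simp

lemma K_step: "1000 * K ^ n \<le> K ^ Suc n" using K1000 by simp

text \<open>Makes the powers of \<open>K\<close> usable as atoms of linear arithmetic, each
  exceeding a thousandfold the one before.\<close>

lemma K_steps: "1000 \<le> K" "1000 * K \<le> K ^ 2" "1000 * K ^ 2 \<le> K ^ 3" "1000 * K ^ 3 \<le> K ^ 4"
  "1000 * K ^ 4 \<le> K ^ 5" "1000 * K ^ 5 \<le> K ^ 6" "1000 * K ^ 6 \<le> K ^ 7" "1000 * K ^ 7 \<le> K ^ 8"
  "1000 * K ^ 8 \<le> K ^ 9" "1000 * K ^ 9 \<le> K ^ 10" "1000 * K ^ 10 \<le> K ^ 11" "1000 * K ^ 11 \<le> K ^ 12"
  "1000 * K ^ 12 \<le> K ^ 13" "1000 * K ^ 13 \<le> K ^ 14" "1000 * K ^ 14 \<le> K ^ 15" "1000 * K ^ 15 \<le> K ^ 16"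
  using K1000 K_step[of 1] K_step[of 2] K_step[of 3] K_step[of 4] K_step[of 5] K_step[of 6]
    K_step[of 7] K_step[of 8] K_step[of 9] K_step[of 10] K_step[of 11] K_step[of 12] K_step[of 13]
    K_step[of 14] K_step[of 15]
  by (simp_all only: power_one_right Suc_eq_plus1 add_num_simps one_add_one arith_simps numeral_plus_one)

text \<open>A loop of linearly many rounds in \<open>K\<close> raises the exponent by one.\<close>

lemma K_mult: "n \<le> c * K \<Longrightarrow> n * K ^ m \<le> c * K ^ Suc m"
  using mult_right_mono[of n "c * K" "K ^ m"] by (simp add: mult.assoc)

text \<open>The recursion ends as soon as either tree ends, so the time depends on the first
  argument only and the second one may be arbitrarily large.\<close>

lemma eq_computes: "computes prog (ix FEq) (Cell x y) (enc_bool (x = y)) (100 * (2 * size x + 1))"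
proof (induction x arbitrary: y)
  case Atom
  show ?case by (rule computesI) (cases y; auto; simp add: HID_def)
next
  case (Cell x1 x2)
  show ?case
  proof (cases y)
    case (Cell y1 y2)
    show ?thesis unfolding Cell
      by (rule computesI) (auto intro!: computes_CALLS[OF Cell.IH(1)] computes_CALLS[OF Cell.IH(2)], auto simp: HID_def)
  qed (rule computesI, auto, auto simp: HID_def)
qed

lemma eq_nat_computes:
  assumes "small K m" shows "computes prog (ix FEq) (Cell (enc_nat m) (enc_nat n)) (enc_bool (m = n)) (K ^ 2)"
  using computes_mono[OF eq_computes[of "enc_nat m" "enc_nat n"], of "K ^ 2"] assms K_steps by simp

lemma mem_computes:
  assumes "small K l"
  shows "computes prog (ix FMem) (Cell (enc_nat l) (elabs ls)) (enc_bool (l \<in> set ls))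
    ((length ls + 1) * K ^ 3)"
proof (induction ls)
  case Nil
  show ?case using K_steps by (intro computesI) (auto, auto simp: HID_def)
next
  case (Cons y ls)
  show ?case using K_steps
    by (intro computesI) (auto intro!: computes_CALLS[OF eq_nat_computes[OF assms]] computes_CALLS[OF Cons.IH], auto simp: HID_def)
qed

lemma app_computes:
  "computes prog (ix FApp) (Cell (elist f xs) (elist f ys)) (elist f (xs @ ys)) (100 * (length xs + 1))"
proof (induction xs)
  case Nil
  show ?case by (intro computesI) (auto split: list.splits, auto simp: HID_def)
next
  case (Cons y xs)
  show ?case by (intro computesI) (auto intro!: computes_CALLS[OF Cons.IH], auto simp: HID_def)
qed

lemma rpl_computes:
  assumes "\<forall>l \<in> set ls. small K l"
  shows "computes prog (ix FRpl) (Cell (enc_nat i) (Cell (enc_nat j) (elabs ls)))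
    (elabs (map (\<lambda>l. if l = i then j else l) ls)) ((length ls + 1) * K ^ 3)"
  using assms
proof (induction ls)
  case Nil
  show ?case using K_steps by (intro computesI) (auto, auto simp: HID_def)
next
  case (Cons y ls)
  from Cons.prems have "small K y" "\<forall>l \<in> set ls. small K l" by auto
  note * = computes_CALLS[OF eq_nat_computes[OF this(1)]] computes_CALLS[OF Cons.IH[OF this(2)]]
  show ?case using K_steps by (intro computesI) (auto intro!: *, auto simp: HID_def)
qed

end

section \<open>The dynamic programming tables and the time to fill them\<close>

context tables
begin

text \<open>One table entry, for the tests given by \<open>s\<close>. The case distinction in a join
  is essential: the identity behind \<open>jt\<close> assumes that both classes are nonempty. With
  an absent label a join adds no edge, and the entry is just passed on.\<close>

fun leaf :: "nat \<Rightarrow> nat list \<Rightarrow> (nat \<times> nat) list \<Rightarrow> nat \<Rightarrow> nat cexpr \<Rightarrow> tbl \<Rightarrow> tbl \<Rightarrow>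
    (nat \<times> nat) list \<Rightarrow> bool list" where
  "leaf d ls w r (Introduce l v) ta tb s =
     (case wt (get s l) of (b0, b1, bl) \<Rightarrow>
        if v = r then scaled bl (get w v) d else padd (scaled b0 0 d) (scaled b1 (get w v) d))"
| "leaf d ls w r (Disj_Union p q) ta tb s = pmul d (lk ta ls s) (lk tb ls s)"
| "leaf d ls w r (Relabel i j p) ta tb s =
     lk ta ls (if i \<in> set (labs p) then (i, get s j) # s else s)"
| "leaf d ls w r (Join i j p) ta tb s =
     (if i \<in> set (labs p) \<and> j \<in> set (labs p) then jsum d ta ls s i j (jt (get s i) (get s j))
      else lk ta ls s)"

fun tab :: "((nat \<times> nat) list \<Rightarrow> bool list) \<Rightarrow> nat list \<Rightarrow> (nat \<times> nat) list \<Rightarrow> (nat \<times> nat) list \<Rightarrow> tbl" where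
  "tab f [] lv s = Leaf (f s)"
| "tab f (l # ls) lv s = Node (map (\<lambda>t. tab f ls lv ((l, t) # s))
     (if get lv l = 0 then dead_opts else live_opts))"

text \<open>\<open>lv\<close> records, from the root downwards, which labels still take part in a
  join above. A join marks both of its labels; below a relabelling, \<open>i\<close> inherits the
  mark of \<open>j\<close>, since its vertices carry \<open>j\<close> from then on. New marks shadow
  old ones.\<close>

fun dp :: "nat \<Rightarrow> nat list \<Rightarrow> (nat \<times> nat) list \<Rightarrow> nat \<Rightarrow> nat cexpr \<Rightarrow> (nat \<times> nat) list \<Rightarrow> tbl" where
  "dp d ls w r (Introduce l v) lv = tab (leaf d ls w r (Introduce l v) (Leaf []) (Leaf [])) ls lv []"
| "dp d ls w r (Disj_Union p q) lv =
     tab (leaf d ls w r (Disj_Union p q) (dp d ls w r p lv) (dp d ls w r q lv)) ls lv []"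
| "dp d ls w r (Relabel i j p) lv =
     tab (leaf d ls w r (Relabel i j p)
       (dp d ls w r p (if i \<in> set (labs p) then (i, get lv j) # lv else lv)) (Leaf [])) ls lv []"
| "dp d ls w r (Join i j p) lv =
     tab (leaf d ls w r (Join i j p)
       (dp d ls w r p (if i \<in> set (labs p) \<and> j \<in> set (labs p) then (i, 1) # (j, 1) # lv else lv))
       (Leaf [])) ls lv []"

definition accepts :: "nat \<Rightarrow> nat list \<Rightarrow> (nat \<times> nat) list \<Rightarrow> nat cexpr \<Rightarrow> nat \<Rightarrow> bool" where
  "accepts d ls w e r \<longleftrightarrow> True \<in> set (lk (dp d ls w r e []) ls [])"

definition ectx :: "nat \<Rightarrow> nat list \<Rightarrow> (nat \<times> nat) list \<Rightarrow> nat \<Rightarrow> sexp" where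
  "ectx d ls w r = Cell (ebits (zeros d)) (Cell (elabs ls) (Cell (eassoc w) (enc_nat r)))"

definition ejob :: "nat \<Rightarrow> nat list \<Rightarrow> (nat \<times> nat) list \<Rightarrow> nat \<Rightarrow> nat cexpr \<Rightarrow> tbl \<Rightarrow> tbl \<Rightarrow> sexp" where
  "ejob d ls w r e ta tb = Cell (ectx d ls w r) (Cell (enc_cexpr e) (Cell (etbl ta) (etbl tb)))"

fun child_shapes :: "nat \<Rightarrow> nat list \<Rightarrow> nat cexpr \<Rightarrow> tbl \<Rightarrow> tbl \<Rightarrow> bool" where
  "child_shapes d ls (Introduce l v) ta tb \<longleftrightarrow> True"
| "child_shapes d ls (Disj_Union p q) ta tb \<longleftrightarrow> shape d ta ls \<and> shape d tb ls"
| "child_shapes d ls (Relabel i j p) ta tb \<longleftrightarrow> shape d ta ls"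
| "child_shapes d ls (Join i j p) ta tb \<longleftrightarrow> shape d ta ls"

lemma length_leaf: "child_shapes d ls e ta tb \<Longrightarrow> length (leaf d ls w r e ta tb s) = d"
  by (cases e) (auto split: prod.splits)

end

context bounded
begin

lemma K_mult1: "n \<le> 2 * K \<Longrightarrow> (n + 1) * K ^ m \<le> 3 * K ^ Suc m"
  using K_mult[of "n + 1" 3 m] K1000 by simp

lemma mem_computes':
  assumes "small K l" "length ls \<le> 2 * K"
  shows "computes prog (ix FMem) (Cell (enc_nat l) (elabs ls)) (enc_bool (l \<in> set ls)) (3 * K ^ 4)"
  using computes_mono[OF mem_computes[OF assms(1)]] K_mult1[OF assms(2), of 3] by simp

lemma rpl_computes':
  assumes "\<forall>l \<in> set ls. small K l" "length ls \<le> 2 * K"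
  shows "computes prog (ix FRpl) (Cell (enc_nat i) (Cell (enc_nat j) (elabs ls)))
    (elabs (map (\<lambda>l. if l = i then j else l) ls)) (3 * K ^ 4)"
  using computes_mono[OF rpl_computes[OF assms(1)]] K_mult1[OF assms(2), of 3] by simp

lemma labs_computes:
  "size (enc_cexpr e) \<le> K \<Longrightarrow>
   computes prog (ix FLabs) (enc_cexpr e) (elabs (labs e)) (nodes e * K ^ 5)"
proof (induction e)
  case (Introduce l v)
  show ?case using K_steps
    by (intro computesI) (auto simp: MATCH_def enc_nat_numerals, auto simp: HID_def)
next
  case (Disj_Union p q)
  from Disj_Union.prems have sz: "size (enc_cexpr p) \<le> K" "size (enc_cexpr q) \<le> K" by auto
  have "length (labs p) \<le> K" using length_labs[of p] nodes_le[of p] sz by simp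
  then show ?case using K_steps
    by (intro computesI) (auto simp: MATCH_def enc_nat_numerals
      intro!: computes_CALLS[OF Disj_Union.IH(1)[OF sz(1)]] computes_CALLS[OF Disj_Union.IH(2)[OF sz(2)]]
        computes_CALLS[OF app_computes], auto simp: HID_def algebra_simps)
next
  case (Relabel i j p)
  from Relabel.prems have sz: "size (enc_cexpr p) \<le> K" by auto
  have l: "length (labs p) \<le> 2 * K" "\<forall>l \<in> set (labs p). small K l"
    using length_labs[of p] nodes_le[of p] size_labs[of _ p] sz by fastforce+
  then show ?case using K_steps
    by (intro computesI) (auto simp: MATCH_def enc_nat_numerals
      intro!: computes_CALLS[OF Relabel.IH[OF sz]] computes_CALLS[OF rpl_computes'[OF l(2) l(1)]],
      auto simp: HID_def algebra_simps)
next
  case (Join i j p)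
  from Join.prems have sz: "size (enc_cexpr p) \<le> K" by auto
  show ?case using K_steps
    by (intro computesI) (auto simp: MATCH_def enc_nat_numerals
      intro!: computes_CALLS[OF Join.IH[OF sz]], auto simp: HID_def algebra_simps)
qed

lemma labs_computes':
  assumes "size (enc_cexpr e) \<le> K"
  shows "computes prog (ix FLabs) (enc_cexpr e) (elabs (labs e)) (K ^ 6)"
  using computes_mono[OF labs_computes[OF assms]] K_mult[of "nodes e" 1 5] nodes_le[of e] assms by simp

lemma all_labs_computes:
  "size (enc_cexpr e) \<le> K \<Longrightarrow>
   computes prog (ix FAll) (enc_cexpr e) (elabs (all_labs e)) (nodes e * K ^ 7)"
proof (induction e)
  case (Introduce l v)
  show ?case using K_steps
    by (intro computesI) (auto simp: MATCH_def enc_nat_numerals, auto simp: HID_def)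
next
  case (Disj_Union p q)
  from Disj_Union.prems have sz: "size (enc_cexpr p) \<le> K" "size (enc_cexpr q) \<le> K" by auto
  have "length (all_labs p) \<le> K" using length_all_labs[of p] nodes_le[of p] sz by simp
  then show ?case using K_steps
    by (intro computesI) (auto simp: MATCH_def enc_nat_numerals
      intro!: computes_CALLS[OF Disj_Union.IH(1)[OF sz(1)]] computes_CALLS[OF Disj_Union.IH(2)[OF sz(2)]]
        computes_CALLS[OF app_computes], auto simp: HID_def algebra_simps)
next
  case (Relabel i j p)
  from Relabel.prems have sz: "size (enc_cexpr p) \<le> K" "small K i" by auto
  have l: "length (labs p) \<le> 2 * K" using length_labs[of p] nodes_le[of p] sz by simp
  show ?case using K_steps
    by (intro computesI) (auto simp: MATCH_def enc_nat_numerals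
      intro!: computes_CALLS[OF Relabel.IH[OF sz(1)]] computes_CALLS[OF mem_computes'[OF sz(2) l]]
        computes_CALLS[OF labs_computes'[OF sz(1)]],
      auto simp: HID_def algebra_simps)
next
  case (Join i j p)
  from Join.prems have sz: "size (enc_cexpr p) \<le> K" by auto
  show ?case using K_steps
    by (intro computesI) (auto simp: MATCH_def enc_nat_numerals
      intro!: computes_CALLS[OF Join.IH[OF sz]], auto simp: HID_def algebra_simps)
qed

lemma dist_computes:
  "\<lbrakk>\<forall>l \<in> set ls. small K l; length ls \<le> 2 * K\<rbrakk> \<Longrightarrow>
   computes prog (ix FDist) (elabs ls) (elabs (remdups ls)) ((length ls + 1) * K ^ 5)"
proof (induction ls)
  case Nil
  show ?case using K_steps by (intro computesI) (auto, auto simp: HID_def)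
next
  case (Cons y ls)
  then have "small K y" "length ls \<le> 2 * K" "\<forall>l \<in> set ls. small K l" by auto
  note * = computes_CALLS[OF mem_computes'[OF this(1,2)]] computes_CALLS[OF Cons.IH[OF this(3,2)]]
  show ?case using K_steps by (intro computesI) (auto intro!: *, auto simp: HID_def)
qed

lemma get_computes:
  assumes "small K l"
  shows "computes prog (ix FGet) (Cell (enc_nat l) (eassoc s)) (unary (get s l)) ((length s + 1) * K ^ 3)"
proof (induction s)
  case Nil
  show ?case using K_steps by (intro computesI) (auto, auto simp: HID_def)
next
  case (Cons h s)
  obtain y t where h: "h = (y, t)" by (cases h)
  note * = computes_CALLS[OF eq_nat_computes[OF assms]] computes_CALLS[OF Cons.IH]
  show ?case unfolding h using K_steps by (intro computesI) (auto intro!: *, auto simp: HID_def)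
qed

lemma get_computes':
  assumes "small K l" "length s \<le> 2 * K"
  shows "computes prog (ix FGet) (Cell (enc_nat l) (eassoc s)) (unary (get s l)) (3 * K ^ 4)"
  using computes_mono[OF get_computes[OF assms(1)]] K_mult1[OF assms(2), of 3] by simp

lemma nth_computes:
  "ts \<noteq> [] \<Longrightarrow> computes prog (ix FNth) (Cell (elist f ts) (unary n)) (f (sel ts n)) (100 * (n + 1))"
proof (induction ts n rule: sel.induct)
  case (1 t ts n)
  show ?case
  proof (cases n)
    case 0
    then show ?thesis by (intro computesI) (auto, auto simp: HID_def)
  next
    case (Suc m)
    show ?thesis
    proof (cases "ts = []")
      case True
      then show ?thesis unfolding Suc by (intro computesI) (auto, auto simp: HID_def)
    next
      case False
      then obtain u us where ts: "ts = u # us" by (cases ts) auto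
      have "computes prog (ix FNth) (Cell (Cell (f u) (elist f us)) (unary m)) (f (sel (u # us) m)) (100 * (m + 1))"
        using "1.IH"[OF Suc False False] unfolding ts by simp
      note * = computes_CALLS[OF this]
      show ?thesis unfolding Suc ts by (intro computesI) (auto intro!: *, auto simp: HID_def)
    qed
  qed
qed simp

text \<open>The bound is \<open>2 * K\<close> instead of \<open>K\<close> because relabellings and
  joins put one or two entries in front of a list of length at most \<open>K\<close>.\<close>

definition bounded_path :: "(nat \<times> nat) list \<Rightarrow> bool" where
  "bounded_path s \<longleftrightarrow> length s \<le> 2 * K \<and> (\<forall>(l, t) \<in> set s. t \<le> a)"

lemma get_le: "\<forall>(l, t) \<in> set s. t \<le> a \<Longrightarrow> get s l \<le> a"
  by (induction s l rule: get.induct) auto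

lemma bounded_path_get: "bounded_path s \<Longrightarrow> get s l \<le> a"
  by (auto simp: bounded_path_def intro: get_le)

lemma a_le: "10 * a \<le> K" using K_ge by simp

lemma lk_computes:
  assumes "bounded_path s"
  shows "\<lbrakk>shape d t ls; \<forall>l \<in> set ls. small K l\<rbrakk> \<Longrightarrow>
    computes prog (ix FLk) (Cell (etbl t) (Cell (elabs ls) (eassoc s))) (ebits (lk t ls s))
      ((length ls + 1) * K ^ 6)"
proof (induction d t ls rule: shape.induct)
  case (1 d p)
  show ?case using K_steps by (intro computesI) (auto, auto simp: HID_def)
next
  case (2 d ts l ls)
  from 2(2) have ts: "ts \<noteq> []" "shape d (sel ts (get s l)) ls" by (auto simp: sel_in)
  from 2(3) have sm: "small K l" "\<forall>l \<in> set ls. small K l" by auto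
  from assms have len: "length s \<le> 2 * K" by (simp add: bounded_path_def)
  note * = computes_CALLS[OF get_computes'[OF sm(1) len]] computes_CALLS[OF nth_computes[OF ts(1)]]
    computes_CALLS[OF "2.IH"[OF sel_in[OF ts(1)] ts(2) sm(2)]]
  show ?case using K_steps a_le bounded_path_get[OF assms, of l]
    unfolding etbl_Node by (intro computesI) (auto intro!: *, auto simp: HID_def)
qed simp_all

lemma lk_computes':
  assumes "bounded_path s" "shape d t ls" "\<forall>l \<in> set ls. small K l" "length ls \<le> K"
  shows "computes prog (ix FLk) (Cell (etbl t) (Cell (elabs ls) (eassoc s))) (ebits (lk t ls s)) (3 * K ^ 7)"
  using computes_mono[OF lk_computes[OF assms(1-3)]] K_mult1[of "length ls" 6] assms(4) by simp

lemma padd_computes: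
  "computes prog (ix FPadd) (Cell (ebits p) (ebits q)) (ebits (padd p q)) (100 * (length p + 1))"
proof (induction p q rule: padd.induct)
  case (1 b p c q)
  show ?case
    by (intro computesI) (auto intro!: computes_CALLS[OF "1.IH"], auto simp: HID_def)
qed ((intro computesI, auto split: list.splits, auto simp: HID_def)+)

lemma butl_computes:
  "computes prog (ix FButl) (ebits p) (ebits (butlast p)) (100 * (length p + 1))"
proof (induction p)
  case Nil
  show ?case by (intro computesI) (auto, auto simp: HID_def)
next
  case (Cons b p)
  show ?case
  proof (cases p)
    case Nil
    then show ?thesis by (intro computesI) (auto, auto simp: HID_def)
  next
    case p: (Cons c q)
    note * = computes_CALLS[OF Cons.IH[unfolded p elist_simps]]
    show ?thesis unfolding p by (intro computesI) (auto intro!: *, auto simp: HID_def)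
  qed
qed

lemma pmul_computes:
  assumes "length q = d" "d \<le> K"
  shows "computes prog (ix FPmul) (Cell (ebits (zeros d)) (Cell (ebits p) (ebits q))) (ebits (pmul d p q))
    ((length p + 1) * K ^ 2)"
proof (induction p)
  case Nil
  show ?case using K_steps by (intro computesI) (auto, auto simp: HID_def)
next
  case (Cons c p)
  define r where "r = butlast (False # pmul d p q)"
  have b: "computes prog (ix FButl) (Cell Atom (ebits (pmul d p q))) (ebits r) (100 * (d + 2))"
    using butl_computes[of "False # pmul d p q"] assms by (simp add: r_def)
  have p: "computes prog (ix FPadd) (Cell (ebits y) (ebits r)) (ebits (padd y r)) (100 * (d + 1))"
    if "length y = d" for y
    using padd_computes[of y r] that by simp
  note * = computes_CALLS[OF b] computes_CALLS[OF p[OF assms(1)]] computes_CALLS[OF p[of "zeros d"]]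
    computes_CALLS[OF Cons.IH]
  have "pmul d (c # p) q = padd (if c then q else zeros d) r" by (simp add: r_def)
  then show ?case using K_steps assms(2)
    by (cases c; intro computesI) (auto intro!: *, auto simp: HID_def)
qed

lemma zpow_computes:
  "computes prog (ix FMono) (Cell (unary w) (ebits (zeros d))) (ebits (zpow w d)) (100 * (d + 1))"
proof (induction w d rule: zpow.induct)
  case (3 w d)
  show ?case by (intro computesI) (auto intro!: computes_CALLS[OF "3.IH"], auto simp: HID_def)
qed ((intro computesI, auto split: nat.splits, auto simp: HID_def)+)

lemma epairs_simps [simp]:
  "epairs [] = Atom" "epairs ((u, v) # us) = Cell (Cell (unary u) (unary v)) (epairs us)"
  by (simp_all add: epairs_def)

lemma jsum_computes:
  assumes "bounded_path s" "length s \<le> K" "shape d t ls" "\<forall>l \<in> set ls. small K l" "length ls \<le> K" "d \<le> K"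
  shows "\<forall>(u, v) \<in> set us. u \<le> a \<and> v \<le> a \<Longrightarrow>
    computes prog (ix FJsum) (Cell (Cell (ebits (zeros d)) (Cell (etbl t) (Cell (elabs ls) (eassoc s))))
      (Cell (enc_nat i) (Cell (enc_nat j) (epairs us)))) (ebits (jsum d t ls s i j us)) ((length us + 1) * K ^ 8)"
proof (induction us)
  case Nil
  show ?case using K_steps by (intro computesI) (auto, auto simp: HID_def)
next
  case (Cons h us)
  obtain u v where h: "h = (u, v)" by (cases h)
  have b: "bounded_path ((i, u) # (j, v) # s)" using assms(1,2) Cons.prems K1000
    by (auto simp: bounded_path_def h)
  have l: "computes prog (ix FLk) (Cell (etbl t) (Cell (elabs ls) (Cell (Cell (enc_nat i) (unary u))
      (Cell (Cell (enc_nat j) (unary v)) (eassoc s))))) (ebits (lk t ls ((i, u) # (j, v) # s))) (3 * K ^ 7)"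
    using lk_computes'[OF b assms(3-5)] by simp
  from Cons have IH: "computes prog (ix FJsum) (Cell (Cell (ebits (zeros d)) (Cell (etbl t) (Cell (elabs ls) (eassoc s))))
      (Cell (enc_nat i) (Cell (enc_nat j) (epairs us)))) (ebits (jsum d t ls s i j us)) ((length us + 1) * K ^ 8)"
    by auto
  show ?case unfolding h using K_steps assms(3,6)
    by (intro computesI) (auto intro!: computes_CALLS[OF l] computes_CALLS[OF IH] computes_CALLS[OF padd_computes],
      auto simp: HID_def)
qed

end

context bounded
begin

lemma sel_upt: "n \<le> a \<Longrightarrow> sel [0..<Suc a] n = n"
  by (simp add: sel_nth del: upt_Suc)

lemma jtab_row_computes:
  assumes "n \<le> a"
  shows "computes prog (ix FNth) (Cell jtab (unary n)) (elist (\<lambda>s'. epairs (jt n s')) [0..<Suc a]) (K ^ 2)"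
  using computes_mono[OF nth_computes[of "[0..<Suc a]" "\<lambda>s. elist (\<lambda>s'. epairs (jt s s')) [0..<Suc a]" n], of "K ^ 2"]
    assms K_steps a_le
  by (simp add: jtab_def sel_upt del: upt_Suc)

lemma jtab_computes:
  assumes "n \<le> a"
  shows "computes prog (ix FNth) (Cell (elist (\<lambda>s'. epairs (jt m s')) [0..<Suc a]) (unary n)) (epairs (jt m n)) (K ^ 2)"
  using computes_mono[OF nth_computes[of "[0..<Suc a]" "\<lambda>s'. epairs (jt m s')" n], of "K ^ 2"]
    assms K_steps a_le
  by (simp add: sel_upt del: upt_Suc)

lemma wtab_computes:
  assumes "n \<le> a"
  shows "computes prog (ix FNth) (Cell wtab (unary n)) (ewt (wt n)) (K ^ 2)"
  using computes_mono[OF nth_computes[of "[0..<Suc a]" "\<lambda>s. ewt (wt s)" n], of "K ^ 2"]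
    assms K_steps a_le
  by (simp add: wtab_def sel_upt del: upt_Suc)

lemma size_elist: "x \<in> set xs \<Longrightarrow> size (f x) \<le> size (elist f xs)" "length xs \<le> size (elist f xs)"
  by (induction xs) auto

lemma length_jt:
  assumes "m \<le> a" "n \<le> a" shows "length (jt m n) \<le> K"
proof -
  have "size (elist (\<lambda>s'. epairs (jt m s')) [0..<Suc a]) \<le> size jtab"
    unfolding jtab_def using assms by (intro size_elist(1)) auto
  moreover have "size (epairs (jt m n)) \<le> size (elist (\<lambda>s'. epairs (jt m s')) [0..<Suc a])"
    using assms by (intro size_elist(1)[of n _ "\<lambda>s'. epairs (jt m s')"]) auto
  moreover have "length (jt m n) \<le> size (epairs (jt m n))"
    unfolding epairs_def by (rule size_elist(2))
  ultimately show ?thesis using K_ge by linarith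
qed

lemma scaled_computes:
  assumes "d \<le> K"
  shows "computes prog (ix FMono) (Cell (unary w) (ebits (zeros d))) (ebits (zpow w d)) (K ^ 2)"
  using computes_mono[OF zpow_computes] assms K_steps by simp

lemma leaf_computes:
  assumes path: "bounded_path s" "length s \<le> K"
    and ls: "\<forall>l \<in> set ls. small K l" "length ls \<le> K" and d: "d \<le> K" and w: "length w \<le> K"
    and e: "size (enc_cexpr e) \<le> K" and sh: "child_shapes d ls e ta tb"
  shows "computes prog (ix FLeaf) (Cell (ejob d ls w r e ta tb) (eassoc s))
    (ebits (leaf d ls w r e ta tb s)) (K ^ 10)"
proof (cases e)
  case (Introduce l v)
  from e Introduce have sm: "small K l" "small K v" by auto
  from path w have len: "length s \<le> 2 * K" "length w \<le> 2 * K" by simp_all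
  obtain b0 b1 bl where wt: "wt (get s l) = (b0, b1, bl)" by (metis prod_cases3)
  have pa: "computes prog (ix FPadd) (Cell (ebits p) (ebits q)) (ebits (padd p q)) (K ^ 2)"
    if "length p = d" for p q
    using computes_mono[OF padd_computes[of p q], of "K ^ 2"] that d K_steps by simp
  have z: "computes prog (ix FMono) (Cell Atom (ebits (zeros d))) (ebits (zpow 0 d)) (K ^ 2)"
    using scaled_computes[OF d, of 0] by simp
  note * = computes_CALLS[OF get_computes'[OF sm(1) len(1)]] computes_CALLS[OF get_computes'[OF _ len(2)]]
    computes_CALLS[OF wtab_computes[OF bounded_path_get[OF path(1)]]]
    computes_CALLS[OF scaled_computes[OF d]] computes_CALLS[OF z] computes_CALLS[OF eq_nat_computes[OF sm(2)]]
    computes_CALLS[OF pa]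
  show ?thesis unfolding Introduce ejob_def ectx_def using K_steps K_ge sm
    by (intro computesI) (auto simp: MATCH_def enc_nat_numerals ewt_def wt intro!: *, auto simp: HID_def wt scaled_def)
next
  case (Disj_Union p q)
  with sh have sh: "shape d ta ls" "shape d tb ls" by simp_all
  have len: "length (lk ta ls s) = d" "length (lk tb ls s) = d" using sh by simp_all
  have m: "computes prog (ix FPmul) (Cell (ebits (zeros d)) (Cell (ebits (lk ta ls s)) (ebits (lk tb ls s))))
      (ebits (pmul d (lk ta ls s) (lk tb ls s))) (3 * K ^ 3)"
    using computes_mono[OF pmul_computes[OF len(2) d]] K_mult1[of d 2] len d by simp
  note * = computes_CALLS[OF lk_computes'[OF path(1) sh(1) ls]] computes_CALLS[OF lk_computes'[OF path(1) sh(2) ls]]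
    computes_CALLS[OF m]
  show ?thesis unfolding Disj_Union ejob_def ectx_def using K_steps
    by (intro computesI) (auto simp: MATCH_def enc_nat_numerals intro!: *, auto simp: HID_def)
next
  case (Relabel i j p)
  with sh have sh: "shape d ta ls" by simp
  from e Relabel have sz: "small K i" "small K j" "size (enc_cexpr p) \<le> K" by auto
  from path have len: "length s \<le> 2 * K" by simp
  have lp: "length (labs p) \<le> 2 * K" using length_labs[of p] nodes_le[of p] sz by simp
  have b: "bounded_path ((i, get s j) # s)"
    using path bounded_path_get[OF path(1)] K1000 by (auto simp: bounded_path_def)
  have l: "computes prog (ix FLk) (Cell (etbl ta) (Cell (elabs ls) (Cell (Cell (enc_nat i) (unary (get s j))) (eassoc s))))
      (ebits (lk ta ls ((i, get s j) # s))) (3 * K ^ 7)"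
    using lk_computes'[OF b sh ls] by simp
  note * = computes_CALLS[OF lk_computes'[OF path(1) sh ls]] computes_CALLS[OF l]
    computes_CALLS[OF mem_computes'[OF sz(1) lp]] computes_CALLS[OF labs_computes'[OF sz(3)]]
    computes_CALLS[OF get_computes'[OF sz(2) len]]
  show ?thesis unfolding Relabel ejob_def ectx_def using K_steps
    by (intro computesI) (auto simp: MATCH_def enc_nat_numerals intro!: *, auto simp: HID_def)
next
  case (Join i j p)
  with sh have sh: "shape d ta ls" by simp
  from e Join have sz: "small K i" "small K j" "size (enc_cexpr p) \<le> K" by auto
  from path have len: "length s \<le> 2 * K" by simp
  have lp: "length (labs p) \<le> 2 * K" using length_labs[of p] nodes_le[of p] sz by simp
  note g = bounded_path_get[OF path(1)]
  have jr: "\<forall>(u, v) \<in> set (jt (get s i) (get s j)). u \<le> a \<and> v \<le> a"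
    using jt_le[OF g g] by blast
  have js: "computes prog (ix FJsum) (Cell (Cell (ebits (zeros d)) (Cell (etbl ta) (Cell (elabs ls) (eassoc s))))
      (Cell (enc_nat i) (Cell (enc_nat j) (epairs (jt (get s i) (get s j))))))
      (ebits (jsum d ta ls s i j (jt (get s i) (get s j)))) (3 * K ^ 9)"
    using computes_mono[OF jsum_computes[OF path sh ls d jr]] K_mult1[of "length (jt (get s i) (get s j))" 8]
      length_jt[OF g g, of i j] by simp
  note * = computes_CALLS[OF lk_computes'[OF path(1) sh ls]]
    computes_CALLS[OF mem_computes'[OF sz(1) lp]] computes_CALLS[OF mem_computes'[OF sz(2) lp]]
    computes_CALLS[OF labs_computes'[OF sz(3)]]
    computes_CALLS[OF get_computes'[OF sz(1) len]] computes_CALLS[OF get_computes'[OF sz(2) len]]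
    computes_CALLS[OF jtab_row_computes[OF g]] computes_CALLS[OF jtab_computes[OF g]] computes_CALLS[OF js]
  show ?thesis unfolding Join ejob_def ectx_def using K_steps K_ge
    by (intro computesI) (auto simp: MATCH_def enc_nat_numerals intro!: *, auto simp: HID_def)
qed

lemma tabs_computes:
  assumes tab: "\<And>t. t \<le> a \<Longrightarrow> computes prog (ix FTab)
      (Cell job (Cell (elabs ls) (Cell (eassoc lv) (eassoc ((l, t) # s))))) (etbl (g t)) T"
  shows "\<forall>t \<in> set ts. t \<le> a \<Longrightarrow> computes prog (ix FTabs)
    (Cell job (Cell (elabs ls) (Cell (eassoc lv) (Cell (eassoc s) (Cell (enc_nat l) (elist unary ts))))))
    (elist etbl (map g ts)) (length ts * (T + 100) + 100)"
proof (induction ts)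
  case Nil
  show ?case by (intro computesI) (auto, auto simp: HID_def)
next
  case (Cons t ts)
  then have t: "t \<le> a" and IH: "computes prog (ix FTabs)
    (Cell job (Cell (elabs ls) (Cell (eassoc lv) (Cell (eassoc s) (Cell (enc_nat l) (elist unary ts))))))
    (elist etbl (map g ts)) (length ts * (T + 100) + 100)" by auto
  have tb: "computes prog (ix FTab)
      (Cell job (Cell (elabs ls) (Cell (eassoc lv) (Cell (Cell (enc_nat l) (unary t)) (eassoc s))))) (etbl (g t)) T"
    using tab[OF t] by simp
  show ?case by (intro computesI) (auto intro!: computes_CALLS[OF tb] computes_CALLS[OF IH], auto simp: HID_def algebra_simps)
qed

text \<open>One level costs at most \<open>a\<close> times the level below plus
  \<open>K ^ 6\<close>. As \<open>K ^ 6\<close> is at most \<open>a ^ Suc n * K ^ 6\<close>, these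
  overheads collect in the second factor as \<open>length ls * K ^ 6\<close>, and the exponential
  factor stays exactly \<open>a ^ length ls\<close>.\<close>

lemma tab_computes:
  assumes leaf: "\<And>s. bounded_path s \<Longrightarrow> length s \<le> K \<Longrightarrow>
      computes prog (ix FLeaf) (Cell job (eassoc s)) (ebits (f s)) (K ^ 10)"
    and lv: "length lv \<le> 2 * K"
  shows "\<lbrakk>\<forall>l \<in> set ls. small K l; bounded_path s; length s + length ls \<le> K\<rbrakk> \<Longrightarrow>
    computes prog (ix FTab) (Cell job (Cell (elabs ls) (Cell (eassoc lv) (eassoc s)))) (etbl (tab f ls lv s))
      (a ^ length ls * (K ^ 10 + 1000 + length ls * K ^ 6))"
proof (induction ls arbitrary: s)
  case Nil
  then have "length s \<le> K" by simp
  note * = computes_CALLS[OF leaf[OF Nil(2) this]]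
  show ?case by (intro computesI) (auto intro!: *, auto simp: HID_def)
next
  case (Cons l ls)
  let ?T = "a ^ length ls * (K ^ 10 + 1000 + length ls * K ^ 6)"
  let ?ts = "if get lv l = 0 then dead_opts else live_opts"
  from Cons.prems have sm: "small K l" "\<forall>l \<in> set ls. small K l" by auto
  have IH: "computes prog (ix FTab) (Cell job (Cell (elabs ls) (Cell (eassoc lv) (eassoc ((l, t) # s)))))
      (etbl (tab f ls lv ((l, t) # s))) ?T" if "t \<le> a" for t
    using Cons.prems that by (intro Cons.IH) (auto simp: bounded_path_def)
  have ts: "\<forall>t \<in> set ?ts. t \<le> a" "length ?ts \<le> a" using a_pos by (auto simp: live_opts_def dead_opts_def)
  have Tb: "length ts * (?T + 100) + 100 \<le> a * ?T + 200 * K" if "length ts \<le> a" for ts :: "nat list"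
  proof -
    have "length ts * (?T + 100) \<le> a * (?T + 100)" using that by (intro mult_right_mono) auto
    then show ?thesis using a_le K1000 by (simp add: algebra_simps)
  qed
  have tabs: "computes prog (ix FTabs)
    (Cell job (Cell (elabs ls) (Cell (eassoc lv) (Cell (eassoc s) (Cell (enc_nat l) (elist unary ts))))))
    (elist etbl (map (\<lambda>t. tab f ls lv ((l, t) # s)) ts)) (a * ?T + 200 * K)"
    if "\<forall>t \<in> set ts. t \<le> a" "length ts \<le> a" for ts
    by (rule computes_mono[OF tabs_computes[OF IH that(1)] Tb[OF that(2)]])
  have l: "\<forall>t \<in> set live_opts. t \<le> a" "length live_opts \<le> a" "\<forall>t \<in> set dead_opts. t \<le> a" "length dead_opts \<le> a"
    using a_pos by (auto simp: live_opts_def dead_opts_def)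
  note * = computes_CALLS[OF get_computes'[OF sm(1) lv]] computes_CALLS[OF tabs[OF l(1,2)]] computes_CALLS[OF tabs[OF l(3,4)]]
  have "K ^ 6 \<le> a ^ Suc (length ls) * K ^ 6" using a_pos by simp
  then have T: "a * ?T + K ^ 6 \<le> a ^ length (l # ls) * (K ^ 10 + 1000 + length (l # ls) * K ^ 6)"
    by (simp add: algebra_simps)
  have "computes prog (ix FTab) (Cell job (Cell (elabs (l # ls)) (Cell (eassoc lv) (eassoc s))))
      (etbl (tab f (l # ls) lv s)) (a * ?T + K ^ 6)"
    using K_steps K_ge
    by (intro computesI) (auto intro!: * split: nat.splits simp del: mult.assoc, auto simp: HID_def elist_def)
  from computes_mono[OF this T] show ?case .
qed

lemma shape_tab:
  assumes "\<And>s. length (f s) = d" shows "shape d (tab f ls lv s) ls"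
  using assms a_pos by (induction ls arbitrary: s) (auto simp: live_opts_def dead_opts_def)

lemma shape_dp: "shape d (dp d ls w r e lv) ls"
  by (induction e arbitrary: lv) (auto intro!: shape_tab length_leaf)

end

section \<open>Random weights and unary arithmetic\<close>

declare enc_nat_numerals [simp]

fun lg :: "nat \<Rightarrow> nat" where
  "lg n = (if n = 0 then 0 else Suc (lg (n div 2)))"

declare lg.simps [simp del]

fun weights :: "nat \<Rightarrow> nat \<Rightarrow> (nat \<times> nat) list \<Rightarrow> bool list \<Rightarrow> (nat \<times> nat) list" where
  "weights m M [] r = []"
| "weights m M ((v, c) # cs) r = (v, M * c + val (take m r)) # weights m M cs (drop m r)"

abbreviation (input) total :: "(nat \<times> nat) list \<Rightarrow> nat" where "total cs \<equiv> (\<Sum>(v, c)\<leftarrow>cs. c)"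

abbreviation ecosts :: "(nat \<times> nat) list \<Rightarrow> sexp" where
  "ecosts \<equiv> elist (\<lambda>(v, c). Cell (enc_nat v) (enc_nat c))"

lemma unary_elist: "unary n = elist (\<lambda>_. Atom) (replicate n ())"
  by (induction n) auto

lemma val_less: "val p < 2 ^ length p"
  by (induction p) auto

lemma length_weights [simp]: "length (weights m M cs r) = length cs"
  by (induction m M cs r rule: weights.induct) auto

lemma fst_weights [simp]: "map fst (weights m M cs r) = map fst cs"
  by (induction m M cs r rule: weights.induct) auto

context bounded
begin

lemma tab_leaf_computes:
  assumes ls: "\<forall>l \<in> set ls. small K l" "length ls \<le> K" and d: "d \<le> K" and w: "length w \<le> K"
    and e: "size (enc_cexpr e) \<le> K" and sh: "child_shapes d ls e ta tb" and lv: "length lv \<le> 2 * K"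
  shows "computes prog (ix FTab)
    (Cell (Cell (ectx d ls w r) (Cell (enc_cexpr e) (Cell (etbl ta) (etbl tb)))) (Cell (elabs ls) (Cell (eassoc lv) Atom)))
      (etbl (tab (leaf d ls w r e ta tb) ls lv [])) (a ^ length ls * (3 * K ^ 10))"
proof -
  have "bounded_path []" by (simp add: bounded_path_def)
  note 1 = tab_computes[where f = "leaf d ls w r e ta tb",
      OF leaf_computes[OF _ _ ls d w e sh] lv ls(1) this, simplified, OF ls(2)]
  have "length ls * K ^ 6 \<le> 1 * K ^ Suc 6" using K_mult[of "length ls" 1 6] ls(2) by simp
  then have "K ^ 10 + 1000 + length ls * K ^ 6 \<le> 3 * K ^ 10" using K_steps by simp
  then have "a ^ length ls * (K ^ 10 + 1000 + length ls * K ^ 6) \<le> a ^ length ls * (3 * K ^ 10)"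
    by (rule mult_left_mono) simp
  from computes_mono[OF 1 this] show ?thesis by (simp add: ejob_def)
qed

text \<open>Additive overhead outside the table is charged to the table itself, which has at least
  one entry.\<close>

lemma pow_slack: "a ^ n * (3 * K ^ 10) + K ^ 8 \<le> a ^ n * K ^ 12"
proof -
  have "1 * K ^ 8 \<le> a ^ n * K ^ 8" using a_pos by (intro mult_right_mono) auto
  moreover have "a ^ n * (3 * K ^ 10 + K ^ 8) \<le> a ^ n * K ^ 12"
    using K_steps by (intro mult_left_mono) auto
  ultimately show ?thesis unfolding distrib_left by linarith
qed

text \<open>The invariant on \<open>length lv\<close> pays for the at most two marks that each node
  pushes onto \<open>lv\<close> on the way down.\<close>

lemma dp_computes:
  assumes ls: "\<forall>l \<in> set ls. small K l" "length ls \<le> K" and d: "d \<le> K" and w: "length w \<le> K"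
  shows "\<lbrakk>size (enc_cexpr e) \<le> K; length lv + 2 * nodes e \<le> 2 * K\<rbrakk> \<Longrightarrow>
    computes prog (ix FDp) (Cell (ectx d ls w r) (Cell (enc_cexpr e) (eassoc lv)))
      (etbl (dp d ls w r e lv)) (nodes e * (a ^ length ls * K ^ 12))"
proof (induction e arbitrary: lv)
  case (Introduce l v)
  then have lv: "length lv \<le> 2 * K" by simp
  have "computes prog (ix FTab)
    (Cell (Cell (ectx d ls w r) (Cell (enc_cexpr (Introduce l v)) (Cell Atom Atom))) (Cell (elabs ls) (Cell (eassoc lv) Atom)))
      (etbl (dp d ls w r (Introduce l v) lv)) (a ^ length ls * (3 * K ^ 10))"
    using tab_leaf_computes[OF ls d w Introduce(1) _ lv, of "Leaf []" "Leaf []" r] by simp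
  note * = computes_CALLS[OF this[unfolded ectx_def]]
  \<comment> \<open>Executes the match while keeping the encoded expression folded, because the
    whole expression is also stored in the job handed to \<open>FTab\<close>.\<close>
  have m: "RUN prog env (MATCH (Var k) (\<lambda>_ _. TT) fu fr fj) \<Phi> \<longleftrightarrow> \<Phi> (Cell Atom Atom) 11"
    if "k < length env" "env ! (length env - Suc k) = enc_cexpr (Introduce l v)" for k env fu fr fj \<Phi>
    using that by (simp add: MATCH_def enc_nat_numerals numeral_eq_Suc)
  show ?case using K_steps pow_slack[of "length ls"] unfolding ectx_def
    by (intro computesI) (auto intro!: * simp: m simp del: enc_cexpr.simps dp.simps, auto simp: HID_def)
next
  case (Disj_Union p q)
  let ?e = "Disj_Union p q" and ?ta = "dp d ls w r p lv" and ?tb = "dp d ls w r q lv"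
  from Disj_Union.prems have sz: "size (enc_cexpr p) \<le> K" "size (enc_cexpr q) \<le> K"
    "length lv + 2 * nodes p \<le> 2 * K" "length lv + 2 * nodes q \<le> 2 * K" and lv: "length lv \<le> 2 * K" by auto
  have "computes prog (ix FTab)
    (Cell (Cell (ectx d ls w r) (Cell (enc_cexpr ?e) (Cell (etbl ?ta) (etbl ?tb)))) (Cell (elabs ls) (Cell (eassoc lv) Atom)))
      (etbl (dp d ls w r ?e lv)) (a ^ length ls * (3 * K ^ 10))"
    using tab_leaf_computes[OF ls d w Disj_Union.prems(1) _ lv, of ?ta ?tb r] shape_dp by simp
  note * = computes_CALLS[OF this[unfolded ectx_def]]
    computes_CALLS[OF Disj_Union.IH(1)[OF sz(1,3), unfolded ectx_def]]
    computes_CALLS[OF Disj_Union.IH(2)[OF sz(2,4), unfolded ectx_def]]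
  show ?case using K_steps pow_slack[of "length ls"] unfolding ectx_def
    by (intro computesI) (auto intro!: *[simplified] simp: MATCH_def enc_nat_numerals simp del: dp.simps,
      auto simp: HID_def algebra_simps)
next
  case (Relabel i j p)
  let ?e = "Relabel i j p"
  let ?lv = "if i \<in> set (labs p) then (i, get lv j) # lv else lv"
  let ?ta = "dp d ls w r p ?lv"
  from Relabel.prems have sz: "size (enc_cexpr p) \<le> K" "small K i" "small K j"
    "length ?lv + 2 * nodes p \<le> 2 * K" and lv: "length lv \<le> 2 * K" by auto
  have lp: "length (labs p) \<le> 2 * K" using length_labs[of p] nodes_le[of p] sz by simp
  have "computes prog (ix FTab)
    (Cell (Cell (ectx d ls w r) (Cell (enc_cexpr ?e) (Cell (etbl ?ta) Atom))) (Cell (elabs ls) (Cell (eassoc lv) Atom)))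
      (etbl (dp d ls w r ?e lv)) (a ^ length ls * (3 * K ^ 10))"
    using tab_leaf_computes[OF ls d w Relabel.prems(1) _ lv, of ?ta "Leaf []" r] shape_dp by simp
  note 1 = computes_CALLS[OF this[unfolded ectx_def]]
    computes_CALLS[OF Relabel.IH[OF sz(1,4), unfolded ectx_def]]
  note * = computes_CALLS[OF mem_computes'[OF sz(2) lp]] computes_CALLS[OF labs_computes'[OF sz(1)]]
    computes_CALLS[OF get_computes'[OF sz(3) lv]]
  show ?case
  proof (cases "i \<in> set (labs p)")
    case True
    show ?thesis using K_steps pow_slack[of "length ls"] True unfolding ectx_def
      by (intro computesI) (auto intro!: * 1[simplified True if_True, simplified] simp: MATCH_def enc_nat_numerals simp del: dp.simps,
        auto simp: HID_def algebra_simps)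
  next
    case False
    show ?thesis using K_steps pow_slack[of "length ls"] False unfolding ectx_def
      by (intro computesI) (auto intro!: * 1[simplified False if_False, simplified] simp: MATCH_def enc_nat_numerals simp del: dp.simps,
        auto simp: HID_def algebra_simps)
  qed
next
  case (Join i j p)
  let ?e = "Join i j p"
  let ?b = "i \<in> set (labs p) \<and> j \<in> set (labs p)"
  let ?lv = "if ?b then (i, 1) # (j, 1) # lv else lv"
  let ?ta = "dp d ls w r p ?lv"
  from Join.prems have sz: "size (enc_cexpr p) \<le> K" "small K i" "small K j"
    "length ?lv + 2 * nodes p \<le> 2 * K" and lv: "length lv \<le> 2 * K" by auto
  have lp: "length (labs p) \<le> 2 * K" using length_labs[of p] nodes_le[of p] sz by simp
  have "computes prog (ix FTab)
    (Cell (Cell (ectx d ls w r) (Cell (enc_cexpr ?e) (Cell (etbl ?ta) Atom))) (Cell (elabs ls) (Cell (eassoc lv) Atom)))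
      (etbl (dp d ls w r ?e lv)) (a ^ length ls * (3 * K ^ 10))"
    using tab_leaf_computes[OF ls d w Join.prems(1) _ lv, of ?ta "Leaf []" r] shape_dp by simp
  note 1 = computes_CALLS[OF this[unfolded ectx_def]]
    computes_CALLS[OF Join.IH[OF sz(1,4), unfolded ectx_def]]
  note * = computes_CALLS[OF mem_computes'[OF sz(2) lp]] computes_CALLS[OF mem_computes'[OF sz(3) lp]]
    computes_CALLS[OF labs_computes'[OF sz(1)]]
  show ?case
  proof (cases ?b)
    case True
    show ?thesis using K_steps pow_slack[of "length ls"] True unfolding ectx_def
      by (intro computesI) (auto intro!: * 1[simplified True if_True, simplified] simp: MATCH_def enc_nat_numerals simp del: dp.simps,
        auto simp: HID_def algebra_simps)
  next
    case False
    show ?thesis using K_steps pow_slack[of "length ls"] False unfolding ectx_def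
      by (intro computesI) (auto intro!: * 1[simplified False if_False, simplified] simp: MATCH_def enc_nat_numerals simp del: dp.simps,
        auto simp: HID_def algebra_simps)
  qed
qed

lemma or_computes: "computes prog (ix FOr) (ebits p) (enc_bool (True \<in> set p)) (100 * (length p + 1))"
proof (induction p)
  case Nil
  show ?case by (intro computesI) (auto, auto simp: HID_def)
next
  case (Cons b p)
  show ?case by (intro computesI) (auto intro!: computes_CALLS[OF Cons.IH], auto simp: HID_def)
qed

lemma any_computes:
  assumes ls: "\<forall>l \<in> set ls. small K l" "length ls \<le> K" and d: "d \<le> K" and w: "length w \<le> K"
    and e: "size (enc_cexpr e) \<le> K"
  shows "computes prog (ix FAny)
    (Cell (eassoc vs) (Cell (enc_cexpr e) (Cell (ebits (zeros d)) (Cell (elabs ls) (eassoc w)))))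
    (enc_bool (\<exists>(v, x) \<in> set vs. accepts d ls w e v)) ((length vs + 1) * (a ^ length ls * K ^ 14))"
proof (induction vs)
  case Nil
  have "1 * K ^ 14 \<le> a ^ length ls * K ^ 14" using a_pos by (intro mult_right_mono) auto
  then have "1000 \<le> a ^ length ls * K ^ 14" using K_steps by linarith
  then show ?case by (intro computesI) (auto, auto simp: HID_def)
next
  case (Cons h vs)
  obtain v x where h: "h = (v, x)" by (cases h)
  let ?A = "a ^ length ls"
  have n: "nodes e \<le> K" using nodes_le[of e] e by simp
  have "computes prog (ix FDp) (Cell (ectx d ls w v) (Cell (enc_cexpr e) Atom))
      (etbl (dp d ls w v e [])) (nodes e * (?A * K ^ 12))"
    using dp_computes[OF ls d w e, of "[]" v] n by simp
  moreover have "nodes e * (?A * K ^ 12) \<le> ?A * K ^ 13"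
    using mult_left_mono[OF K_mult[of "nodes e" 1 12], of ?A] n by (simp add: mult.left_commute)
  ultimately have D: "computes prog (ix FDp) (Cell (ectx d ls w v) (Cell (enc_cexpr e) Atom))
      (etbl (dp d ls w v e [])) (?A * K ^ 13)" by (rule computes_mono)
  have L: "computes prog (ix FLk) (Cell (etbl (dp d ls w v e [])) (Cell (elabs ls) Atom))
      (ebits (lk (dp d ls w v e []) ls [])) (3 * K ^ 7)"
    using lk_computes'[OF _ shape_dp ls, of "[]"] by (simp add: bounded_path_def)
  have R: "computes prog (ix FOr) (ebits (lk (dp d ls w v e []) ls [])) (enc_bool (accepts d ls w e v)) (K ^ 2)"
    unfolding accepts_def using computes_mono[OF or_computes, of _ "K ^ 2"] length_lk[OF shape_dp] d K_steps by simp
  have "1 * K ^ 13 \<le> ?A * K ^ 13" using a_pos by (intro mult_right_mono) auto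
  then have "?A * K ^ 13 + K ^ 12 \<le> ?A * (2 * K ^ 13)" using K_steps by linarith
  also have "\<dots> \<le> ?A * K ^ 14" using K_steps by (intro mult_left_mono) auto
  finally have T: "?A * K ^ 13 + K ^ 12 \<le> ?A * K ^ 14" .
  note * = computes_CALLS[OF D[unfolded ectx_def]] computes_CALLS[OF L] computes_CALLS[OF R] computes_CALLS[OF Cons.IH]
  show ?case unfolding h using K_steps T
    by (intro computesI) (auto intro!: *, auto simp: HID_def algebra_simps)
qed

lemma add_computes: "computes prog (ix FApp) (Cell (unary m) (unary n)) (unary (m + n)) (100 * (m + 1))"
  using app_computes[of "\<lambda>_. Atom" "replicate m ()" "replicate n ()"]
  by (simp add: unary_elist replicate_add)

lemma len_computes: "computes prog (ix FLen) (elist f xs) (unary (length xs)) (100 * (length xs + 1))"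
proof (induction xs)
  case Nil
  show ?case by (intro computesI) (auto, auto simp: HID_def)
next
  case (Cons x xs)
  show ?case by (intro computesI) (auto intro!: computes_CALLS[OF Cons.IH], auto simp: HID_def)
qed

lemma mul_computes:
  "computes prog (ix FMul) (Cell (unary m) (unary n)) (unary (m * n)) ((m + 1) * (200 * (n + 1)))"
proof (induction m)
  case 0
  show ?case by (intro computesI) (auto, auto simp: HID_def)
next
  case (Suc m)
  show ?case
    by (intro computesI) (auto intro!: computes_CALLS[OF Suc.IH] computes_CALLS[OF add_computes], auto simp: HID_def)
qed

lemma min_computes:
  "computes prog (ix FMin) (Cell (unary m) (unary n)) (unary (min m n)) (100 * (m + 1))"
proof (induction m arbitrary: n)
  case 0
  show ?case by (intro computesI) (auto, auto simp: HID_def)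
next
  case (Suc m)
  show ?case
    by (cases n; intro computesI) (auto intro!: computes_CALLS[OF Suc.IH], auto simp: HID_def)
qed

lemma val_computes:
  "computes prog (ix FVal) (ebits p) (unary (val p)) ((length p + 1) * (200 * (val p + 1)))"
proof (induction p)
  case Nil
  show ?case by (intro computesI) (auto, auto simp: HID_def)
next
  case (Cons b p)
  have "(length p + 1) * (200 * (val p + 1)) \<le> (length p + 1) * (200 * (val (b # p) + 1))"
    by (intro mult_left_mono) auto
  then show ?case
    by (intro computesI) (auto intro!: computes_CALLS[OF Cons.IH] computes_CALLS[OF add_computes],
      auto simp: HID_def mult_2)
qed

text \<open>The budget is given in binary and can be exponentially large, so it must not be expanded
  to unary. Capping after every digit keeps intermediate values at most
  \<open>2 * u + 1\<close>.\<close>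

lemma cap_computes:
  "computes prog (ix FCap) (Cell (unary u) (ebits p)) (unary (min u (val p))) ((length p + 1) * (500 * (u + 1)))"
proof (induction p)
  case Nil
  show ?case by (intro computesI) (auto, auto simp: HID_def)
next
  case (Cons b p)
  let ?m = "min u (val p)"
  have 1: "computes prog (ix FApp) (Cell (unary ?m) (unary ?m)) (unary (?m + ?m)) (100 * (u + 1))"
    by (rule computes_mono[OF add_computes]) simp
  have 2: "computes prog (ix FMin) (Cell (unary u) (Cell Atom (unary n))) (unary (min u (Suc n))) (100 * (u + 1))" for n
    using min_computes[of u "Suc n"] by simp
  \<comment> \<open>Capping early loses nothing: a value that was cut down to \<open>u\<close> is at
    least \<open>u\<close> again after doubling.\<close>
  have r: "min u (val (b # p)) = min u (if b then Suc (?m + ?m) else ?m + ?m)" by (auto simp: min_def)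
  show ?case unfolding r
    by (cases b; intro computesI) (auto intro!: computes_CALLS[OF Cons.IH] computes_CALLS[OF 1] computes_CALLS[OF 2]
      computes_CALLS[OF min_computes], auto simp: HID_def)
qed

lemma half_computes: "computes prog (ix FHalf) (unary n) (unary (n div 2)) (100 * (n + 1))"
proof (induction n rule: less_induct)
  case (less n)
  consider "n = 0" | "n = Suc 0" | m where "n = Suc (Suc m)" by (cases n rule: nat.exhaust; metis nat.exhaust)
  then show ?case
  proof cases
    case 3
    then have "computes prog (ix FHalf) (unary m) (unary (m div 2)) (100 * (m + 1))" using less by simp
    note * = computes_CALLS[OF this]
    show ?thesis unfolding 3 by (intro computesI) (auto intro!: *, auto simp: HID_def)
  qed (intro computesI, auto, auto simp: HID_def)+
qed

lemma lg_computes: "computes prog (ix FLg) (unary n) (unary (lg n)) ((n + 1) * (200 * (n + 1)))"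
proof (induction n rule: lg.induct)
  case (1 n)
  show ?case
  proof (cases n)
    case 0
    then show ?thesis by (intro computesI) (auto, auto simp: HID_def lg.simps[of 0])
  next
    case (Suc m)
    define q where "q = n div 2"
    have "(q + 1) * (200 * (q + 1)) \<le> n * (200 * (n + 1))"
      unfolding q_def using Suc by (intro mult_mono) auto
    then have T: "(q + 1) * (200 * (q + 1)) + 200 * (n + 1) \<le> (n + 1) * (200 * (n + 1))" by simp
    have l: "lg n = Suc (lg q)" unfolding q_def using Suc by (subst lg.simps) simp
    have h: "computes prog (ix FHalf) (Cell Atom (unary m)) (unary q) (100 * (n + 1))"
      using half_computes[of n] Suc by (simp add: q_def)
    have IH: "computes prog (ix FLg) (unary q) (unary (lg q)) ((q + 1) * (200 * (q + 1)))"
      using "1.IH" Suc by (simp add: q_def)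
    have "computes prog (ix FLg) (Cell Atom (unary m)) (unary (Suc (lg q))) ((n + 1) * (200 * (n + 1)))"
      by (rule computes_mono[OF _ T], intro computesI)
        (auto intro!: computes_CALLS[OF h] computes_CALLS[OF IH], auto simp: HID_def)
    then show ?thesis unfolding l using Suc by simp
  qed
qed

lemma exp_computes: "computes prog (ix FExp) (unary m) (unary (2 ^ m)) ((m + 1) * (200 * (2 ^ m + 1)))"
proof (induction m)
  case 0
  show ?case by (intro computesI) (auto, auto simp: HID_def)
next
  case (Suc m)
  have "(m + 1) * (200 * (2 ^ m + 1)) \<le> (m + 1) * (200 * (2 ^ Suc m + 1))"
    by (intro mult_left_mono) auto
  then show ?case
    by (intro computesI) (auto intro!: computes_CALLS[OF Suc.IH] computes_CALLS[OF add_computes],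
      auto simp: HID_def mult_2)
qed

lemma take_computes: "computes prog (ix FTake) (Cell (unary m) (ebits r)) (ebits (take m r)) (100 * (m + 1))"
proof (induction m arbitrary: r)
  case 0
  show ?case by (intro computesI) (auto, auto simp: HID_def)
next
  case (Suc m)
  show ?case
    by (cases r; intro computesI) (auto intro!: computes_CALLS[OF Suc.IH], auto simp: HID_def)
qed

lemma drop_computes: "computes prog (ix FDrop) (Cell (unary m) (ebits r)) (ebits (drop m r)) (100 * (m + 1))"
proof (induction m arbitrary: r)
  case 0
  show ?case by (intro computesI) (auto, auto simp: HID_def)
next
  case (Suc m)
  show ?case
    by (cases r; intro computesI) (auto intro!: computes_CALLS[OF Suc.IH], auto simp: HID_def)
qed

text \<open>Expanding to unary takes time proportional to the value itself, which is affordable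
  because costs are polynomially bounded.\<close>

lemma val_enc_nat_computes:
  assumes "c \<le> K" "size (enc_nat c) \<le> K"
  shows "computes prog (ix FVal) (enc_nat c) (unary c) (K ^ 3)"
proof -
  have "length (bits_of_nat c) \<le> K"
    using size_elist(2)[of "bits_of_nat c" enc_bool] assms(2) by (simp add: enc_nat_ebits)
  then have "(length (bits_of_nat c) + 1) * (200 * (c + 1)) \<le> (2 * K) * (200 * (2 * K))"
    using assms(1) K1000 by (intro mult_mono) auto
  also have "\<dots> = 800 * K ^ 2" by (simp add: power2_eq_square)
  also have "\<dots> \<le> K ^ 3" using K_steps by linarith
  finally have "(length (bits_of_nat c) + 1) * (200 * (c + 1)) \<le> K ^ 3" .
  with computes_mono[OF val_computes[of "bits_of_nat c"]] show ?thesis by (simp add: enc_nat_ebits)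
qed

lemma total_computes:
  "\<forall>(v, c) \<in> set cs. c \<le> K \<and> size (enc_nat c) \<le> K \<Longrightarrow>
   computes prog (ix FTot) (ecosts cs) (unary (total cs)) ((length cs + 1) * K ^ 4)"
proof (induction cs)
  case Nil
  show ?case using K_steps by (intro computesI) (auto, auto simp: HID_def)
next
  case (Cons h cs)
  obtain v c where h: "h = (v, c)" by (cases h)
  with Cons have c: "c \<le> K" "size (enc_nat c) \<le> K" and
    IH: "computes prog (ix FTot) (ecosts cs) (unary (total cs)) ((length cs + 1) * K ^ 4)" by auto
  note * = computes_CALLS[OF IH] computes_CALLS[OF val_enc_nat_computes[OF c]] computes_CALLS[OF add_computes]
  show ?case unfolding h using K_steps c(1) by (intro computesI) (auto intro!: *, auto simp: HID_def)
qed

lemma weights_computes: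
  assumes M: "M \<le> K" and m: "2 ^ m \<le> K"
  shows "\<forall>(v, c) \<in> set cs. c \<le> K \<and> size (enc_nat c) \<le> K \<Longrightarrow>
    computes prog (ix FWts) (Cell (ecosts cs) (Cell (ebits r) (Cell (unary m) (unary M))))
      (eassoc (weights m M cs r)) ((length cs + 1) * K ^ 4)"
proof (induction cs arbitrary: r)
  case Nil
  show ?case using K_steps by (intro computesI) (auto, auto simp: HID_def)
next
  case (Cons h cs)
  obtain v c where h: "h = (v, c)" by (cases h)
  with Cons have c: "c \<le> K" "size (enc_nat c) \<le> K" and
    IH: "\<And>r. computes prog (ix FWts) (Cell (ecosts cs) (Cell (ebits r) (Cell (unary m) (unary M))))
      (eassoc (weights m M cs r)) ((length cs + 1) * K ^ 4)" by auto
  have "m < 2 ^ m" by simp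
  with m have mK: "m \<le> K" by linarith
  have "(M + 1) * (200 * (c + 1)) \<le> (2 * K) * (200 * (2 * K))" using M c K1000 by (intro mult_mono) auto
  then have Mul: "computes prog (ix FMul) (Cell (unary M) (unary c)) (unary (M * c)) (800 * K ^ 2)"
    by (intro computes_mono[OF mul_computes]) (simp add: power2_eq_square)
  have "M * c \<le> K * K" using M c by (intro mult_mono) auto
  moreover have "x \<le> K ^ 2 \<Longrightarrow> 100 * (x + 1) \<le> 200 * K ^ 2" for x using K_steps by simp
  ultimately have "100 * (M * c + 1) \<le> 200 * K ^ 2" unfolding power2_eq_square by blast
  then have Add: "computes prog (ix FApp) (Cell (unary (M * c)) (unary n)) (unary (M * c + n)) (200 * K ^ 2)" for n
    by (rule computes_mono[OF add_computes])
  have v: "val (take m r) \<le> K"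
  proof -
    have "val (take m r) < 2 ^ length (take m r)" by (rule val_less)
    also have "\<dots> \<le> 2 ^ m" by (intro power_increasing) auto
    finally show ?thesis using m by simp
  qed
  have "(length (take m r) + 1) * (200 * (val (take m r) + 1)) \<le> (2 * K) * (200 * (2 * K))"
    using mK v K1000 by (intro mult_mono) auto
  then have Val: "computes prog (ix FVal) (ebits (take m r)) (unary (val (take m r))) (800 * K ^ 2)"
    by (intro computes_mono[OF val_computes]) (simp add: power2_eq_square)
  note * = computes_CALLS[OF IH] computes_CALLS[OF val_enc_nat_computes[OF c]] computes_CALLS[OF Mul]
    computes_CALLS[OF Add] computes_CALLS[OF Val] computes_CALLS[OF take_computes] computes_CALLS[OF drop_computes]
  show ?case unfolding h using K_steps mK
    by (intro computesI) (auto intro!: *, auto simp: HID_def)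
qed

end

text \<open>With \<open>n\<close> vertices, weights have \<open>Suc (lg n)\<close> random bits and hence take at least \<open>2 * n\<close> values.
  Multiplying the costs by more than the largest total random weight lets cost dominate.\<close>

definition weight_bits :: "nat \<Rightarrow> nat" where "weight_bits n = Suc (lg n)"
definition cost_factor :: "nat \<Rightarrow> nat" where "cost_factor n = n * 2 ^ weight_bits n"
definition poly_len :: "(nat \<times> nat) list \<Rightarrow> nat \<Rightarrow> nat" where
  "poly_len cs b = cost_factor (length cs) * Suc (min (total cs) b)"
definition weighting :: "(nat \<times> nat) list \<Rightarrow> bool list \<Rightarrow> (nat \<times> nat) list" where
  "weighting cs r = weights (weight_bits (length cs)) (cost_factor (length cs)) cs r"

definition (in tables) decide :: "nat cexpr \<Rightarrow> (nat \<times> nat) list \<Rightarrow> nat \<Rightarrow> bool list \<Rightarrow> bool" where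
  "decide e cs b r \<longleftrightarrow>
     (\<exists>(v, x) \<in> set (weighting cs r). accepts (poly_len cs b) (remdups (all_labs e)) (weighting cs r) e v)"

lemma less_power_lg: "n < 2 ^ lg n"
proof (induction n rule: lg.induct)
  case (1 n)
  then show ?case by (cases "n = 0") (auto simp: lg.simps[of n])
qed

text \<open>The converse bound keeps the weights small: \<open>2 ^ weight_bits n\<close> is at most
  \<open>4 * n\<close>, so the degrees of all polynomials remain polynomial in the input
  size.\<close>

lemma power_lg_le: "0 < n \<Longrightarrow> 2 ^ lg n \<le> 2 * n"
proof (induction n rule: lg.induct)
  case (1 n)
  show ?case
  proof (cases "n div 2 = 0")
    case True
    then have "n = 1" using 1 by linarith
    then show ?thesis by (simp add: lg.simps[of "Suc 0"] lg.simps[of 0])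
  next
    case False
    then have "2 ^ lg (n div 2) \<le> 2 * (n div 2)" using 1 by simp
    then show ?thesis using 1 by (simp add: lg.simps[of n])
  qed
qed

lemma (in bounded) decide_computes:
  assumes e: "size (enc_cexpr e) \<le> K" and b: "size (enc_nat b) \<le> K"
    and cs: "\<forall>(v, c) \<in> set cs. c \<le> K \<and> size (enc_nat c) \<le> K" "length cs \<le> K"
    and sz: "2 ^ weight_bits (length cs) \<le> K" "cost_factor (length cs) \<le> K" "poly_len cs b \<le> K" "total cs \<le> K"
  shows "computes prog (ix FDec)
    (Cell (Cell (enc_cexpr e) (Cell (ecosts cs) (Cell (enc_nat b) Atom))) (ebits r))
    (enc_bool (decide e cs b r)) (a ^ length (remdups (all_labs e)) * K ^ 16)"
proof -
  let ?n = "length cs" and ?L = "remdups (all_labs e)" and ?W = "weighting cs r"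
  let ?m = "weight_bits ?n" and ?M = "cost_factor ?n" and ?d = "poly_len cs b"
  let ?A = "a ^ length ?L"
  have n: "nodes e \<le> K" using nodes_le[of e] e by simp
  have al: "\<forall>l \<in> set (all_labs e). small K l" "length (all_labs e) \<le> 2 * K"
    using size_all_labs[of _ e] e length_all_labs[of e] n by force+
  have L: "\<forall>l \<in> set ?L. small K l" "length ?L \<le> K"
    using al le_trans[OF length_remdups_leq le_trans[OF length_all_labs n]] by auto
  have bnd: "(p + 1) * (c * (q + 1)) \<le> (2 * K) * (c * (2 * K))" if "p \<le> K" "q \<le> K" for p q c
    using that K1000 by (intro mult_mono) auto
  have lg: "computes prog (ix FLg) (unary ?n) (unary (lg ?n)) (800 * K ^ 2)"
    using bnd[OF cs(2) cs(2), of 200] by (intro computes_mono[OF lg_computes]) (simp add: power2_eq_square)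
  have mK: "?m \<le> K" using sz(1) less_exp[of ?m] by linarith
  have ex: "computes prog (ix FExp) (Cell Atom (unary (lg ?n))) (unary (2 ^ ?m)) (800 * K ^ 2)"
    using bnd[OF mK sz(1), of 200] computes_mono[OF exp_computes[of ?m], of "800 * K ^ 2"]
    by (simp add: power2_eq_square weight_bits_def)
  have mM: "computes prog (ix FMul) (Cell (unary ?n) (unary (2 ^ ?m))) (unary ?M) (800 * K ^ 2)"
    using bnd[OF cs(2) sz(1), of 200] computes_mono[OF mul_computes[of ?n "2 ^ ?m"], of "800 * K ^ 2"]
    by (simp add: power2_eq_square cost_factor_def)
  have "length (bits_of_nat b) \<le> K"
    using size_elist(2)[of "bits_of_nat b" enc_bool] b by (simp add: enc_nat_ebits)
  from bnd[OF this sz(4), of 500]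
  have cap: "computes prog (ix FCap) (Cell (unary (total cs)) (enc_nat b)) (unary (min (total cs) b)) (2000 * K ^ 2)"
    using computes_mono[OF cap_computes[of "total cs" "bits_of_nat b"], of "2000 * K ^ 2"]
    by (simp add: power2_eq_square enc_nat_ebits)
  have tot: "computes prog (ix FTot) (ecosts cs) (unary (total cs)) (3 * K ^ 5)"
    using K_mult1[of ?n 4] cs(2) by (intro computes_mono[OF total_computes[OF cs(1)]]) simp
  have "min (total cs) b \<le> K" using sz(4) by simp
  then have "(?M + 1) * (200 * (Suc (min (total cs) b) + 1)) \<le> (2 * K) * (200 * (2 * K))"
    using sz(2) K1000 by (intro mult_mono) auto
  then have md: "computes prog (ix FMul) (Cell (unary ?M) (Cell Atom (unary (min (total cs) b)))) (ebits (zeros ?d)) (800 * K ^ 2)"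
    using computes_mono[OF mul_computes[of ?M "Suc (min (total cs) b)"], of "800 * K ^ 2"]
    by (simp add: power2_eq_square poly_len_def unary_ebits[symmetric])
  have w: "computes prog (ix FWts) (Cell (ecosts cs) (Cell (ebits r) (Cell (Cell Atom (unary (lg ?n))) (unary ?M)))) (eassoc ?W) (3 * K ^ 5)"
    using K_mult1[of ?n 4] cs(2) computes_mono[OF weights_computes[OF sz(2,1) cs(1), of r], of "3 * K ^ 5"]
    by (simp add: weighting_def weight_bits_def)
  have a: "computes prog (ix FAll) (enc_cexpr e) (elabs (all_labs e)) (K ^ 8)"
    using K_mult[of "nodes e" 1 7] n by (intro computes_mono[OF all_labs_computes[OF e]]) simp
  have di: "computes prog (ix FDist) (elabs (all_labs e)) (elabs ?L) (3 * K ^ 6)"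
    using K_mult1[OF al(2), of 5] by (intro computes_mono[OF dist_computes[OF al]]) simp
  have lw: "length ?W \<le> K" using cs(2) by (simp add: weighting_def)
  have "?A * ((length ?W + 1) * K ^ 14) \<le> ?A * (3 * K ^ 15)"
    using mult_left_mono[OF K_mult1[of "length ?W" 14], of ?A] lw by fastforce
  then have "(length ?W + 1) * (?A * K ^ 14) \<le> ?A * (3 * K ^ 15)"
    by (simp only: mult.left_commute)
  then have an: "computes prog (ix FAny)
    (Cell (eassoc ?W) (Cell (enc_cexpr e) (Cell (ebits (zeros ?d)) (Cell (elabs ?L) (eassoc ?W)))))
    (enc_bool (decide e cs b r)) (?A * (3 * K ^ 15))"
    using any_computes[OF L sz(3) lw e, of ?W] by (auto simp: decide_def intro: computes_mono)
  have "1 * K ^ 15 \<le> ?A * K ^ 15" using a_pos by (intro mult_right_mono) auto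
  then have "?A * (3 * K ^ 15) + K ^ 10 \<le> ?A * (4 * K ^ 15)" using K_steps by linarith
  also have "\<dots> \<le> ?A * K ^ 16" using K_steps by (intro mult_left_mono) auto
  finally have T: "?A * (3 * K ^ 15) + K ^ 10 \<le> ?A * K ^ 16" .
  note * = computes_CALLS[OF len_computes] computes_CALLS[OF lg] computes_CALLS[OF ex] computes_CALLS[OF mM]
    computes_CALLS[OF cap] computes_CALLS[OF tot] computes_CALLS[OF md] computes_CALLS[OF w]
    computes_CALLS[OF a] computes_CALLS[OF di] computes_CALLS[OF an]
  show ?thesis using K_steps T cs(2)
    by (intro computesI) (auto intro!: *, auto simp: HID_def)
qed

section \<open>Uniform bit strings and the distribution of the output\<close>

lemma finite_bits: "finite {bs :: bool list. length bs = n}"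
  using finite_lists_length_eq[of "UNIV :: bool set" n] by simp

lemma card_bits: "card {bs :: bool list. length bs = n} = 2 ^ n"
  using card_lists_length_eq[of "UNIV :: bool set" n] by simp

text \<open>The first bit splits the strings into two disjoint blocks of equal size, and the uniform
  distribution on such a union is the uniform mixture of those on the blocks.\<close>

lemma spmf_of_set_bits_Suc:
  "spmf_of_set {bs :: bool list. length bs = Suc n} =
   bind_spmf coin_spmf (\<lambda>b. map_spmf (Cons b) (spmf_of_set {bs. length bs = n}))"
proof -
  let ?S = "{bs :: bool list. length bs = n}"
  have ne: "?S \<noteq> {}" using Ex_list_of_length[of n] by blast
  have "{bs :: bool list. length bs = Suc n} = (\<Union>b. Cons b ` ?S)"
    by (auto simp: length_Suc_conv)
  also have "pmf_of_set \<dots> = bind_pmf (pmf_of_set UNIV) (\<lambda>b. pmf_of_set (Cons b ` ?S))"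
    using ne by (intro pmf_of_set_UN[where n = "2 ^ n"])
      (auto simp: finite_bits card_bits card_image disjoint_family_on_def)
  also have "\<dots> = bind_pmf (pmf_of_set UNIV) (\<lambda>b. map_pmf (Cons b) (pmf_of_set ?S))"
    using ne finite_bits by (simp add: map_pmf_of_set_inj inj_on_def)
  finally have "spmf_of_pmf (pmf_of_set {bs :: bool list. length bs = Suc n}) =
      bind_spmf (spmf_of_pmf (pmf_of_set UNIV)) (\<lambda>b. map_spmf (Cons b) (spmf_of_pmf (pmf_of_set ?S)))"
    by (simp add: spmf_of_pmf_bind map_spmf_of_pmf flip: bind_spmf_of_pmf)
  moreover have "{bs :: bool list. length bs = Suc n} \<noteq> {}" using Ex_list_of_length[of "Suc n"] by blast
  ultimately show ?thesis using ne
    by (simp add: finite_bits del: map_spmf_of_pmf map_spmf_of_set_inj_on)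
qed

context tables
begin

text \<open>The number of steps is the same for all outcomes of the flips, so it can be chosen
  outside the distribution.\<close>

lemma flip_eval:
  "\<exists>t \<le> 100 * (n + 1). eval prog [unary n] (prog ! ix FFlip) =
     map_spmf (\<lambda>bs. (ebits bs, t)) (spmf_of_set {bs. length bs = n})"
proof (induction n)
  case 0
  have "spmf_of_set {bs :: bool list. bs = []} = return_spmf []"
    by (simp add: spmf_of_set_singleton)
  then show ?case
    by (simp add: prog_ix CASE_def NIL_def Var_def eval.simps)
next
  case (Suc n)
  then obtain t where t: "t \<le> 100 * (n + 1)" "eval prog [unary n] (prog ! ix FFlip) =
     map_spmf (\<lambda>bs. (ebits bs, t)) (spmf_of_set {bs. length bs = n})" by blast
  have body: "prog ! ix FFlip = ECase (EVar 0) EAtom (EPair EFlip (ECall (ix FFlip) (EVar 1)))"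
    by (simp add: prog_ix(2) CASE_def NIL_def Var_def APP_def FLIP_def PAIR_def)
  have "eval prog [unary (Suc n)] (ECase (EVar 0) EAtom (EPair EFlip (ECall (ix FFlip) (EVar 1)))) =
     map_spmf (\<lambda>bs. (ebits bs, t + 6)) (spmf_of_set {bs. length bs = Suc n})"
    unfolding spmf_of_set_bits_Suc
    by (simp add: eval.simps[of prog _ "ECase _ _ _"] eval.simps[of prog _ "EVar _"]
      eval.simps[of prog _ "EPair _ _"] eval.simps[of prog _ EFlip] eval.simps[of prog _ "ECall _ _"]
      prog_ix(1) t(2) map_spmf_bind_spmf map_spmf_conv_bind_spmf numeral_eq_Suc)
  then have "eval prog [unary (Suc n)] (prog ! ix FFlip) =
     map_spmf (\<lambda>bs. (ebits bs, t + 6)) (spmf_of_set {bs. length bs = Suc n})"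
    by (simp only: body)
  moreover have "t + 6 \<le> 100 * (Suc n + 1)" using t(1) by simp
  ultimately show ?case by blast
qed

end

context bounded
begin

lemma shape_computes:
  assumes "length cs \<le> K" "2 ^ weight_bits (length cs) \<le> K"
  shows "computes prog (ix FShape) (Cell y (Cell (ecosts cs) z))
    (unary (length cs * weight_bits (length cs))) (K ^ 4)"
proof -
  let ?n = "length cs" and ?m = "weight_bits (length cs)"
  have bnd: "(p + 1) * (c * (q + 1)) \<le> (2 * K) * (c * (2 * K))" if "p \<le> K" "q \<le> K" for p q c
    using that K1000 by (intro mult_mono) auto
  have lg: "computes prog (ix FLg) (unary ?n) (unary (lg ?n)) (800 * K ^ 2)"
    using bnd[OF assms(1,1), of 200] by (intro computes_mono[OF lg_computes]) (simp add: power2_eq_square)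
  have mK: "?m \<le> K" using assms(2) less_exp[of ?m] by linarith
  have mM: "computes prog (ix FMul) (Cell (unary ?n) (Cell Atom (unary (lg ?n)))) (unary (?n * ?m)) (800 * K ^ 2)"
    using bnd[OF assms(1) mK, of 200] computes_mono[OF mul_computes[of ?n ?m], of "800 * K ^ 2"]
    by (simp add: power2_eq_square weight_bits_def)
  note * = computes_CALLS[OF len_computes] computes_CALLS[OF lg] computes_CALLS[OF mM]
  show ?thesis using K_steps assms(1)
    by (intro computesI) (auto intro!: *, auto simp: HID_def)
qed

lemma run_prog:
  assumes e: "size (enc_cexpr e) \<le> K" and b: "size (enc_nat b) \<le> K"
    and cs: "\<forall>(v, c) \<in> set cs. c \<le> K \<and> size (enc_nat c) \<le> K" "length cs \<le> K"
    and sz: "2 ^ weight_bits (length cs) \<le> K" "cost_factor (length cs) \<le> K" "poly_len cs b \<le> K" "total cs \<le> K"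
  shows "\<exists>t. (\<forall>r. t r \<le> a ^ length (remdups (all_labs e)) * K ^ 17) \<and>
    run prog (Cell (enc_cexpr e) (Cell (ecosts cs) (Cell (enc_nat b) Atom))) =
    map_spmf (\<lambda>r. (enc_bool (decide e cs b r), t r))
      (spmf_of_set {r. length r = length cs * weight_bits (length cs)})"
proof -
  let ?x = "Cell (enc_cexpr e) (Cell (ecosts cs) (Cell (enc_nat b) Atom))"
  let ?N = "length cs * weight_bits (length cs)" and ?A = "a ^ length (remdups (all_labs e))"
  obtain s where s: "s \<le> K ^ 4" "eval prog [?x] (prog ! ix FShape) = return_spmf (unary ?N, s)"
    using computes_eval[OF shape_computes[OF cs(2) sz(1), of "enc_cexpr e" "Cell (enc_nat b) Atom"]] by blast
  obtain f where f: "f \<le> 100 * (?N + 1)" "eval prog [unary ?N] (prog ! ix FFlip) =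
     map_spmf (\<lambda>bs. (ebits bs, f)) (spmf_of_set {bs. length bs = ?N})"
    using flip_eval by blast
  have "\<forall>r. \<exists>d. d \<le> ?A * K ^ 16 \<and> eval prog [Cell ?x (ebits r)] (prog ! ix FDec) = return_spmf (enc_bool (decide e cs b r), d)"
    using computes_eval[OF decide_computes[OF assms]] by blast
  then obtain d where d: "\<And>r. d r \<le> ?A * K ^ 16"
    "\<And>r. eval prog [Cell ?x (ebits r)] (prog ! ix FDec) = return_spmf (enc_bool (decide e cs b r), d r)"
    by metis
  \<comment> \<open>The 12 steps are those of the initial call and of the body of
    \<open>FMain\<close>, apart from the three bodies it calls.\<close>
  define t where "t r = s + f + d r + 12" for r
  have ix0: "ix FMain = 0" by (simp add: ix_def fns_def)
  have "run prog ?x = map_spmf (\<lambda>r. (enc_bool (decide e cs b r), t r)) (spmf_of_set {r. length r = ?N})"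
    unfolding run_def
    using prog_ix(1)[of FMain] prog_ix(2)[of FMain] s(2) f(2) d(2) prog_ix(1)
    by (simp add: ix0 eval.simps[of prog _ "ELet _ _"] LET_def APP_def PAIR_def Var_def
      eval.simps[of prog _ "EVar _"] eval.simps[of prog _ "EPair _ _"]
      eval.simps[of prog _ "ECall _ _"] map_spmf_conv_bind_spmf t_def numeral_eq_Suc add.assoc)
  moreover have "t r \<le> ?A * K ^ 17" for r
  proof -
    have "weight_bits (length cs) \<le> K" using sz(1) less_exp[of "weight_bits (length cs)"] by linarith
    then have "?N \<le> K * K" using cs(2) by (intro mult_mono) auto
    then have "?N \<le> K ^ 2" by (simp add: power2_eq_square)
    moreover have "s + f + 12 \<le> K ^ 16" if "x \<le> K ^ 2" "f \<le> 100 * (x + 1)" for x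
    proof -
      have "s + f + 12 \<le> K ^ 5" using that s(1) K_steps(1-5) by simp
      also have "\<dots> \<le> K ^ 16" using K1000 by (intro power_increasing) auto
      finally show ?thesis .
    qed
    ultimately have "s + f + 12 \<le> K ^ 16" using f(1) by blast
    moreover have "1 * K ^ 16 \<le> ?A * K ^ 16" using a_pos by (intro mult_right_mono) auto
    ultimately have "t r \<le> ?A * (2 * K ^ 16)" using d(1)[of r] unfolding t_def by linarith
    also have "\<dots> \<le> ?A * K ^ 17" using K_step[of 16] by (intro mult_left_mono) auto
    finally show ?thesis .
  qed
  ultimately show ?thesis by blast
qed

end

lemma measure_map_spmf_of_set:
  assumes "finite S" "S \<noteq> {}"
  shows "measure (measure_spmf (map_spmf f (spmf_of_set S))) A = card {x \<in> S. f x \<in> A} / card S"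
  using assms by (simp add: measure_map_spmf measure_spmf_of_set vimage_def Int_def)

text \<open>Turns the bound on the error probability into counting: of the equally likely strings in
  \<open>S\<close>, at most half may reject a yes-instance.\<close>

lemma one_sided_monte_carloI:
  assumes run: "run P x = map_spmf (\<lambda>r. (enc_bool (q r), t r)) (spmf_of_set S)"
    and S: "finite S" "S \<noteq> {}"
    and T: "\<And>r. t r \<le> T"
    and sound: "\<And>r. r \<in> S \<Longrightarrow> q r \<Longrightarrow> ans"
    and complete: "ans \<Longrightarrow> 2 * card {r \<in> S. \<not> q r} \<le> card S"
  shows "one_sided_monte_carlo P x ans T"
proof -
  have m: "measure (measure_spmf (run P x)) {(y, t). y = enc_bool False} = card {r \<in> S. \<not> q r} / card S"
    unfolding run using S by (subst measure_map_spmf_of_set) auto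
  have "measure (measure_spmf (run P x)) {(y, t). y = enc_bool False} \<le> 1 / 2" if ans
  proof -
    have "2 * real (card {r \<in> S. \<not> q r}) \<le> real (card S)" using complete[OF that] by linarith
    moreover have "0 < card S" using S by (simp add: card_gt_0_iff)
    ultimately show ?thesis unfolding m by (simp add: field_simps)
  qed
  then show ?thesis
    using S T sound unfolding one_sided_monte_carlo_def
    by (auto simp: run simp del: enc_bool.simps)
qed

section \<open>Counting assignments modulo two\<close>

text \<open>A vertex in state \<open>Lft\<close> or \<open>Rgt\<close> belongs to the solution, on the respective side of a cut.
  \<open>Forb\<close> is only used for dominating sets; such a vertex must have no neighbour in the solution.\<close>

datatype st = Out | Forb | Lft | Rgt

lemma UNIV_st: "UNIV = {Out, Forb, Lft, Rgt}"
  using st.exhaust by blast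

instance st :: finite
  by standard (simp add: UNIV_st)

abbreviation V :: "'v cexpr \<Rightarrow> 'v set" where "V e \<equiv> verts (lgraph_of e)"
abbreviation lb :: "'v cexpr \<Rightarrow> 'v \<Rightarrow> nat" where "lb e \<equiv> lab (lgraph_of e)"

definition selected :: "'v cexpr \<Rightarrow> ('v \<Rightarrow> st) \<Rightarrow> 'v set" where
  "selected e \<sigma> = {v \<in> V e. \<sigma> v \<in> {Lft, Rgt}}"

lemma finite_V [simp]: "finite (V e)"
  by (induction e) (auto simp: Let_def)

lemma edges_V: "{u, v} \<in> edges (lgraph_of e) \<Longrightarrow> u \<in> V e \<and> v \<in> V e"
  by (induction e) (auto simp: Let_def doubleton_eq_iff)

lemma set_labs: "wf_cexpr e \<Longrightarrow> set (labs e) = lb e ` V e"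
proof (induction e)
  case (Disj_Union p q)
  then have "v \<in> V q \<Longrightarrow> v \<notin> V p" for v by auto
  with Disj_Union show ?case by (auto simp: Let_def)
qed (auto simp: Let_def)

lemma labs_subset: "set (labs e) \<subseteq> set (all_labs e)"
  by (induction e) auto

locale state_problem =
  fixes ok :: "st \<Rightarrow> st \<Rightarrow> bool"
  assumes ok_sym: "ok x y \<longleftrightarrow> ok y x"
begin

text \<open>Fixing \<open>Out\<close> off the graph makes an assignment determined by its values on
  the vertices, so that there are finitely many and those of a disjoint union are pairs. The
  condition on \<open>r\<close> is void in subgraphs without \<open>r\<close>.\<close>

definition asg :: "nat \<Rightarrow> nat cexpr \<Rightarrow> (nat \<Rightarrow> st set) \<Rightarrow> (nat \<Rightarrow> st) set" where
  "asg r e \<tau> = {\<sigma>. (\<forall>v. v \<notin> V e \<longrightarrow> \<sigma> v = Out) \<and> (\<forall>v \<in> V e. \<sigma> v \<in> \<tau> (lb e v)) \<and>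
     (\<forall>u v. {u, v} \<in> edges (lgraph_of e) \<longrightarrow> ok (\<sigma> u) (\<sigma> v)) \<and> (r \<in> V e \<longrightarrow> \<sigma> r = Lft)}"

definition cnt :: "nat \<Rightarrow> (nat \<Rightarrow> nat) \<Rightarrow> nat cexpr \<Rightarrow> (nat \<Rightarrow> st set) \<Rightarrow> nat \<Rightarrow> nat" where
  "cnt r \<omega> e \<tau> i = card {\<sigma> \<in> asg r e \<tau>. sum \<omega> (selected e \<sigma>) = i}"

lemma finite_asg [simp]: "finite (asg r e \<tau>)"
proof (rule finite_subset)
  show "asg r e \<tau> \<subseteq> {\<sigma>. \<forall>v. (v \<in> V e \<longrightarrow> \<sigma> v \<in> UNIV) \<and> (v \<notin> V e \<longrightarrow> \<sigma> v = Out)}"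
    by (auto simp: asg_def)
  show "finite {\<sigma>. \<forall>v. (v \<in> V e \<longrightarrow> \<sigma> v \<in> (UNIV :: st set)) \<and> (v \<notin> V e \<longrightarrow> \<sigma> v = Out)}"
    by (intro finite_set_of_finite_funs) auto
qed

lemma cnt_cong:
  assumes "wf_cexpr e" "\<And>l. l \<in> set (labs e) \<Longrightarrow> \<tau> l = \<tau>' l"
  shows "cnt r \<omega> e \<tau> = cnt r \<omega> e \<tau>'"
proof -
  have "asg r e \<tau> = asg r e \<tau>'"
    unfolding asg_def using assms(2) unfolding set_labs[OF assms(1)] by auto
  then show ?thesis by (simp add: cnt_def fun_eq_iff)
qed

text \<open>The vertices labelled \<open>i\<close> below are labelled \<open>j\<close> above, so
  they are subject to the test of \<open>j\<close>.\<close>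

lemma cnt_Relabel: "cnt r \<omega> (Relabel i j p) \<tau> = cnt r \<omega> p (\<tau>(i := \<tau> j))"
proof -
  have "asg r (Relabel i j p) \<tau> = asg r p (\<tau>(i := \<tau> j))"
    by (auto simp: asg_def Let_def split: if_splits)
  then show ?thesis by (simp add: cnt_def fun_eq_iff selected_def Let_def)
qed

text \<open>The membership and the two cardinalities on the right are what \<open>wt\<close> stores,
  the latter modulo two.\<close>

lemma cnt_Introduce:
  "cnt r \<omega> (Introduce l v) \<tau> i =
     (if v = r then of_bool (Lft \<in> \<tau> l \<and> i = \<omega> v)
      else card (\<tau> l \<inter> {Out, Forb}) * of_bool (i = 0) + card (\<tau> l \<inter> {Lft, Rgt}) * of_bool (i = \<omega> v))"
proof -
  let ?f = "\<lambda>s. (\<lambda>_. Out)(v := s)"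
  have inj: "inj_on ?f A" for A by (auto simp: inj_on_def fun_eq_iff split: if_splits)
  have asg: "asg r (Introduce l v) \<tau> = ?f ` {s \<in> \<tau> l. v = r \<longrightarrow> s = Lft}" (is "?A = ?B")
  proof (intro equalityI subsetI)
    fix \<sigma> assume "\<sigma> \<in> ?A"
    then have "\<sigma> = ?f (\<sigma> v)" "\<sigma> v \<in> \<tau> l" "v = r \<longrightarrow> \<sigma> v = Lft" by (auto simp: asg_def fun_eq_iff)
    then show "\<sigma> \<in> ?B" by blast
  qed (auto simp: asg_def)
  have w: "sum \<omega> (selected (Introduce l v) (?f s)) = (if s \<in> {Lft, Rgt} then \<omega> v else 0)" for s
  proof (cases "s \<in> {Lft, Rgt}")
    case True
    then have "selected (Introduce l v) (?f s) = {v}" by (auto simp: selected_def)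
    with True show ?thesis by simp
  next
    case False
    then have "selected (Introduce l v) (?f s) = {}" by (auto simp: selected_def)
    with False show ?thesis by simp
  qed
  have "{\<sigma> \<in> asg r (Introduce l v) \<tau>. sum \<omega> (selected (Introduce l v) \<sigma>) = i} =
      ?f ` {s \<in> \<tau> l. (v = r \<longrightarrow> s = Lft) \<and> (if s \<in> {Lft, Rgt} then \<omega> v else 0) = i}"
    unfolding asg using w by auto
  then have c: "cnt r \<omega> (Introduce l v) \<tau> i =
      card {s \<in> \<tau> l. (v = r \<longrightarrow> s = Lft) \<and> (if s \<in> {Lft, Rgt} then \<omega> v else 0) = i}"
    unfolding cnt_def by (simp only: card_image[OF inj])
  show ?thesis
  proof (cases "v = r")
    case True
    then have "{s \<in> \<tau> l. (v = r \<longrightarrow> s = Lft) \<and> (if s \<in> {Lft, Rgt} then \<omega> v else 0) = i} =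
        (if Lft \<in> \<tau> l \<and> i = \<omega> v then {Lft} else {})" by auto
    with True show ?thesis unfolding c by simp
  next
    case False
    have "{s \<in> \<tau> l. (v = r \<longrightarrow> s = Lft) \<and> (if s \<in> {Lft, Rgt} then \<omega> v else 0) = i} =
        (if i = 0 then \<tau> l \<inter> {Out, Forb} else {}) \<union> (if i = \<omega> v then \<tau> l \<inter> {Lft, Rgt} else {})"
      using False st.exhaust by (auto split: if_splits) 
    moreover have "card \<dots> = card (if i = 0 then \<tau> l \<inter> {Out, Forb} else {}) +
        card (if i = \<omega> v then \<tau> l \<inter> {Lft, Rgt} else {})"
      by (intro card_Un_disjoint) auto
    ultimately show ?thesis using False unfolding c by auto
  qed
qed

text \<open>A containment test holds on the union iff it holds on both sides, and no edge runs
  between them. Hence both factors use the same tests and only the weights are convolved.\<close>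

lemma cnt_Disj_Union:
  assumes "wf_cexpr (Disj_Union p q)"
  shows "cnt r \<omega> (Disj_Union p q) \<tau> i = (\<Sum>j\<le>i. cnt r \<omega> p \<tau> j * cnt r \<omega> q \<tau> (i - j))"
proof -
  let ?e = "Disj_Union p q"
  from assms have disj: "V p \<inter> V q = {}" by simp
  have Ve: "V ?e = V p \<union> V q" and Ee: "edges (lgraph_of ?e) = edges (lgraph_of p) \<union> edges (lgraph_of q)"
    and lbe: "lb ?e v = (if v \<in> V p then lb p v else lb q v)" for v by (simp_all add: Let_def)
  let ?f = "\<lambda>(\<sigma>, \<rho>) v. if v \<in> V p then \<sigma> v else \<rho> v :: st"
  let ?P = "\<lambda>j. {\<sigma> \<in> asg r p \<tau>. sum \<omega> (selected p \<sigma>) = j}" and ?Q = "\<lambda>j. {\<sigma> \<in> asg r q \<tau>. sum \<omega> (selected q \<sigma>) = j}"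
  let ?S = "\<Union>j\<le>i. ?P j \<times> ?Q (i - j)"
  have eq: "?f (\<sigma>, \<rho>) v = (if v \<in> V p then \<sigma> v else if v \<in> V q then \<rho> v else Out)"
    if "\<sigma> \<in> asg r p \<tau>" "\<rho> \<in> asg r q \<tau>" for \<sigma> \<rho> v
    using that by (auto simp: asg_def)
  have sel: "selected ?e (?f (\<sigma>, \<rho>)) = selected p \<sigma> \<union> selected q \<rho>" "selected p \<sigma> \<inter> selected q \<rho> = {}" for \<sigma> \<rho>
    unfolding selected_def Ve using disj by (auto split: if_splits)
  have fin: "finite (selected e' \<sigma>)" for e' :: "nat cexpr" and \<sigma> by (simp add: selected_def)
  have w: "sum \<omega> (selected ?e (?f (\<sigma>, \<rho>))) = sum \<omega> (selected p \<sigma>) + sum \<omega> (selected q \<rho>)" for \<sigma> \<rho>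
    unfolding sel(1) by (rule sum.union_disjoint[OF fin fin sel(2)])
  have inj: "inj_on ?f ?S"
  proof (rule inj_onI, clarify)
    fix \<sigma> \<rho> \<sigma>' \<rho>'
    assume m: "\<sigma> \<in> asg r p \<tau>" "\<rho> \<in> asg r q \<tau>" "\<sigma>' \<in> asg r p \<tau>" "\<rho>' \<in> asg r q \<tau>"
      and e: "(\<lambda>v. if v \<in> V p then \<sigma> v else \<rho> v) = (\<lambda>v. if v \<in> V p then \<sigma>' v else \<rho>' v)"
    have "\<sigma> v = \<sigma>' v \<and> \<rho> v = \<rho>' v" for v
      using fun_cong[OF e, of v] m disj by (cases "v \<in> V p"; cases "v \<in> V q") (auto simp: asg_def)
    then show "\<sigma> = \<sigma>' \<and> \<rho> = \<rho>'" by blast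
  qed
  have img: "{\<sigma> \<in> asg r ?e \<tau>. sum \<omega> (selected ?e \<sigma>) = i} = ?f ` ?S"
  proof (intro equalityI subsetI)
    fix \<sigma> assume \<sigma>: "\<sigma> \<in> {\<sigma> \<in> asg r ?e \<tau>. sum \<omega> (selected ?e \<sigma>) = i}"
    let ?s = "\<lambda>v. if v \<in> V p then \<sigma> v else Out" and ?r = "\<lambda>v. if v \<in> V q then \<sigma> v else Out"
    have *: "\<sigma> v \<in> \<tau> (lb ?e v)" if "v \<in> V ?e" for v using \<sigma> that unfolding asg_def by blast
    have "\<forall>v \<in> V p. \<sigma> v \<in> \<tau> (lb p v)" using *[unfolded Ve lbe] by fastforce
    moreover have "\<sigma> v \<in> \<tau> (lb q v)" if "v \<in> V q" for v
      using *[unfolded Ve lbe, of v] disj that by (auto split: if_splits)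
    ultimately have s: "?s \<in> asg r p \<tau>" and r: "?r \<in> asg r q \<tau>"
      using \<sigma> edges_V[of _ _ p] edges_V[of _ _ q] unfolding asg_def Ve Ee lbe by auto
    have f: "\<sigma> = ?f (?s, ?r)" using \<sigma> unfolding asg_def Ve by (auto simp: fun_eq_iff)
    have "sum \<omega> (selected p ?s) + sum \<omega> (selected q ?r) = i"
      using \<sigma> w[of ?s ?r] f by simp
    then have "(?s, ?r) \<in> ?S" using s r by (auto intro!: bexI[of _ "sum \<omega> (selected p ?s)"])
    with f show "\<sigma> \<in> ?f ` ?S" by (rule image_eqI)
  next
    fix \<sigma> assume "\<sigma> \<in> ?f ` ?S"
    then obtain s r' j where sr: "j \<le> i" "s \<in> ?P j" "r' \<in> ?Q (i - j)" and \<sigma>: "\<sigma> = ?f (s, r')" by auto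
    have "sum \<omega> (selected ?e \<sigma>) = i" using sr unfolding \<sigma> w by simp
    moreover have "\<sigma> \<in> asg r ?e \<tau>"
      using sr disj edges_V[of _ _ p] edges_V[of _ _ q] unfolding asg_def \<sigma> Ve Ee lbe
      by (auto simp: disjoint_iff)
    ultimately show "\<sigma> \<in> {\<sigma> \<in> asg r ?e \<tau>. sum \<omega> (selected ?e \<sigma>) = i}" by simp
  qed
  have "cnt r \<omega> ?e \<tau> i = card ?S" unfolding cnt_def img by (rule card_image[OF inj])
  also have "\<dots> = (\<Sum>j\<le>i. card (?P j \<times> ?Q (i - j)))"
    by (rule card_UN_disjoint) auto
  also have "\<dots> = (\<Sum>j\<le>i. cnt r \<omega> p \<tau> j * cnt r \<omega> q \<tau> (i - j))"
    by (simp add: card_cartesian_product cnt_def)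
  finally show ?thesis .
qed

lemma asg_Join:
  "asg r (Join i j p) \<tau> =
     {\<sigma> \<in> asg r p \<tau>. \<forall>u \<in> V p. \<forall>v \<in> V p. lb p u = i \<longrightarrow> lb p v = j \<longrightarrow> ok (\<sigma> u) (\<sigma> v)}"
  by (auto simp: asg_def Let_def doubleton_eq_iff) (use ok_sym in blast)+

lemma selected_Join [simp]: "selected (Join i j p) = selected p"
  by (simp add: fun_eq_iff selected_def Let_def)

lemma cnt_Join_trivial:
  assumes "wf_cexpr p" "i \<notin> set (labs p) \<or> j \<notin> set (labs p)"
  shows "cnt r \<omega> (Join i j p) \<tau> = cnt r \<omega> p \<tau>"
proof -
  have "asg r (Join i j p) \<tau> = asg r p \<tau>"
    unfolding asg_Join using assms(2) unfolding set_labs[OF assms(1)] by auto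
  then show ?thesis by (simp add: cnt_def fun_eq_iff)
qed

end

section \<open>Joins as combinations modulo two, and correctness of the tables\<close>

lemma sum_list_card_filter:
  "finite B \<Longrightarrow> (\<Sum>x\<leftarrow>xs. card {b \<in> B. P x b}) = (\<Sum>b\<in>B. length (filter (\<lambda>x. P x b) xs))"
proof (induction xs)
  case (Cons x xs)
  have "(\<Sum>b\<in>B. length (filter (\<lambda>y. P y b) (x # xs))) =
      (\<Sum>b\<in>B. of_bool (P x b) + length (filter (\<lambda>y. P y b) xs))"
    by (intro sum.cong) auto
  with Cons show ?case by (simp add: sum.distrib Int_def)
qed simp

text \<open>In \<open>jt_parity\<close>, \<open>T\<close> and \<open>T'\<close> stand for the exact
  sets of states in two nonempty classes: the number of listed pairs of tests that they pass must be
  odd iff they pass \<open>s\<close> and \<open>s'\<close> and may be joined. In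
  \<open>jt_less\<close> the strict bound says that the listed tests are available at live
  labels.\<close>

locale cut_count = tables a jt wt + state_problem ok
  for a jt wt ok +
  fixes tst :: "nat \<Rightarrow> st set"
  assumes a_pos: "0 < a"
    and jt_less: "\<lbrakk>s \<le> a; s' \<le> a; (u, v) \<in> set (jt s s')\<rbrakk> \<Longrightarrow> u < a \<and> v < a"
    and jt_parity: "\<lbrakk>s \<le> a; s' \<le> a; T \<noteq> {}; T' \<noteq> {}; T \<subseteq> tst a; T' \<subseteq> tst a\<rbrakk> \<Longrightarrow>
      odd (length (filter (\<lambda>(u, v). T \<subseteq> tst u \<and> T' \<subseteq> tst v) (jt s s'))) \<longleftrightarrow>
      T \<subseteq> tst s \<and> T' \<subseteq> tst s' \<and> (\<forall>x \<in> T. \<forall>y \<in> T'. ok x y)"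
    and tst_subset: "s \<le> a \<Longrightarrow> tst s \<subseteq> tst a"
    and wt: "s \<le> a \<Longrightarrow> wt s =
      (odd (card (tst s \<inter> {Out, Forb})), odd (card (tst s \<inter> {Lft, Rgt})), Lft \<in> tst s)"
begin

text \<open>Double counting: on the right, an assignment is counted once for each listed pair of
  tests that it passes, and by \<open>jt_parity\<close> this number is odd exactly for the
  assignments counted on the left.\<close>

lemma odd_cnt_Join:
  assumes wf: "wf_cexpr p" and ij: "i \<noteq> j" "i \<in> set (labs p)" "j \<in> set (labs p)"
    and s: "s \<le> a" "s' \<le> a" "\<tau> i = tst s" "\<tau> j = tst s'"
  shows "odd (cnt r \<omega> (Join i j p) \<tau> k) \<longleftrightarrow>
    odd (\<Sum>(u, v)\<leftarrow>jt s s'. cnt r \<omega> p (\<tau>(i := tst u, j := tst v)) k)"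
proof -
  \<comment> \<open>Both classes get the full test, so \<open>B\<close> contains the assignments
    counted by every entry involved; an entry then only restricts the occurring states
    \<open>T\<close> and \<open>T'\<close>.\<close>
  define B where "B = {\<sigma> \<in> asg r p (\<tau>(i := tst a, j := tst a)). sum \<omega> (selected p \<sigma>) = k}"
  define T where "T \<sigma> = \<sigma> ` {v \<in> V p. lb p v = i}" for \<sigma> :: "nat \<Rightarrow> st"
  define T' where "T' \<sigma> = \<sigma> ` {v \<in> V p. lb p v = j}" for \<sigma> :: "nat \<Rightarrow> st"
  have fin: "finite B" by (simp add: B_def)
  have T: "T \<sigma> \<noteq> {}" "T' \<sigma> \<noteq> {}" for \<sigma>
    using ij unfolding T_def T'_def set_labs[OF wf] by auto
  have Ta: "T \<sigma> \<subseteq> tst a" "T' \<sigma> \<subseteq> tst a" if "\<sigma> \<in> B" for \<sigma>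
    using that ij(1) unfolding B_def asg_def T_def T'_def by auto
  have c': "{\<sigma> \<in> asg r p (\<tau>(i := tst u, j := tst v)). sum \<omega> (selected p \<sigma>) = k} =
      {\<sigma> \<in> B. T \<sigma> \<subseteq> tst u \<and> T' \<sigma> \<subseteq> tst v}"
    if "u \<le> a" "v \<le> a" for u v
  proof (intro equalityI subsetI)
    fix \<sigma> assume "\<sigma> \<in> {\<sigma> \<in> asg r p (\<tau>(i := tst u, j := tst v)). sum \<omega> (selected p \<sigma>) = k}"
    then show "\<sigma> \<in> {\<sigma> \<in> B. T \<sigma> \<subseteq> tst u \<and> T' \<sigma> \<subseteq> tst v}"
      using tst_subset[OF that(1)] tst_subset[OF that(2)] ij(1)
      unfolding B_def asg_def T_def T'_def by (auto split: if_splits)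
  next
    fix \<sigma> assume "\<sigma> \<in> {\<sigma> \<in> B. T \<sigma> \<subseteq> tst u \<and> T' \<sigma> \<subseteq> tst v}"
    then show "\<sigma> \<in> {\<sigma> \<in> asg r p (\<tau>(i := tst u, j := tst v)). sum \<omega> (selected p \<sigma>) = k}"
      using ij(1) unfolding B_def asg_def T_def T'_def by (auto split: if_splits)
  qed
  note c = arg_cong[where f = card, OF c', folded cnt_def]
  have "\<tau>(i := tst s, j := tst s') = \<tau>" unfolding s(3,4)[symmetric] by simp
  with c'[OF s(1,2)]
  have "{\<sigma> \<in> asg r p \<tau>. sum \<omega> (selected p \<sigma>) = k} = {\<sigma> \<in> B. T \<sigma> \<subseteq> tst s \<and> T' \<sigma> \<subseteq> tst s'}"
    by simp
  moreover have "cnt r \<omega> (Join i j p) \<tau> k =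
      card {\<sigma> \<in> {\<sigma> \<in> asg r p \<tau>. sum \<omega> (selected p \<sigma>) = k}. \<forall>x \<in> T \<sigma>. \<forall>y \<in> T' \<sigma>. ok x y}"
    unfolding cnt_def asg_Join by (intro arg_cong[where f = card]) (auto simp: T_def T'_def)
  ultimately have "cnt r \<omega> (Join i j p) \<tau> k =
      card {\<sigma> \<in> B. T \<sigma> \<subseteq> tst s \<and> T' \<sigma> \<subseteq> tst s' \<and> (\<forall>x \<in> T \<sigma>. \<forall>y \<in> T' \<sigma>. ok x y)}"
    by (simp add: conj_ac)
  also have "{\<sigma> \<in> B. T \<sigma> \<subseteq> tst s \<and> T' \<sigma> \<subseteq> tst s' \<and> (\<forall>x \<in> T \<sigma>. \<forall>y \<in> T' \<sigma>. ok x y)} =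
      {\<sigma> \<in> B. odd (length (filter (\<lambda>(u, v). T \<sigma> \<subseteq> tst u \<and> T' \<sigma> \<subseteq> tst v) (jt s s')))}"
    using jt_parity[OF s(1,2) T Ta] by blast
  also have "odd (card \<dots>) \<longleftrightarrow>
      odd (\<Sum>\<sigma>\<in>B. length (filter (\<lambda>(u, v). T \<sigma> \<subseteq> tst u \<and> T' \<sigma> \<subseteq> tst v) (jt s s')))"
    by (simp add: even_sum_iff[OF fin])
  also have "(\<Sum>\<sigma>\<in>B. length (filter (\<lambda>(u, v). T \<sigma> \<subseteq> tst u \<and> T' \<sigma> \<subseteq> tst v) (jt s s'))) =
      (\<Sum>x\<leftarrow>jt s s'. card {\<sigma> \<in> B. case x of (u, v) \<Rightarrow> T \<sigma> \<subseteq> tst u \<and> T' \<sigma> \<subseteq> tst v})"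
    by (rule sum_list_card_filter[OF fin, symmetric])
  also have "\<dots> = (\<Sum>(u, v)\<leftarrow>jt s s'. cnt r \<omega> p (\<tau>(i := tst u, j := tst v)) k)"
    using jt_less[OF s(1,2)] by (intro arg_cong[where f = sum_list] map_cong) (auto simp: c less_imp_le)
  finally show ?thesis .
qed

definition rep :: "nat \<Rightarrow> bool list \<Rightarrow> (nat \<Rightarrow> nat) \<Rightarrow> bool" where
  "rep d p f \<longleftrightarrow> length p = d \<and> (\<forall>k < d. p ! k = odd (f k))"

lemma rep_cong: "rep d p f \<Longrightarrow> (\<And>k. k < d \<Longrightarrow> odd (f k) \<longleftrightarrow> odd (g k)) \<Longrightarrow> rep d p g"
  by (auto simp: rep_def)

lemma rep_zeros: "rep d (zeros d) (\<lambda>_. 0)"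
  by (simp add: rep_def)

lemma padd_nth: "k < length p \<Longrightarrow> k < length q \<Longrightarrow> padd p q ! k = (p ! k \<noteq> q ! k)"
  by (induction p q arbitrary: k rule: padd.induct) (auto simp: nth_Cons split: nat.splits)

lemma rep_padd: "rep d p f \<Longrightarrow> rep d q g \<Longrightarrow> rep d (padd p q) (\<lambda>k. f k + g k)"
  by (auto simp: rep_def padd_nth)

lemma zpow_nth: "k < d \<Longrightarrow> zpow w d ! k = (k = w)"
  by (induction w d arbitrary: k rule: zpow.induct) (auto simp: nth_Cons split: nat.splits)

lemma rep_scaled: "rep d (scaled b w d) (\<lambda>k. of_bool (b \<and> k = w))"
  by (auto simp: rep_def scaled_def zpow_nth)

lemma rep_pmul_aux:
  assumes "rep d q g"
  shows "rep d (pmul d p q) (\<lambda>k. \<Sum>j\<le>k. of_bool (j < length p \<and> p ! j) * g (k - j))"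
proof (induction p)
  case Nil
  show ?case by (simp add: rep_def)
next
  case (Cons c p)
  let ?h = "\<lambda>k. \<Sum>j\<le>k. of_bool (j < length p \<and> p ! j) * g (k - j)"
  from assms have len: "length q = d" by (simp add: rep_def)
  \<comment> \<open>Multiplication by the variable shifts the coefficients by one.\<close>
  have sh: "rep d (butlast (False # pmul d p q)) (\<lambda>k. if k = 0 then 0 else ?h (k - 1))"
    using Cons len by (auto simp: rep_def nth_butlast nth_Cons simp del: butlast.simps split: nat.splits)
  have sc: "rep d (if c then q else zeros d) (\<lambda>k. of_bool c * g k)"
    using assms by (auto simp: rep_def)
  have "(\<Sum>j\<le>k. of_bool (j < length (c # p) \<and> (c # p) ! j) * g (k - j)) =
      of_bool c * g k + (if k = 0 then 0 else ?h (k - 1))" for k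
    by (cases k) (simp_all add: sum.atMost_Suc_shift del: sum.atMost_Suc)
  then show ?case using rep_padd[OF sc sh] by simp
qed

lemma rep_pmul:
  assumes "rep d p f" "rep d q g"
  shows "rep d (pmul d p q) (\<lambda>k. \<Sum>j\<le>k. f j * g (k - j))"
proof (rule rep_cong[OF rep_pmul_aux[OF assms(2)]])
  fix k assume "k < d"
  then have "odd (of_bool (j < length p \<and> p ! j) * g (k - j)) \<longleftrightarrow> odd (f j * g (k - j))" if "j \<le> k" for j
    using assms(1) that by (simp add: rep_def)
  then have "{j \<in> {..k}. odd (of_bool (j < length p \<and> p ! j) * g (k - j))} = {j \<in> {..k}. odd (f j * g (k - j))}"
    by blast
  then show "odd (\<Sum>j\<le>k. of_bool (j < length p \<and> p ! j) * g (k - j)) \<longleftrightarrow> odd (\<Sum>j\<le>k. f j * g (k - j))"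
    unfolding even_sum_iff[OF finite_atMost] by (rule arg_cong)
qed

lemma rep_jsum:
  assumes "\<And>u v. (u, v) \<in> set us \<Longrightarrow> rep d (lk t ls ((i, u) # (j, v) # s)) (f u v)"
  shows "rep d (jsum d t ls s i j us) (\<lambda>k. \<Sum>(u, v)\<leftarrow>us. f u v k)"
  using assms
proof (induction us)
  case Nil
  show ?case by (simp add: rep_zeros)
next
  case (Cons h us)
  obtain u v where h: "h = (u, v)" by (cases h)
  from Cons have "rep d (lk t ls ((i, u) # (j, v) # s)) (f u v)"
    "rep d (jsum d t ls s i j us) (\<lambda>k. \<Sum>(u, v)\<leftarrow>us. f u v k)" by (auto simp: h)
  from rep_padd[OF this] show ?case by (simp add: h)
qed

text \<open>Index \<open>a\<close> is the full test, which restricts nothing; live labels only use the indices below.\<close>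

definition eff :: "(nat \<times> nat) list \<Rightarrow> (nat \<times> nat) list \<Rightarrow> nat \<Rightarrow> nat" where
  "eff lv s l = (if get lv l = 0 then a else get s l)"

definition valid :: "nat list \<Rightarrow> (nat \<times> nat) list \<Rightarrow> (nat \<times> nat) list \<Rightarrow> bool" where
  "valid ls lv s \<longleftrightarrow> (\<forall>l \<in> set ls. get lv l \<noteq> 0 \<longrightarrow> get s l < a)"

text \<open>The entry found need not have been computed for \<open>s\<close> itself, since at a dead
  label the index is ignored. It was computed for some \<open>s'\<close> that agrees with
  \<open>eff\<close> on \<open>ls\<close>, which is all that the recursion needs. The right-hand
  side of the first equation is just \<open>f s'\<close>.\<close>

lemma lk_tab:
  "distinct ls \<Longrightarrow> valid ls lv s \<Longrightarrow>
   \<exists>s'. lk (tab f ls lv s0) ls s = lk (Leaf (f s')) [] s \<and> (\<forall>l \<in> set ls. get s' l = eff lv s l) \<and>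
     (\<forall>l. l \<notin> set ls \<longrightarrow> get s' l = get s0 l)"
proof (induction ls arbitrary: s0)
  case (Cons l ls)
  let ?t = "eff lv s l"
  have "sel (map (\<lambda>t. tab f ls lv ((l, t) # s0)) (if get lv l = 0 then dead_opts else live_opts)) (get s l) =
      tab f ls lv ((l, ?t) # s0)"
    using Cons.prems by (auto simp: eff_def dead_opts_def live_opts_def valid_def sel_nth split: nat.splits)
  moreover have "valid ls lv s" "distinct ls" "l \<notin> set ls" using Cons.prems by (auto simp: valid_def)
  moreover from Cons.IH[OF this(2,1), of "(l, ?t) # s0"] obtain s' where
    "lk (tab f ls lv ((l, ?t) # s0)) ls s = lk (Leaf (f s')) [] s" "\<forall>l \<in> set ls. get s' l = eff lv s l"
    "\<forall>l'. l' \<notin> set ls \<longrightarrow> get s' l' = get ((l, ?t) # s0) l'" by blast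
  ultimately show ?case by (intro exI[of _ s']) auto
qed auto

text \<open>The induction is over arbitrary \<open>lv\<close> and \<open>s\<close>, because a node
  consults the tables of its children with other marks and tests than its own.\<close>

lemma dp_rep:
  assumes "distinct ls"
  shows "\<lbrakk>wf_cexpr e; set (all_labs e) \<subseteq> set ls; valid ls lv s\<rbrakk> \<Longrightarrow>
    rep d (lk (dp d ls w r e lv) ls s) (cnt r (get w) e (\<lambda>l. tst (eff lv s l)))"
proof (induction e arbitrary: lv s)
  case (Introduce l v)
  obtain s' where s': "lk (dp d ls w r (Introduce l v) lv) ls s = leaf d ls w r (Introduce l v) (Leaf []) (Leaf []) s'"
    "\<forall>l \<in> set ls. get s' l = eff lv s l"
    using lk_tab[OF assms Introduce.prems(3)] by (metis dp.simps(1) lk.simps(1))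
  let ?t = "eff lv s l"
  have l: "get s' l = ?t" using s' Introduce.prems by simp
  have t: "?t \<le> a" using Introduce.prems by (auto simp: eff_def valid_def less_imp_le)
  show ?case
  proof (cases "v = r")
    case True
    then show ?thesis using rep_scaled[of d "Lft \<in> tst ?t" "get w v"]
      unfolding s'(1) by (simp add: l wt[OF t] cnt_Introduce[abs_def])
  next
    case False
    show ?thesis
      unfolding s'(1) using False
      by (auto simp: l wt[OF t] cnt_Introduce[abs_def] intro!: rep_cong[OF rep_padd[OF rep_scaled rep_scaled]])
  qed
next
  case (Disj_Union p q)
  obtain s' where s': "lk (dp d ls w r (Disj_Union p q) lv) ls s =
      leaf d ls w r (Disj_Union p q) (dp d ls w r p lv) (dp d ls w r q lv) s'"
    "\<forall>l \<in> set ls. get s' l = eff lv s l"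
    using lk_tab[OF assms Disj_Union.prems(3)] by (metis dp.simps(2) lk.simps(1))
  have v: "valid ls lv s'" using s'(2) Disj_Union.prems(3) by (auto simp: valid_def eff_def)
  have wf: "wf_cexpr p" "wf_cexpr q" "set (all_labs p) \<subseteq> set ls" "set (all_labs q) \<subseteq> set ls"
    using Disj_Union.prems by auto
  have e: "cnt r (get w) e' (\<lambda>l. tst (eff lv s' l)) = cnt r (get w) e' (\<lambda>l. tst (eff lv s l))"
    if "wf_cexpr e'" "set (all_labs e') \<subseteq> set ls" for e'
    using s'(2) labs_subset[of e'] that by (intro cnt_cong) (auto simp: eff_def subset_iff)
  show ?case
    using rep_pmul[OF Disj_Union.IH(1)[OF wf(1,3) v] Disj_Union.IH(2)[OF wf(2,4) v]]
    unfolding s'(1) by (simp add: e wf cnt_Disj_Union[OF Disj_Union.prems(1), abs_def])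
next
  case (Relabel i j p)
  let ?b = "i \<in> set (labs p)"
  let ?lv = "if ?b then (i, get lv j) # lv else lv"
  obtain s' where s': "lk (dp d ls w r (Relabel i j p) lv) ls s =
      leaf d ls w r (Relabel i j p) (dp d ls w r p ?lv) (Leaf []) s'"
    "\<forall>l \<in> set ls. get s' l = eff lv s l"
    using lk_tab[OF assms Relabel.prems(3)] by (metis dp.simps(3) lk.simps(1))
  let ?s = "if ?b then (i, get s' j) # s' else s'"
  have wf: "wf_cexpr p" "set (all_labs p) \<subseteq> set ls" "?b \<Longrightarrow> j \<in> set ls"
    using Relabel.prems by auto
  have v: "valid ls ?lv ?s" using s'(2) Relabel.prems(3) wf(3) by (auto simp: valid_def eff_def)
  have e: "cnt r (get w) p (\<lambda>l. tst (eff ?lv ?s l)) = cnt r (get w) (Relabel i j p) (\<lambda>l. tst (eff lv s l))"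
    unfolding cnt_Relabel
    using s'(2) labs_subset[of p] wf by (intro cnt_cong) (auto simp: eff_def subset_iff)
  show ?case using Relabel.IH[OF wf(1,2) v] unfolding e s'(1) by simp
next
  case (Join i j p)
  let ?b = "i \<in> set (labs p) \<and> j \<in> set (labs p)"
  let ?lv = "if ?b then (i, 1) # (j, 1) # lv else lv"
  obtain s' where s': "lk (dp d ls w r (Join i j p) lv) ls s =
      leaf d ls w r (Join i j p) (dp d ls w r p ?lv) (Leaf []) s'"
    "\<forall>l \<in> set ls. get s' l = eff lv s l"
    using lk_tab[OF assms Join.prems(3)] by (metis dp.simps(4) lk.simps(1))
  have wf: "wf_cexpr p" "set (all_labs p) \<subseteq> set ls" "i \<noteq> j" "?b \<Longrightarrow> i \<in> set ls \<and> j \<in> set ls"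
    using Join.prems labs_subset[of p] by auto
  show ?case
  proof (cases ?b)
    case True
    let ?\<tau> = "\<lambda>l. tst (eff lv s l)"
    have ij: "get s' i = eff lv s i" "get s' j = eff lv s j" "eff lv s i \<le> a" "eff lv s j \<le> a"
      using s'(2) wf(4)[OF True] Join.prems(3) by (auto simp: eff_def valid_def less_imp_le)
    have IH: "rep d (lk (dp d ls w r p ?lv) ls ((i, u) # (j, v) # s')) (cnt r (get w) p (?\<tau>(i := tst u, j := tst v)))"
      if uv: "(u, v) \<in> set (jt (eff lv s i) (eff lv s j))" for u v
    proof -
      \<comment> \<open>The strict bound is what makes the lookup valid: below the join both labels
        are live and have no entry for the full test.\<close>
      have lt: "u < a" "v < a" using jt_less[OF ij(3,4) uv] by auto
      have v: "valid ls ?lv ((i, u) # (j, v) # s')"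
        using True s'(2) Join.prems(3) lt by (auto simp: valid_def eff_def)
      have e: "cnt r (get w) p (\<lambda>l. tst (eff ?lv ((i, u) # (j, v) # s') l)) = cnt r (get w) p (?\<tau>(i := tst u, j := tst v))"
        using s'(2) labs_subset[of p] wf True by (intro cnt_cong) (auto simp: eff_def subset_iff)
      show ?thesis using Join.IH[OF wf(1,2) v] unfolding e .
    qed
    have "rep d (jsum d (dp d ls w r p ?lv) ls s' i j (jt (eff lv s i) (eff lv s j)))
        (\<lambda>k. \<Sum>(u, v)\<leftarrow>jt (eff lv s i) (eff lv s j). cnt r (get w) p (?\<tau>(i := tst u, j := tst v)) k)"
      by (rule rep_jsum[OF IH])
    moreover have "lk (dp d ls w r (Join i j p) lv) ls s = jsum d (dp d ls w r p ?lv) ls s' i j (jt (eff lv s i) (eff lv s j))"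
      unfolding s'(1) using True ij by simp
    ultimately show ?thesis
      using odd_cnt_Join[OF wf(1,3) conjunct1[OF True] conjunct2[OF True] ij(3,4), of ?\<tau>]
      by (auto intro: rep_cong)
  next
    case False
    \<comment> \<open>One of the classes is empty, so no edge is added; both labels keep their marks
      and tests, and a dead label stays dead.\<close>
    then have lv: "?lv = lv" and l: "leaf d ls w r (Join i j p) t t' s' = lk t ls s'" for t t' by auto
    have v: "valid ls lv s'" using s'(2) Join.prems(3) by (auto simp: valid_def eff_def)
    have e: "cnt r (get w) p (\<lambda>l. tst (eff lv s' l)) = cnt r (get w) (Join i j p) (\<lambda>l. tst (eff lv s l))"
      unfolding cnt_Join_trivial[OF wf(1) False[unfolded de_Morgan_conj]]
      using s'(2) labs_subset[of p] wf by (intro cnt_cong) (auto simp: eff_def subset_iff)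
    show ?thesis using Join.IH[OF wf(1,2) v] unfolding e s'(1) l lv .
  qed
qed

text \<open>At the root no label is live, so the only entry has the full test everywhere and no
  assignment is excluded by a test.\<close>

lemma accepts_iff:
  assumes "distinct ls" "wf_cexpr e" "set (all_labs e) \<subseteq> set ls"
  shows "accepts d ls w e r \<longleftrightarrow> (\<exists>k < d. odd (cnt r (get w) e (\<lambda>_. tst a) k))"
proof -
  have "rep d (lk (dp d ls w r e []) ls []) (cnt r (get w) e (\<lambda>l. tst (eff [] [] l)))"
    using assms by (intro dp_rep) (auto simp: valid_def)
  then show ?thesis by (auto simp: rep_def accepts_def in_set_conv_nth eff_def)
qed

end

section \<open>The tests for the two problems\<close>

text \<open>The requirements on \<open>jt\<close> as a computable statement: tests are lists and the
  possible sets of occurring states are sublists of the full test, so the two instances are decided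
  by evaluation.\<close>

definition join_parity :: "nat \<Rightarrow> (nat \<Rightarrow> st list) \<Rightarrow> (st \<Rightarrow> st \<Rightarrow> bool) \<Rightarrow> (nat \<Rightarrow> nat \<Rightarrow> (nat \<times> nat) list) \<Rightarrow> bool" where
  "join_parity a t ok jt \<longleftrightarrow> list_all (\<lambda>s. list_all (\<lambda>s'. let us = jt s s' in
     list_all (\<lambda>(u, v). u < a \<and> v < a) us \<and>
     list_all (\<lambda>x. list_all (\<lambda>y. x = [] \<or> y = [] \<or>
       odd (length (filter (\<lambda>(u, v). list_all (List.member (t u)) x \<and> list_all (List.member (t v)) y) us)) =
       (list_all (List.member (t s)) x \<and> list_all (List.member (t s')) y \<and> list_all (\<lambda>p. list_all (ok p) y) x))
       (subseqs (t a))) (subseqs (t a))) [0..<Suc a]) [0..<Suc a]"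

definition ok_cvc :: "st \<Rightarrow> st \<Rightarrow> bool" where
  "ok_cvc x y \<longleftrightarrow> (x, y) \<notin> {(Out, Out), (Lft, Rgt), (Rgt, Lft)}"

definition tst_cvc :: "nat \<Rightarrow> st list" where
  "tst_cvc n = [[Out], [Lft], [Rgt], [Out, Lft], [Out, Rgt], [Lft, Rgt], [Out, Lft, Rgt]] ! n"

text \<open>Here \<open>t\<close> ranges over the possible sets of states that occur at the first label, \<open>v\<close> is the largest
  test at the second label that is compatible with \<open>t\<close>, and \<open>u\<close> expresses by Moebius inversion
  (without signs, modulo two) that exactly the states in \<open>t\<close> occur.\<close>

definition jt_cvc :: "nat \<Rightarrow> nat \<Rightarrow> (nat \<times> nat) list" where
  "jt_cvc s s' = [(u, v). t \<leftarrow> [0..<6], list_all (List.member (tst_cvc s)) (tst_cvc t),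
     v \<leftarrow> [0..<6], tst_cvc v = filter (\<lambda>y. list_all (\<lambda>x. ok_cvc x y) (tst_cvc t)) (tst_cvc s'),
     u \<leftarrow> [0..<6], list_all (List.member (tst_cvc t)) (tst_cvc u)]"

definition ok_cds :: "st \<Rightarrow> st \<Rightarrow> bool" where
  "ok_cds x y \<longleftrightarrow> x = Out \<or> y = Out \<or> x = y"

definition tst_cds :: "nat \<Rightarrow> st list" where
  "tst_cds n = [[Out], [Out, Forb], [Out, Lft], [Out, Rgt], [Out, Forb, Lft, Rgt], [Out, Forb, Lft, Rgt]] ! n"

text \<open>Two classes are compatible if one of them contains no state but \<open>Out\<close> (inclusion-exclusion, the
  first three entries) or both contain the same single other state \<open>x\<close>. Index 5 is a copy of the
  live test 4, used for labels that take part in no later join.\<close>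

definition jt_cds :: "nat \<Rightarrow> nat \<Rightarrow> (nat \<times> nat) list" where
  "jt_cds s s' = [(min s 4, 0), (0, min s' 4), (0, 0)] @
     concat [[(x, x), (x, 0), (0, x), (0, 0)]. x \<leftarrow> [1..<4],
       list_all (List.member (tst_cds s)) (tst_cds x), list_all (List.member (tst_cds s')) (tst_cds x)]"

lemma join_parity_cvc: "join_parity 6 tst_cvc ok_cvc jt_cvc"
  by code_simp

lemma join_parity_cds: "join_parity 5 tst_cds ok_cds jt_cds"
  by code_simp

section \<open>The isolation lemma\<close>

lemma val_inject: "length p = length q \<Longrightarrow> val p = val q \<Longrightarrow> p = q"
proof (induction p q rule: list_induct2)
  case (Cons b p c q)
  have "of_bool b + 2 * val p = of_bool c + 2 * val q" using Cons.prems by simp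
  then have "b = c" by (cases b; cases c) (simp_all, presburger+)
  with Cons show ?case by simp
qed simp

definition chunk :: "nat \<Rightarrow> nat \<Rightarrow> bool list \<Rightarrow> bool list" where
  "chunk m i r = take m (drop (i * m) r)"

definition minimal_in :: "'a set set \<Rightarrow> ('a \<Rightarrow> nat) \<Rightarrow> 'a set \<Rightarrow> bool" where
  "minimal_in F \<omega> X \<longleftrightarrow> X \<in> F \<and> (\<forall>Y \<in> F. sum \<omega> X \<le> sum \<omega> Y)"

lemma minimal_in_exists: "F \<noteq> {} \<Longrightarrow> \<exists>X. minimal_in F \<omega> X"
  using ex_has_least_nat[of "\<lambda>X. X \<in> F" _ "sum \<omega>"] unfolding minimal_in_def by blast

text \<open>The isolation lemma of Mulmuley, Vazirani and Vazirani. If the lightest set is not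
  unique, some element lies in one lightest set but not in another. With the random parts of all
  other elements fixed, this happens for at most one value of its own part; a union bound over the
  elements finishes the proof.\<close>

lemma isolation:
  fixes vs :: "'a list" and \<omega> :: "bool list \<Rightarrow> 'a \<Rightarrow> nat"
  assumes F: "F \<subseteq> Pow (set vs)" "F \<noteq> {}" and d: "distinct vs"
    and \<omega>: "\<And>r i. i < length vs \<Longrightarrow> \<omega> r (vs ! i) = base (vs ! i) + val (chunk m i r)"
    and m: "2 * length vs \<le> 2 ^ m"
  shows "2 * card {r. length r = length vs * m \<and> \<not> (\<exists>!X. minimal_in F (\<omega> r) X)} \<le> 2 ^ (length vs * m)"
proof -
  let ?n = "length vs"
  \<comment> \<open>The strings for which element \<open>i\<close> is ambiguous, that is, both used
    and avoided by lightest sets.\<close>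
  define Bad where "Bad i = {r. length r = ?n * m \<and>
    (\<exists>A B. minimal_in F (\<omega> r) A \<and> minimal_in F (\<omega> r) B \<and> vs ! i \<in> A \<and> vs ! i \<notin> B)}" for i
  have Bad_fin: "finite (Bad i)" for i
    by (rule finite_subset[OF _ finite_bits[of "?n * m"]]) (auto simp: Bad_def)
  have bad: "{r. length r = ?n * m \<and> \<not> (\<exists>!X. minimal_in F (\<omega> r) X)} \<subseteq> (\<Union>i<?n. Bad i)"
  proof
    fix r assume r: "r \<in> {r. length r = ?n * m \<and> \<not> (\<exists>!X. minimal_in F (\<omega> r) X)}"
    obtain A where A: "minimal_in F (\<omega> r) A" using minimal_in_exists[OF F(2)] by blast
    have "\<exists>B. minimal_in F (\<omega> r) B \<and> B \<noteq> A"
    proof (rule ccontr)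
      assume "\<nexists>B. minimal_in F (\<omega> r) B \<and> B \<noteq> A"
      then have "X = A" if "minimal_in F (\<omega> r) X" for X using that by blast
      with A have "\<exists>!X. minimal_in F (\<omega> r) X" by (intro ex1I[of "minimal_in F (\<omega> r)" A])
      with r show False by blast
    qed
    with A obtain B where AB: "minimal_in F (\<omega> r) A" "minimal_in F (\<omega> r) B" "A \<noteq> B" by blast
    have "A \<subseteq> set vs" "B \<subseteq> set vs" using AB(1,2) F(1) by (auto simp: minimal_in_def)
    then obtain v where "v \<in> set vs" "v \<in> A \<and> v \<notin> B \<or> v \<in> B \<and> v \<notin> A" using AB(3) by blast
    moreover from this(1) obtain i where i: "i < ?n" "v = vs ! i" by (auto simp: in_set_conv_nth)
    ultimately have "\<exists>A B. minimal_in F (\<omega> r) A \<and> minimal_in F (\<omega> r) B \<and> vs ! i \<in> A \<and> vs ! i \<notin> B"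
      using AB(1,2) by blast
    then have "r \<in> Bad i" using r by (simp add: Bad_def)
    with i(1) show "r \<in> (\<Union>i<?n. Bad i)" by blast
  qed
  have card_Bad: "card (Bad i) \<le> 2 ^ ((?n - 1) * m)" if i: "i < ?n" for i
  proof -
    let ?v = "vs ! i"
    let ?h = "\<lambda>r :: bool list. take (i * m) r @ drop (i * m + m) r"
    have im: "i * m + m \<le> ?n * m" using mult_right_mono[of "Suc i" ?n m] i by simp
    have split: "r = take (i * m) r @ chunk m i r @ drop (i * m + m) r" for r :: "bool list"
    proof -
      have "drop (i * m + m) r = drop m (drop (i * m) r)" by (simp add: add.commute)
      then show ?thesis unfolding chunk_def by (simp only: append_take_drop_id)
    qed
    \<comment> \<open>Deleting the chunk of \<open>i\<close> loses no information on
      \<open>Bad i\<close>, since the other chunks determine it there.\<close>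
    have "inj_on ?h (Bad i)"
    proof (rule inj_onI)
      fix r r' assume r: "r \<in> Bad i" "r' \<in> Bad i" and h: "?h r = ?h r'"
      have len: "length r = ?n * m" "length r' = ?n * m" using r by (auto simp: Bad_def)
      then have eq: "take (i * m) r = take (i * m) r'" "drop (i * m + m) r = drop (i * m + m) r'"
        using h im by (auto simp: append_eq_append_conv)
      have chunks: "chunk m j r = chunk m j r'" if "j \<noteq> i" for j
      proof (cases "j < i")
        case True
        then have "j * m + m \<le> i * m" using mult_right_mono[of "Suc j" i m] by simp
        then have "chunk m j x = take m (drop (j * m) (take (i * m) x))" for x :: "bool list"
          by (simp add: chunk_def drop_take min_def)
        then show ?thesis using eq by simp
      next
        case False
        with that have "i * m + m \<le> j * m" using mult_right_mono[of "Suc i" j m] by simp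
        then have "chunk m j x = take m (drop (j * m - (i * m + m)) (drop (i * m + m) x))" for x :: "bool list"
          by (simp add: chunk_def)
        then show ?thesis using eq by (simp only:)
      qed
      have \<omega>_eq: "\<omega> r v = \<omega> r' v" if v: "v \<in> set vs" "v \<noteq> ?v" for v
      proof -
        obtain j where j: "j < ?n" "v = vs ! j" using v(1) by (auto simp: in_set_conv_nth)
        with v(2) have "j \<noteq> i" by auto
        then show ?thesis using \<omega>[OF j(1)] chunks j(2) by simp
      qed
      obtain A B where A: "minimal_in F (\<omega> r) A" "?v \<in> A" and B: "minimal_in F (\<omega> r) B" "?v \<notin> B"
        using r(1) by (auto simp: Bad_def)
      obtain A' B' where A': "minimal_in F (\<omega> r') A'" "?v \<in> A'" and B': "minimal_in F (\<omega> r') B'" "?v \<notin> B'"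
        using r(2) by (auto simp: Bad_def)
      have sub: "X \<subseteq> set vs" if "X \<in> F" for X using that F(1) by auto
      have out: "sum (\<omega> r) X = sum (\<omega> r') X" if "X \<in> F" "?v \<notin> X" for X
        using that sub[OF that(1)] by (intro sum.cong \<omega>_eq) auto
      have inn: "sum (\<omega> r) X + val (chunk m i r') = sum (\<omega> r') X + val (chunk m i r)" if "X \<in> F" "?v \<in> X" for X
      proof -
        have fin: "finite X" using sub[OF that(1)] finite_subset by blast
        have "sum (\<omega> r) (X - {?v}) = sum (\<omega> r') (X - {?v})"
          using sub[OF that(1)] by (intro sum.cong \<omega>_eq) auto
        then show ?thesis using sum.remove[OF fin that(2), of "\<omega> r"] sum.remove[OF fin that(2), of "\<omega> r'"]
          \<omega>[OF i, of r] \<omega>[OF i, of r'] by simp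
      qed
      have mem: "A \<in> F" "B \<in> F" "A' \<in> F" "B' \<in> F" using A B A' B' by (auto simp: minimal_in_def)
      have m1: "sum (\<omega> r) A \<le> sum (\<omega> r) B" "sum (\<omega> r) B \<le> sum (\<omega> r) A" "sum (\<omega> r) A \<le> sum (\<omega> r) A'" "sum (\<omega> r) B \<le> sum (\<omega> r) B'"
        using A B mem unfolding minimal_in_def by blast+
      have m2: "sum (\<omega> r') A' \<le> sum (\<omega> r') B'" "sum (\<omega> r') B' \<le> sum (\<omega> r') A'" "sum (\<omega> r') A' \<le> sum (\<omega> r') A" "sum (\<omega> r') B' \<le> sum (\<omega> r') B"
        using A' B' mem unfolding minimal_in_def by blast+
      \<comment> \<open>Ambiguity makes the least weight of a set with the element equal to that of
        a set without it. Only the former depends on the chunk, and it does so by adding its value,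
        so the value is forced.\<close>
      have "val (chunk m i r) = val (chunk m i r')"
        using m1 m2 inn[OF mem(1) A(2)] inn[OF mem(3) A'(2)] out[OF mem(2) B(2)] out[OF mem(4) B'(2)] by linarith
      moreover have "length (chunk m i r) = length (chunk m i r')" using len by (simp add: chunk_def)
      ultimately have "chunk m i r = chunk m i r'" by (intro val_inject)
      then have "take (i * m) r @ chunk m i r @ drop (i * m + m) r =
          take (i * m) r' @ chunk m i r' @ drop (i * m + m) r'" using eq by (simp only:)
      then show "r = r'" unfolding split[symmetric] .
    qed
    moreover have "?h ` Bad i \<subseteq> {r. length r = (?n - 1) * m}"
      using im by (auto simp: Bad_def diff_mult_distrib)
    ultimately show ?thesis
      using card_inj_on_le[of ?h "Bad i" "{r. length r = (?n - 1) * m}"] finite_bits card_bits by simp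
  qed
  have "card {r. length r = ?n * m \<and> \<not> (\<exists>!X. minimal_in F (\<omega> r) X)} \<le> card (\<Union>i<?n. Bad i)"
    using bad Bad_fin by (intro card_mono) auto
  also have "\<dots> \<le> (\<Sum>i<?n. card (Bad i))" by (intro card_UN_le) auto
  also have "\<dots> \<le> (\<Sum>i<?n. 2 ^ ((?n - 1) * m))" by (intro sum_mono card_Bad) auto
  also have "\<dots> = ?n * 2 ^ ((?n - 1) * m)" by simp
  finally have le: "2 * card {r. length r = ?n * m \<and> \<not> (\<exists>!X. minimal_in F (\<omega> r) X)} \<le> 2 * ?n * 2 ^ ((?n - 1) * m)"
    by simp
  \<comment> \<open>A part takes \<open>2 ^ m\<close> values, at least \<open>2 * ?n\<close>, so all
    bad events together cover at most half of the strings.\<close>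
  have "2 * ?n * 2 ^ ((?n - 1) * m) \<le> 2 ^ (?n * m)"
  proof (cases "?n = 0")
    case False
    have "2 * ?n * 2 ^ ((?n - 1) * m) \<le> 2 ^ m * 2 ^ ((?n - 1) * m)" using m by (intro mult_right_mono) auto
    also have "\<dots> = 2 ^ (?n * m)" using False by (cases ?n) (simp_all flip: power_add)
    finally show ?thesis .
  qed simp
  with le show ?thesis by linarith
qed


section \<open>Parity of the number of consistent cuts\<close>

lemma even_card_involution:
  assumes "finite A" "\<And>x. x \<in> A \<Longrightarrow> f x \<in> A \<and> f (f x) = x \<and> f x \<noteq> x"
  shows "even (card A)"
  using assms
proof (induction "card A" arbitrary: A rule: less_induct)
  case less
  show ?case
  proof (cases "A = {}")
    case False
    then obtain x where x: "x \<in> A" by blast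
    let ?B = "A - {x, f x}"
    have fx: "f x \<in> A" "f x \<noteq> x" "f (f x) = x" using less.prems(2)[OF x] by auto
    have "f y \<in> ?B \<and> f (f y) = y \<and> f y \<noteq> y" if "y \<in> ?B" for y
    proof -
      have y: "y \<in> A" "y \<noteq> x" "y \<noteq> f x" using that by auto
      from less.prems(2)[OF y(1)] have fy: "f y \<in> A" "f (f y) = y" "f y \<noteq> y" by auto
      have "f y \<noteq> x" using fy(2) y(3) by auto
      moreover have "f y \<noteq> f x" using fy(2) fx(3) y(2) by auto
      ultimately show ?thesis using fy by simp
    qed
    moreover have c: "card A = card ?B + 2"
    proof -
      have two: "card {x, f x} = 2" using fx(2) by simp
      have "card {x, f x} \<le> card A" using x fx(1) less.prems(1) by (intro card_mono) auto
      then show ?thesis using two x fx(1) by (simp add: card_Diff_subset)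
    qed
    ultimately have "even (card ?B)" using less.hyps[of ?B] less.prems(1) by simp
    with c show ?thesis by simp
  qed simp
qed

abbreviation gr :: "nat cexpr \<Rightarrow> nat graph" where "gr e \<equiv> graph.truncate (lgraph_of e)"

lemma gr_simps [simp]: "verts (gr e) = V e" "edges (gr e) = edges (lgraph_of e)"
  by (simp_all add: graph.truncate_def)

lemma edge_doubleton: "x \<in> edges (lgraph_of e) \<Longrightarrow> \<exists>u v. x = {u, v}"
  by (induction e) (auto simp: Let_def)

lemma adjacency_induce:
  "(u, v) \<in> adjacency (induce (gr e) X) \<longleftrightarrow> {u, v} \<in> edges (lgraph_of e) \<and> u \<in> X \<and> v \<in> X"
  by (auto simp: adjacency_def induce_def)

definition swap :: "st \<Rightarrow> st" where
  "swap x = (case x of Lft \<Rightarrow> Rgt | Rgt \<Rightarrow> Lft | _ \<Rightarrow> x)"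

lemma swap_simps [simp]: "swap Lft = Rgt" "swap Rgt = Lft" "swap Out = Out" "swap Forb = Forb" "swap (swap x) = x"
  by (simp_all add: swap_def split: st.splits)

text \<open>Common to both problems: once vertices outside \<open>X\<close> are forced to be
  \<open>Out\<close>, assignments with solution \<open>X\<close> differ only in the side of each
  vertex of \<open>X\<close>. The premise \<open>edge\<close> holds vacuously if \<open>X\<close> is
  a vertex cover.\<close>

lemma (in state_problem) cut_parity:
  fixes e r F X
  defines "S \<equiv> {\<sigma> \<in> asg r e (\<lambda>_. F). selected e \<sigma> = X}"
  assumes X: "X \<subseteq> V e" "r \<in> X" and F: "{Out, Lft, Rgt} \<subseteq> F"
    and ok: "ok Lft Lft" "ok Rgt Rgt" "\<not> ok Lft Rgt" "ok Out Lft" "ok Out Rgt"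
    and Out: "\<And>\<sigma> v. \<sigma> \<in> S \<Longrightarrow> v \<in> V e - X \<Longrightarrow> \<sigma> v = Out"
    and edge: "\<And>u v. {u, v} \<in> edges (lgraph_of e) \<Longrightarrow> u \<notin> X \<Longrightarrow> v \<notin> X \<Longrightarrow> ok Out Out"
  shows "odd (card S) \<longleftrightarrow> connected_graph (induce (gr e) X)"
proof -
  let ?R = "(adjacency (induce (gr e) X))\<^sup>*"
  have in_X: "\<sigma> v = Lft \<or> \<sigma> v = Rgt" if "\<sigma> \<in> S" "v \<in> X" for \<sigma> v
    using that by (auto simp: S_def selected_def)
  have not_X: "\<sigma> v = Out" if "\<sigma> \<in> S" "v \<notin> X" for \<sigma> v
    using that Out[of \<sigma> v] by (cases "v \<in> V e") (auto simp: S_def asg_def)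
  have rL: "\<sigma> r = Lft" if "\<sigma> \<in> S" for \<sigma> using that X by (auto simp: S_def asg_def)
  have e_ok: "ok (\<sigma> u) (\<sigma> v)" if "\<sigma> \<in> S" "{u, v} \<in> edges (lgraph_of e)" for \<sigma> u v
    using that by (auto simp: S_def asg_def)
  \<comment> \<open>Conversely, any choice of sides that is constant along the edges inside
    \<open>X\<close> and puts \<open>r\<close> on the left is an admissible assignment.\<close>
  have memI: "\<sigma> \<in> S"
    if h1: "\<And>v. v \<in> X \<Longrightarrow> \<sigma> v = Lft \<or> \<sigma> v = Rgt" and h2: "\<And>v. v \<notin> X \<Longrightarrow> \<sigma> v = Out" and h3: "\<sigma> r = Lft"
      and h4: "\<And>u v. {u, v} \<in> edges (lgraph_of e) \<Longrightarrow> u \<in> X \<Longrightarrow> v \<in> X \<Longrightarrow> \<sigma> u = \<sigma> v" for \<sigma>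
  proof -
    have ok': "ok (\<sigma> u) (\<sigma> v)" if uv: "{u, v} \<in> edges (lgraph_of e)" for u v
    proof -
      consider "u \<in> X" "v \<in> X" | "u \<in> X" "v \<notin> X" | "u \<notin> X" "v \<in> X" | "u \<notin> X" "v \<notin> X" by blast
      then show ?thesis
      proof cases
        case 1
        then show ?thesis using h4[OF uv] h1[of v] ok by auto
      next
        case 2
        then show ?thesis using h1[of u] h2[of v] ok ok_sym[of Lft Out] ok_sym[of Rgt Out] by auto
      next
        case 3
        then show ?thesis using h1[of v] h2[of u] ok by auto
      next
        case 4
        then show ?thesis using edge[OF uv] h2 by simp
      qed
    qed
    have "\<sigma> v \<in> F" for v using h1[of v] h2[of v] F by (cases "v \<in> X") auto
    moreover have "selected e \<sigma> = X"
    proof (intro equalityI subsetI)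
      fix v assume "v \<in> selected e \<sigma>"
      then show "v \<in> X" using h2[of v] by (cases "v \<in> X") (auto simp: selected_def)
    next
      fix v assume "v \<in> X"
      then show "v \<in> selected e \<sigma>" using h1[of v] X(1) by (auto simp: selected_def)
    qed
    moreover have "\<sigma> v = Out" if "v \<notin> V e" for v using that X(1) h2[of v] by auto
    ultimately show ?thesis using h3 ok' by (auto simp: S_def asg_def)
  qed
  have const: "\<sigma> v = Lft" if "\<sigma> \<in> S" "(r, v) \<in> ?R" for \<sigma> v
    using that(2)
  proof (induction rule: rtrancl_induct)
    case base
    show ?case using rL that by simp
  next
    case (step u v)
    then have "{u, v} \<in> edges (lgraph_of e)" "v \<in> X" by (auto simp: adjacency_induce)
    then show ?case using e_ok[OF that(1), of u v] in_X[OF that(1), of v] step.IH ok by auto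
  qed
  have vX: "verts (induce (gr e) X) = X" using X by (auto simp: induce_def)
  have sym: "sym ?R"
    by (intro sym_rtrancl symI) (auto simp: adjacency_induce insert_commute)
  show ?thesis
  proof (cases "\<forall>v \<in> X. (r, v) \<in> ?R")
    case True
    then have conn: "connected_graph (induce (gr e) X)"
      unfolding connected_graph_def vX
    proof (intro ballI)
      fix u v assume "u \<in> X" "v \<in> X"
      with True have "(r, u) \<in> ?R" "(r, v) \<in> ?R" by auto
      with symD[OF sym] show "(u, v) \<in> ?R" by (blast intro: rtrancl_trans)
    qed
    let ?s = "\<lambda>v. if v \<in> X then Lft else Out"
    have "?s \<in> S" using X by (intro memI) auto
    moreover have "\<sigma> = ?s" if "\<sigma> \<in> S" for \<sigma>
      using const[OF that] not_X[OF that] True by (auto simp: fun_eq_iff)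
    ultimately have "S = {?s}" by blast
    with conn show ?thesis by simp
  next
    case False
    \<comment> \<open>The union of the components of the solution that avoid \<open>r\<close>; no
      edge inside \<open>X\<close> leaves it, so both sides can be exchanged there.\<close>
    define D where "D = {v \<in> X. (r, v) \<notin> ?R}"
    have D: "D \<noteq> {}" using False by (auto simp: D_def)
    have rD: "r \<notin> D" by (simp add: D_def)
    have not_conn: "\<not> connected_graph (induce (gr e) X)"
      using False X(2) unfolding connected_graph_def vX by blast
    have sep: "u \<in> D \<longleftrightarrow> v \<in> D" if "{u, v} \<in> edges (lgraph_of e)" "u \<in> X" "v \<in> X" for u v
      using that rtrancl_into_rtrancl[of r u _ v] rtrancl_into_rtrancl[of r v _ u]
      by (auto simp: D_def adjacency_induce insert_commute)
    let ?f = "\<lambda>\<sigma> v. if v \<in> D then swap (\<sigma> v) else \<sigma> v"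
    have "even (card S)"
    proof (rule even_card_involution)
      show "finite S" by (simp add: S_def)
    next
      fix \<sigma> assume \<sigma>: "\<sigma> \<in> S"
      have same: "\<sigma> u = \<sigma> v" if "{u, v} \<in> edges (lgraph_of e)" "u \<in> X" "v \<in> X" for u v
        using e_ok[OF \<sigma> that(1)] in_X[OF \<sigma> that(2)] in_X[OF \<sigma> that(3)] ok ok_sym[of Rgt Lft] by auto
      have "?f \<sigma> \<in> S"
      proof (rule memI)
        fix v assume "v \<in> X"
        then show "?f \<sigma> v = Lft \<or> ?f \<sigma> v = Rgt" using in_X[OF \<sigma>, of v] by auto
      next
        fix v assume "v \<notin> X"
        then show "?f \<sigma> v = Out" using not_X[OF \<sigma>, of v] by auto
      next
        show "?f \<sigma> r = Lft" using rL[OF \<sigma>] rD by simp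
      next
        fix u v assume "{u, v} \<in> edges (lgraph_of e)" "u \<in> X" "v \<in> X"
        from sep[OF this] same[OF this] show "?f \<sigma> u = ?f \<sigma> v" by simp
      qed
      moreover have "?f (?f \<sigma>) = \<sigma>" by (auto simp: fun_eq_iff)
      moreover obtain v where v: "v \<in> D" using D by blast
      have "?f \<sigma> v \<noteq> \<sigma> v" using v in_X[OF \<sigma>, of v] by (auto simp: D_def)
      then have "?f \<sigma> \<noteq> \<sigma>" using fun_cong[of "?f \<sigma>" \<sigma> v] by blast
      ultimately show "?f \<sigma> \<in> S \<and> ?f (?f \<sigma>) = \<sigma> \<and> ?f \<sigma> \<noteq> \<sigma>" by blast
    qed
    with not_conn show ?thesis by simp
  qed
qed

section \<open>Correctness of the decision procedure\<close>

lemma set_vertex_list [simp]: "set (vertex_list e) = V e"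
  by (induction e) (auto simp: Let_def)

lemma distinct_vertex_list: "wf_cexpr e \<Longrightarrow> distinct (vertex_list e)"
  by (induction e) auto

lemma get_weights:
  "\<lbrakk>distinct (map fst cs); i < length cs\<rbrakk> \<Longrightarrow>
   get (weights m M cs r) (fst (cs ! i)) = M * snd (cs ! i) + val (chunk m i r)"
proof (induction m M cs r arbitrary: i rule: weights.induct)
  case (2 m M v c cs r)
  show ?case
  proof (cases i)
    case 0
    then show ?thesis by (simp add: chunk_def)
  next
    case (Suc j)
    with 2 have "map fst cs ! j \<in> set (map fst cs)" by (intro nth_mem) simp
    with 2 Suc have "fst (cs ! j) \<noteq> v" by auto
    moreover have "chunk m j (drop m r) = chunk m i r" by (simp add: chunk_def Suc add.commute)
    ultimately show ?thesis using 2 Suc by simp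
  qed
qed simp

definition costs :: "nat cexpr \<Rightarrow> (nat \<Rightarrow> nat) \<Rightarrow> (nat \<times> nat) list" where
  "costs e c = map (\<lambda>v. (v, c v)) (vertex_list e)"

lemma length_costs [simp]: "length (costs e c) = length (vertex_list e)"
  by (simp add: costs_def)

lemma total_costs: "wf_cexpr e \<Longrightarrow> total (costs e c) = sum c (V e)"
  using sum_list_distinct_conv_sum_set[OF distinct_vertex_list, of e c]
  by (simp add: costs_def o_def)

locale connected_problem = cut_count a jt wt ok tst
  for a jt wt ok tst +
  fixes good :: "nat cexpr \<Rightarrow> nat set \<Rightarrow> bool"
  assumes good_parity: "\<lbrakk>wf_cexpr e; X \<subseteq> V e; r \<in> X\<rbrakk> \<Longrightarrow>
    odd (card {\<sigma> \<in> asg r e (\<lambda>_. tst a). selected e \<sigma> = X}) \<longleftrightarrow> good e X"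
begin

text \<open>Assignments are grouped by their solution \<open>X\<close>, which contains
  \<open>r\<close> because \<open>r\<close> is on the left; by \<open>good_parity\<close> a group is
  odd iff \<open>X\<close> is good.\<close>

lemma odd_cnt:
  assumes "wf_cexpr e" "r \<in> V e"
  shows "odd (cnt r \<omega> e (\<lambda>_. tst a) k) \<longleftrightarrow>
    odd (card {X. X \<subseteq> V e \<and> r \<in> X \<and> good e X \<and> sum \<omega> X = k})"
proof -
  let ?A = "{X. X \<subseteq> V e \<and> r \<in> X \<and> sum \<omega> X = k}"
  let ?S = "\<lambda>X. {\<sigma> \<in> asg r e (\<lambda>_. tst a). selected e \<sigma> = X}"
  have fin: "finite ?A" by (rule finite_subset[of _ "Pow (V e)"]) auto
  have "r \<in> selected e \<sigma>" if "\<sigma> \<in> asg r e (\<lambda>_. tst a)" for \<sigma>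
    using that assms(2) by (auto simp: asg_def selected_def)
  then have "{\<sigma> \<in> asg r e (\<lambda>_. tst a). sum \<omega> (selected e \<sigma>) = k} = (\<Union>X\<in>?A. ?S X)"
    by (auto simp: selected_def)
  then have "cnt r \<omega> e (\<lambda>_. tst a) k = card (\<Union>X\<in>?A. ?S X)" by (simp add: cnt_def)
  also have "\<dots> = (\<Sum>X\<in>?A. card (?S X))" by (intro card_UN_disjoint fin) auto
  finally have "odd (cnt r \<omega> e (\<lambda>_. tst a) k) \<longleftrightarrow> odd (card {X \<in> ?A. odd (card (?S X))})"
    by (simp only: even_sum_iff[OF fin])
  also have "{X \<in> ?A. odd (card (?S X))} = {X. X \<subseteq> V e \<and> r \<in> X \<and> good e X \<and> sum \<omega> X = k}"
    using good_parity[OF assms(1)] by blast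
  finally show ?thesis .
qed

context
  fixes e :: "nat cexpr" and c :: "nat \<Rightarrow> nat" and b :: nat
  assumes wf: "wf_cexpr e" and ne: "V e \<noteq> {}"
begin

abbreviation "vs \<equiv> vertex_list e"
abbreviation "m \<equiv> weight_bits (length vs)"
abbreviation "M \<equiv> cost_factor (length vs)"
definition \<omega> :: "bool list \<Rightarrow> nat \<Rightarrow> nat" where "\<omega> r = get (weighting (costs e c) r)"

lemma \<omega>: "i < length vs \<Longrightarrow> \<omega> r (vs ! i) = M * c (vs ! i) + val (chunk m i r)"
  using get_weights[of "costs e c" i m M r] distinct_vertex_list[OF wf]
  by (simp add: \<omega>_def weighting_def costs_def o_def)

lemma length_vs: "length vs = card (V e)"
  using distinct_card[OF distinct_vertex_list[OF wf]] by simp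

lemma vs_pos: "0 < length vs"
  using ne by (simp add: length_vs card_gt_0_iff)

text \<open>Each random part is at most \<open>2 ^ m - 1\<close> and there is at least one vertex,
  so they add up to less than \<open>M\<close>. Thus the cost is the weight divided by
  \<open>M\<close>, rounded down.\<close>

lemma \<omega>_bounds:
  assumes "X \<subseteq> V e"
  shows "M * sum c X \<le> sum (\<omega> r) X" "sum (\<omega> r) X < M * Suc (sum c X)"
proof -
  have v: "M * c v \<le> \<omega> r v \<and> \<omega> r v \<le> M * c v + (2 ^ m - 1)" if vX: "v \<in> X" for v
  proof -
    obtain i where i: "i < length vs" "v = vs ! i" using in_set_conv_nth[of v vs] vX assms by auto
    have "val (chunk m i r) < 2 ^ length (chunk m i r)" by (rule val_less)
    also have "\<dots> \<le> 2 ^ m" by (intro power_increasing) (auto simp: chunk_def)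
    finally show ?thesis using \<omega>[OF i(1), of r] i(2) by simp
  qed
  show "M * sum c X \<le> sum (\<omega> r) X"
    unfolding sum_distrib_left using v by (intro sum_mono) auto
  have "sum (\<omega> r) X \<le> (\<Sum>v\<in>X. M * c v + (2 ^ m - 1))" using v by (intro sum_mono) auto
  also have "\<dots> = M * sum c X + card X * (2 ^ m - 1)"
    by (simp only: sum.distrib sum_distrib_left sum_constant of_nat_id)
  also have "card X * (2 ^ m - 1) \<le> length vs * (2 ^ m - 1)"
    using card_mono[OF finite_V assms] unfolding length_vs by (intro mult_right_mono) auto
  also have "length vs * (2 ^ m - 1) < length vs * 2 ^ m" using vs_pos by simp
  finally show "sum (\<omega> r) X < M * Suc (sum c X)" by (simp add: cost_factor_def)
qed

lemma decide_iff:
  "decide e (costs e c) b r \<longleftrightarrow> (\<exists>v \<in> V e. \<exists>k < poly_len (costs e c) b.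
     odd (card {X. X \<subseteq> V e \<and> v \<in> X \<and> good e X \<and> sum (\<omega> r) X = k}))"
proof -
  have "fst ` set (weighting (costs e c) r) = set (map fst (weighting (costs e c) r))" by simp
  also have "\<dots> = set (map fst (costs e c))" unfolding weighting_def fst_weights ..
  also have "\<dots> = V e" by (simp add: costs_def o_def)
  finally have "fst ` set (weighting (costs e c) r) = V e" .
  moreover have "decide e (costs e c) b r \<longleftrightarrow> (\<exists>v \<in> fst ` set (weighting (costs e c) r).
      accepts (poly_len (costs e c) b) (remdups (all_labs e)) (weighting (costs e c) r) e v)"
    unfolding decide_def by force
  ultimately have "decide e (costs e c) b r \<longleftrightarrow> (\<exists>v \<in> V e.
      accepts (poly_len (costs e c) b) (remdups (all_labs e)) (weighting (costs e c) r) e v)" by simp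
  also have "\<dots> \<longleftrightarrow> (\<exists>v \<in> V e. \<exists>k < poly_len (costs e c) b.
     odd (card {X. X \<subseteq> V e \<and> v \<in> X \<and> good e X \<and> sum (\<omega> r) X = k}))"
    using accepts_iff[OF _ wf, of "remdups (all_labs e)"] odd_cnt[OF wf] by (simp add: \<omega>_def)
  finally show ?thesis .
qed

lemma poly_len_eq: "poly_len (costs e c) b = M * Suc (min (sum c (V e)) b)"
  by (simp add: poly_len_def total_costs[OF wf])

lemma decide_sound:
  assumes "decide e (costs e c) b r"
  shows "\<exists>X \<subseteq> V e. good e X \<and> sum c X \<le> b"
proof -
  obtain v k where k: "k < poly_len (costs e c) b"
    "odd (card {X. X \<subseteq> V e \<and> v \<in> X \<and> good e X \<and> sum (\<omega> r) X = k})"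
    using assms unfolding decide_iff by blast
  from k(2) have "{X. X \<subseteq> V e \<and> v \<in> X \<and> good e X \<and> sum (\<omega> r) X = k} \<noteq> {}" by force
  then obtain X where X: "X \<subseteq> V e" "good e X" "sum (\<omega> r) X = k" by blast
  have "M * sum c X < M * Suc (min (sum c (V e)) b)"
    using \<omega>_bounds(1)[OF X(1), of r] X(3) k(1) unfolding poly_len_eq by simp
  \<comment> \<open>Cancelling \<open>M\<close> turns the truncation of the polynomials at
    \<open>poly_len\<close> into the budget constraint.\<close>
  then have "sum c X < Suc (min (sum c (V e)) b)" by (simp only: mult_less_cancel1)
  then have "sum c X \<le> b" by linarith
  with X show ?thesis by blast
qed

text \<open>Isolation is applied to all good sets and not only to those within the budget: as cost
  dominates the weight, the lightest good set is also a cheapest one.\<close>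

lemma decide_complete:
  assumes nonempty: "\<And>X. X \<subseteq> V e \<Longrightarrow> good e X \<Longrightarrow> X \<noteq> {}"
    and ex: "\<exists>X \<subseteq> V e. good e X \<and> sum c X \<le> b"
  shows "2 * card {r. length r = length vs * m \<and> \<not> decide e (costs e c) b r} \<le> 2 ^ (length vs * m)"
proof -
  let ?F = "{X. X \<subseteq> V e \<and> good e X}"
  obtain X0 where X0: "X0 \<subseteq> V e" "good e X0" "sum c X0 \<le> b" using ex by blast
  have dec: "decide e (costs e c) b r" if uniq: "\<exists>!X. minimal_in ?F (\<omega> r) X" for r
  proof -
    obtain X where X: "minimal_in ?F (\<omega> r) X" "\<And>Y. minimal_in ?F (\<omega> r) Y \<Longrightarrow> Y = X"
      using uniq by blast
    have XV: "X \<subseteq> V e" "good e X" and min: "\<And>Y. Y \<subseteq> V e \<Longrightarrow> good e Y \<Longrightarrow> sum (\<omega> r) X \<le> sum (\<omega> r) Y"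
      using X(1) by (auto simp: minimal_in_def)
    \<comment> \<open>Any vertex of the lightest set can be the one fixed on the left, which is why
      solutions have to be nonempty.\<close>
    obtain v where v: "v \<in> X" using nonempty[OF XV] by blast
    have "{Y. Y \<subseteq> V e \<and> v \<in> Y \<and> good e Y \<and> sum (\<omega> r) Y = sum (\<omega> r) X} = {X}"
    proof (intro equalityI subsetI)
      fix Y assume "Y \<in> {Y. Y \<subseteq> V e \<and> v \<in> Y \<and> good e Y \<and> sum (\<omega> r) Y = sum (\<omega> r) X}"
      then have "minimal_in ?F (\<omega> r) Y" using min by (auto simp: minimal_in_def)
      then show "Y \<in> {X}" using X(2) by simp
    qed (use XV v in auto)
    then have "odd (card {Y. Y \<subseteq> V e \<and> v \<in> Y \<and> good e Y \<and> sum (\<omega> r) Y = sum (\<omega> r) X})" by simp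
    \<comment> \<open>\<open>X\<close> need not be \<open>X0\<close> but weighs no more. The cost of
      \<open>X0\<close> is at most the total cost as well as at most \<open>b\<close>, so capping
      the budget does no harm.\<close>
    moreover have "sum (\<omega> r) X < poly_len (costs e c) b"
    proof -
      have "sum (\<omega> r) X < M * Suc (sum c X0)" using min[OF X0(1,2)] \<omega>_bounds(2)[OF X0(1), of r] by simp
      also have "\<dots> \<le> M * Suc (min (sum c (V e)) b)"
        using X0(3) sum_mono2[OF finite_V X0(1), of c] by (intro mult_left_mono) auto
      finally show ?thesis unfolding poly_len_eq .
    qed
    ultimately show ?thesis unfolding decide_iff using v XV by blast
  qed
  have "2 * length vs \<le> 2 ^ m" using less_power_lg[of "length vs"] by (simp add: weight_bits_def)
  then have iso: "2 * card {r. length r = length vs * m \<and> \<not> (\<exists>!X. minimal_in ?F (\<omega> r) X)} \<le> 2 ^ (length vs * m)"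
    using X0 \<omega> by (intro isolation[OF _ _ distinct_vertex_list[OF wf], where base = "\<lambda>v. M * c v"]) auto
  have "card {r. length r = length vs * m \<and> \<not> decide e (costs e c) b r} \<le>
      card {r. length r = length vs * m \<and> \<not> (\<exists>!X. minimal_in ?F (\<omega> r) X)}"
    using dec by (intro card_mono finite_subset[OF _ finite_bits[of "length vs * m"]]) auto
  with iso show ?thesis by linarith
qed

end

end


section \<open>The two problems\<close>

text \<open>Every subset of the full test is the set of some sublist, so the evaluated check covers
  all \<open>T\<close> and \<open>T'\<close>.\<close>

lemma join_parityD:
  assumes "join_parity a t ok jt" "s \<le> a" "s' \<le> a"
  shows "(u, v) \<in> set (jt s s') \<Longrightarrow> u < a \<and> v < a"
    and "\<lbrakk>T \<noteq> {}; T' \<noteq> {}; T \<subseteq> set (t a); T' \<subseteq> set (t a)\<rbrakk> \<Longrightarrow>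
      odd (length (filter (\<lambda>(u, v). T \<subseteq> set (t u) \<and> T' \<subseteq> set (t v)) (jt s s'))) \<longleftrightarrow>
      T \<subseteq> set (t s) \<and> T' \<subseteq> set (t s') \<and> (\<forall>x \<in> T. \<forall>y \<in> T'. ok x y)"
proof -
  have sub: "list_all (List.member ys) xs \<longleftrightarrow> set xs \<subseteq> set ys" for xs ys :: "st list"
    by (auto simp: list_all_iff)
  have s: "s \<in> set [0..<Suc a]" "s' \<in> set [0..<Suc a]" using assms(2,3) by auto
  have 1: "list_all (\<lambda>(u, v). u < a \<and> v < a) (jt s s')"
    and 2: "list_all (\<lambda>x. list_all (\<lambda>y. x = [] \<or> y = [] \<or>
       odd (length (filter (\<lambda>(u, v). set x \<subseteq> set (t u) \<and> set y \<subseteq> set (t v)) (jt s s'))) =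
       (set x \<subseteq> set (t s) \<and> set y \<subseteq> set (t s') \<and> list_all (\<lambda>p. list_all (ok p) y) x))
       (subseqs (t a))) (subseqs (t a))"
    using assms(1)[unfolded join_parity_def Let_def sub list_all_iff[of _ "[0..<Suc a]"], rule_format, OF s]
    by blast+
  from 1 show "(u, v) \<in> set (jt s s') \<Longrightarrow> u < a \<and> v < a" by (auto simp: list_all_iff)
  assume T: "T \<noteq> {}" "T' \<noteq> {}" "T \<subseteq> set (t a)" "T' \<subseteq> set (t a)"
  then have "T \<in> set ` set (subseqs (t a))" "T' \<in> set ` set (subseqs (t a))" by (simp_all add: subseqs_powset)
  then obtain x y where x: "x \<in> set (subseqs (t a))" "T = set x" and y: "y \<in> set (subseqs (t a))" "T' = set y"
    by blast
  have "x \<noteq> []" "y \<noteq> []" using T x y by auto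
  with 2 x(1) y(1) show "odd (length (filter (\<lambda>(u, v). T \<subseteq> set (t u) \<and> T' \<subseteq> set (t v)) (jt s s'))) \<longleftrightarrow>
      T \<subseteq> set (t s) \<and> T' \<subseteq> set (t s') \<and> (\<forall>x \<in> T. \<forall>y \<in> T'. ok x y)"
    unfolding x(2) y(2) list_all_iff by blast
qed

definition wt_of :: "(nat \<Rightarrow> st list) \<Rightarrow> nat \<Rightarrow> bool \<times> bool \<times> bool" where
  "wt_of t s = (odd (card (set (t s) \<inter> {Out, Forb})), odd (card (set (t s) \<inter> {Lft, Rgt})), Lft \<in> set (t s))"

lemma cut_countI:
  assumes "join_parity a t ok jt" "0 < a" "\<And>x y. ok x y \<longleftrightarrow> ok y x"
    "\<And>s. s \<le> a \<Longrightarrow> set (t s) \<subseteq> set (t a)"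
  shows "cut_count a jt (wt_of t) ok (\<lambda>s. set (t s))"
  using assms join_parityD[OF assms(1)] by unfold_locales (auto simp: wt_of_def)

definition good_cvc :: "nat cexpr \<Rightarrow> nat set \<Rightarrow> bool" where
  "good_cvc e X \<longleftrightarrow> edges (delete (gr e) X) = {} \<and> connected_graph (induce (gr e) X)"

definition good_cds :: "nat cexpr \<Rightarrow> nat set \<Rightarrow> bool" where
  "good_cds e X \<longleftrightarrow> closed_nbh (gr e) X = V e \<and> connected_graph (induce (gr e) X)"

interpretation cvc: cut_count 6 jt_cvc "wt_of tst_cvc" ok_cvc "\<lambda>s. set (tst_cvc s)"
proof (rule cut_countI[OF join_parity_cvc])
  fix s :: nat assume "s \<le> 6"
  then have "s \<in> {0, 1, 2, 3, 4, 5, 6}" by auto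
  then show "set (tst_cvc s) \<subseteq> set (tst_cvc 6)" by (auto simp: tst_cvc_def)
qed (auto simp: ok_cvc_def)

interpretation cds: cut_count 5 jt_cds "wt_of tst_cds" ok_cds "\<lambda>s. set (tst_cds s)"
proof (rule cut_countI[OF join_parity_cds])
  fix s :: nat assume "s \<le> 5"
  then have "s \<in> {0, 1, 2, 3, 4, 5}" by auto
  then show "set (tst_cds s) \<subseteq> set (tst_cds 5)" by (auto simp: tst_cds_def)
qed (auto simp: ok_cds_def)

interpretation cvc: connected_problem 6 jt_cvc "wt_of tst_cvc" ok_cvc "\<lambda>s. set (tst_cvc s)" good_cvc
proof
  fix e :: "nat cexpr" and X r assume wf: "wf_cexpr e" and X: "X \<subseteq> V e" "r \<in> X"
  let ?S = "{\<sigma> \<in> cvc.asg r e (\<lambda>_. set (tst_cvc 6)). selected e \<sigma> = X}"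
  have full: "set (tst_cvc 6) = {Out, Lft, Rgt}" by (simp add: tst_cvc_def)
  have out: "\<sigma> v = Out" if "\<sigma> \<in> ?S" "v \<in> V e - X" for \<sigma> v
    using that by (auto simp: cvc.asg_def full selected_def)
  show "odd (card ?S) \<longleftrightarrow> good_cvc e X"
  proof (cases "edges (delete (gr e) X) = {}")
    case True
    have "odd (card ?S) \<longleftrightarrow> connected_graph (induce (gr e) X)"
    proof (rule cvc.cut_parity[OF X])
      fix u v assume uv: "{u, v} \<in> edges (lgraph_of e)" "u \<notin> X" "v \<notin> X"
      then have "{u, v} \<in> edges (delete (gr e) X)"
        using edges_V[OF uv(1)] by (simp add: delete_def induce_def)
      with True show "ok_cvc Out Out" by simp
    qed (use out full in \<open>auto simp: ok_cvc_def\<close>)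
    with True show ?thesis by (simp add: good_cvc_def)
  next
    case False
    then obtain x where x: "x \<in> edges (lgraph_of e)" "x \<subseteq> V e - X" by (auto simp: delete_def induce_def)
    then obtain u v where uv: "x = {u, v}" using edge_doubleton by blast
    \<comment> \<open>The ends of an uncovered edge are both \<open>Out\<close>, which is not
      allowed; so there is nothing to count, rather than an even number by cancellation.\<close>
    have "?S = {}"
    proof (rule equals0I)
      fix \<sigma> assume \<sigma>: "\<sigma> \<in> ?S"
      then have "ok_cvc (\<sigma> u) (\<sigma> v)" using x(1) uv by (auto simp: cvc.asg_def)
      moreover have "\<sigma> u = Out" "\<sigma> v = Out" using out[OF \<sigma>] x(2) uv by auto
      ultimately show False by (simp add: ok_cvc_def)
    qed
    then have "even (card ?S)" by (metis card.empty dvd_0_right)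
    with False show ?thesis by (simp add: good_cvc_def)
  qed
qed

interpretation cds: connected_problem 5 jt_cds "wt_of tst_cds" ok_cds "\<lambda>s. set (tst_cds s)" good_cds
proof
  fix e :: "nat cexpr" and X r assume wf: "wf_cexpr e" and X: "X \<subseteq> V e" "r \<in> X"
  let ?S = "{\<sigma> \<in> cds.asg r e (\<lambda>_. set (tst_cds 5)). selected e \<sigma> = X}"
  have full: "set (tst_cds 5) = {Out, Forb, Lft, Rgt}" by (simp add: tst_cds_def)
  have nX: "\<sigma> v = Out \<or> \<sigma> v = Forb" if "\<sigma> \<in> ?S" "v \<in> V e - X" for \<sigma> v
    using that by (auto simp: cds.asg_def full selected_def)
  have inX: "\<sigma> v = Lft \<or> \<sigma> v = Rgt" if "\<sigma> \<in> ?S" "v \<in> X" for \<sigma> v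
    using that by (auto simp: selected_def)
  have e_ok: "ok_cds (\<sigma> u) (\<sigma> v)" if "\<sigma> \<in> ?S" "{u, v} \<in> edges (lgraph_of e)" for \<sigma> u v
    using that by (auto simp: cds.asg_def)
  show "odd (card ?S) \<longleftrightarrow> good_cds e X"
  proof (cases "closed_nbh (gr e) X = V e")
    case True
    have out: "\<sigma> v = Out" if \<sigma>: "\<sigma> \<in> ?S" and v: "v \<in> V e - X" for \<sigma> v
    proof -
      obtain u where u: "u \<in> X" "{u, v} \<in> edges (lgraph_of e)"
        using v True by (auto simp: closed_nbh_def)
      show ?thesis using inX[OF \<sigma> u(1)] nX[OF \<sigma> v] e_ok[OF \<sigma> u(2)] by (auto simp: ok_cds_def)
    qed
    have "odd (card ?S) \<longleftrightarrow> connected_graph (induce (gr e) X)"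
      by (rule cds.cut_parity[OF X]) (use out full in \<open>auto simp: ok_cds_def\<close>)
    with True show ?thesis by (simp add: good_cds_def)
  next
    case False
    have "closed_nbh (gr e) X \<subseteq> V e" using X edges_V[of _ _ e] by (auto simp: closed_nbh_def)
    with False obtain w where w': "w \<in> V e" "w \<notin> closed_nbh (gr e) X" by blast
    then have w: "w \<in> V e" "w \<notin> X" "\<And>u. u \<in> X \<Longrightarrow> {u, w} \<notin> edges (lgraph_of e)"
      by (auto simp: closed_nbh_def)
    \<comment> \<open>Exchanging \<open>Out\<close> and \<open>Forb\<close> at an undominated vertex
      cancels all assignments in pairs.\<close>
    let ?t = "\<lambda>x. if x = Out then Forb else Out"
    let ?f = "\<lambda>\<sigma>. \<sigma>(w := ?t (\<sigma> w))"
    have "even (card ?S)"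
    proof (rule even_card_involution)
      fix \<sigma> assume \<sigma>: "\<sigma> \<in> ?S"
      have \<sigma>w: "\<sigma> w = Out \<or> \<sigma> w = Forb" using nX[OF \<sigma>] w by auto
      \<comment> \<open>All neighbours of \<open>w\<close> lie outside \<open>X\<close>, hence are
        \<open>Out\<close> or \<open>Forb\<close>, and these two states are compatible with each
        other and with themselves.\<close>
      have ok: "ok_cds (?f \<sigma> u) (?f \<sigma> v)" if uv: "{u, v} \<in> edges (lgraph_of e)" for u v
      proof -
        have V: "u \<in> V e" "v \<in> V e" using edges_V[OF uv] by auto
        have "v \<notin> X" if "u = w" using w(3)[of v] uv that by (auto simp: insert_commute)
        moreover have "u \<notin> X" if "v = w" using w(3)[of u] uv that by auto
        ultimately show ?thesis
          using nX[OF \<sigma>, of u] nX[OF \<sigma>, of v] V \<sigma>w e_ok[OF \<sigma> uv] by (auto simp: ok_cds_def)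
      qed
      have "selected e (?f \<sigma>) = selected e \<sigma>" using \<sigma>w by (auto simp: selected_def)
      moreover have "w \<noteq> r" using w(2) X(2) by blast
      ultimately have "?f \<sigma> \<in> ?S" using \<sigma> w(1) ok unfolding cds.asg_def full by auto
      moreover have "?f (?f \<sigma>) = \<sigma>" using \<sigma>w by (auto simp: fun_eq_iff)
      moreover have "?f \<sigma> w \<noteq> \<sigma> w" using \<sigma>w by auto
      then have "?f \<sigma> \<noteq> \<sigma>" using fun_cong[of "?f \<sigma>" \<sigma> w] by blast
      ultimately show "?f \<sigma> \<in> ?S \<and> ?f (?f \<sigma>) = \<sigma> \<and> ?f \<sigma> \<noteq> \<sigma>" by blast
    qed simp
    with False show ?thesis by (simp add: good_cds_def)
  qed
qed

lemma connected_edge: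
  assumes "connected_graph (gr e)" "2 \<le> card (V e)"
  shows "edges (lgraph_of e) \<noteq> {}"
proof
  assume "edges (lgraph_of e) = {}"
  then have "adjacency (gr e) = {}" by (simp add: adjacency_def)
  moreover obtain u v where "u \<in> V e" "v \<in> V e" "u \<noteq> v"
    using assms(2) card_le_Suc0_iff_eq[of "V e"] by fastforce
  ultimately show False using assms(1) by (auto simp: connected_graph_def)
qed

text \<open>The empty set offers no vertex to fix on the left and has to be excluded. This rests on
  the standing assumption: a connected graph with two vertices has an edge.\<close>

lemma good_cvc_nonempty:
  assumes "connected_graph (gr e)" "2 \<le> card (V e)" "good_cvc e X"
  shows "X \<noteq> {}"
proof
  assume "X = {}"
  obtain x where x: "x \<in> edges (lgraph_of e)" using connected_edge[OF assms(1,2)] by blast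
  moreover obtain u v where "x = {u, v}" using edge_doubleton[OF x] by blast
  ultimately show False using assms(3) \<open>X = {}\<close> edges_V[of u v e]
    by (auto simp: good_cvc_def delete_def induce_def)
qed

lemma good_cds_nonempty: "\<lbrakk>V e \<noteq> {}; good_cds e X\<rbrakk> \<Longrightarrow> X \<noteq> {}"
  by (auto simp: good_cds_def closed_nbh_def)

section \<open>Running times\<close>

lemma all_labs_subexprs: "wf_cexpr e \<Longrightarrow> set (all_labs e) \<subseteq> (\<Union>s \<in> subexprs e. set (labs s))"
  by (induction e) fastforce+

lemma wf_subexprs: "wf_cexpr e \<Longrightarrow> s \<in> subexprs e \<Longrightarrow> wf_cexpr s"
  by (induction e) auto

text \<open>Tables have one level per label in \<open>all_labs\<close>, so this makes the number of
  entries at most \<open>a ^ k\<close>.\<close>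

lemma card_all_labs:
  assumes "k_expression k e" shows "length (remdups (all_labs e)) \<le> k"
proof -
  from assms have wf: "wf_cexpr e" by (simp add: k_expression_def)
  have "set (labs s) \<subseteq> {1..k}" if "s \<in> subexprs e" for s
    using assms that set_labs[OF wf_subexprs[OF wf that]] by (auto simp: k_expression_def)
  with all_labs_subexprs[OF wf] have "set (all_labs e) \<subseteq> {1..k}" by blast
  then have "card (set (all_labs e)) \<le> card {1..k}" by (intro card_mono) auto
  then show ?thesis by (simp add: length_remdups_card_conv)
qed

lemma enc_instance_eq:
  "enc_instance e c b = Cell (enc_cexpr e) (Cell (ecosts (costs e c)) (Cell (enc_nat b) Atom))"
  by (simp add: enc_instance_def enc_costs_def elist_def costs_def o_def)

context connected_problem
begin

definition table_size :: nat where
  "table_size = 1000 + 10 * a + 10 * size jtab + 10 * size wtab +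
    10 * size (elist unary live_opts) + 10 * size (elist unary dead_opts)"

text \<open>With \<open>x\<close> the input size, each summand dominates quantities that
  \<open>K\<close> has to bound: the fixed tables, the range of the random parts and the sizes of
  encodings, the cost factor and the degree bound, a single cost, and the total cost.\<close>

definition size_bound :: "nat poly \<Rightarrow> nat poly" where
  "size_bound p = (let x = [:0, 1:] in
     [:table_size:] + [:4:] * x + [:4:] * x * x * (x * p + 1) + p + x * p)"

lemma poly_size_bound:
  "poly (size_bound p) n = table_size + 4 * n + 4 * n * n * (n * poly p n + 1) + poly p n + n * poly p n"
  unfolding size_bound_def Let_def
  by (simp only: poly_add poly_mult poly_pCons poly_0 poly_1 mult_zero_right add_0_right add_0_left mult_1_right)

lemma run_time:
  assumes e: "k_expression k e" and G: "connected_graph (gr e)" "2 \<le> card (V e)"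
    and c: "\<forall>v \<in> V e. c v \<le> poly p (input_size e c b)"
    and nonempty: "\<And>X. X \<subseteq> V e \<Longrightarrow> good e X \<Longrightarrow> X \<noteq> {}"
  shows "one_sided_monte_carlo prog (enc_instance e c b) (\<exists>X \<subseteq> V e. good e X \<and> sum c X \<le> b)
    (a ^ k * poly (size_bound p ^ 17) (input_size e c b))"
proof -
  define N where "N = input_size e c b"
  define P where "P = poly p N"
  define K where "K = poly (size_bound p) N"
  have K: "K = table_size + 4 * N + 4 * N * N * (N * P + 1) + P + N * P"
    unfolding K_def P_def by (rule poly_size_bound)
  interpret B: bounded a jt wt K
  proof
    show "1000 + 10 * a + 10 * size jtab + 10 * size wtab + 10 * size (elist unary live_opts) +
        10 * size (elist unary dead_opts) \<le> K"
      unfolding table_size_def[symmetric] K by simp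
    show "u \<le> a \<and> v \<le> a" if "s \<le> a" "s' \<le> a" "(u, v) \<in> set (jt s s')" for s s' u v
      using jt_less[OF that] by simp
  qed (rule a_pos)
  from e have wf: "wf_cexpr e" by (simp add: k_expression_def)
  have ne: "V e \<noteq> {}" using G(2) by auto
  let ?cs = "costs e c" and ?n = "length (vertex_list e)"
  have N: "N = size (enc_cexpr e) + size (ecosts ?cs) + size (enc_nat b) + 3"
    by (simp add: N_def input_size_def enc_instance_eq)
  have cs: "\<forall>(v, x) \<in> set ?cs. x \<le> K \<and> size (enc_nat x) \<le> K"
  proof (intro ballI, clarify)
    fix v x assume vx: "(v, x) \<in> set ?cs"
    then have "v \<in> V e" "x = c v" by (auto simp: costs_def)
    with c have "x \<le> P" by (simp add: P_def N_def)
    moreover have "size (enc_nat x) \<le> size (ecosts ?cs)"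
      using B.size_elist(1)[OF vx, of "\<lambda>(v, c). Cell (enc_nat v) (enc_nat c)"] by simp
    ultimately show "x \<le> K \<and> size (enc_nat x) \<le> K" by (simp add: K N)
  qed
  have nN: "?n \<le> N"
    using B.size_elist(2)[of ?cs "\<lambda>(v, c). Cell (enc_nat v) (enc_nat c)"] by (simp add: N)
  have pos: "0 < ?n" using vs_pos[OF wf ne] .
  have m: "2 ^ weight_bits ?n \<le> 4 * N"
    using power_lg_le[OF pos] nN by (simp add: weight_bits_def)
  then have M: "cost_factor ?n \<le> 4 * N * N"
    using mult_mono[OF nN m] by (simp add: cost_factor_def algebra_simps)
  have t: "total ?cs \<le> N * P"
  proof -
    have "total ?cs = sum c (V e)" by (rule total_costs[OF wf])
    also have "\<dots> \<le> (\<Sum>v\<in>V e. P)" using c by (intro sum_mono) (auto simp: P_def N_def)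
    also have "\<dots> = ?n * P" by (simp add: length_vs[OF wf ne])
    also have "\<dots> \<le> N * P" using nN by (intro mult_right_mono) auto
    finally show ?thesis .
  qed
  have d: "poly_len ?cs b \<le> 4 * N * N * (N * P + 1)"
    unfolding poly_len_def length_costs using M t by (intro mult_mono) auto
  have sz: "size (enc_cexpr e) \<le> K" "size (enc_nat b) \<le> K" "length ?cs \<le> K"
    "2 ^ weight_bits (length ?cs) \<le> K" "cost_factor (length ?cs) \<le> K" "poly_len ?cs b \<le> K" "total ?cs \<le> K"
    using nN m M t d unfolding length_costs K by (simp_all add: N)
  obtain f where f: "\<And>r. f r \<le> a ^ length (remdups (all_labs e)) * K ^ 17"
    "run prog (enc_instance e c b) = map_spmf (\<lambda>r. (enc_bool (decide e ?cs b r), f r))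
      (spmf_of_set {r. length r = ?n * weight_bits ?n})"
    using B.run_prog[OF sz(1,2) cs sz(3-7)] unfolding enc_instance_eq length_costs by blast
  \<comment> \<open>The only place where \<open>k\<close> enters the running time.\<close>
  have "a ^ length (remdups (all_labs e)) * K ^ 17 \<le> a ^ k * K ^ 17"
    using card_all_labs[OF e] a_pos by (intro mult_right_mono power_increasing) auto
  from order_trans[OF f(1) this] have T: "f r \<le> a ^ k * poly (size_bound p ^ 17) (input_size e c b)" for r
    unfolding K_def N_def poly_power .
  have "{r :: bool list. length r = ?n * weight_bits ?n} \<noteq> {}" using Ex_list_of_length by blast
  from f(2) finite_bits this T show ?thesis
  proof (rule one_sided_monte_carloI)
    show "\<exists>X\<subseteq>V e. good e X \<and> sum c X \<le> b" if "decide e ?cs b r" for r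
      using decide_sound[OF wf ne that] .
    show "2 * card {r \<in> {r. length r = ?n * weight_bits ?n}. \<not> decide e ?cs b r}
        \<le> card {r :: bool list. length r = ?n * weight_bits ?n}"
      if "\<exists>X\<subseteq>V e. good e X \<and> sum c X \<le> b"
      using decide_complete[OF wf ne nonempty that] by (simp add: card_bits)
  qed
qed

lemma solvable:
  assumes problem: "\<And>e c b. problem (gr e) c b \<longleftrightarrow> (\<exists>X \<subseteq> V e. good e X \<and> sum c X \<le> b)"
    and nonempty: "\<And>e X. connected_graph (gr e) \<Longrightarrow> 2 \<le> card (V e) \<Longrightarrow> good e X \<Longrightarrow> X \<noteq> {}"
  shows "monte_carlo_solvable_cw problem a"
  unfolding monte_carlo_solvable_cw_def
proof (intro allI)
  fix p :: "nat poly"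
  show "\<exists>P q. \<forall>k e G c b. k_expression_for k e G \<longrightarrow> connected_graph G \<longrightarrow> 2 \<le> card (verts G) \<longrightarrow>
      (\<forall>v\<in>verts G. 0 < c v \<and> c v \<le> poly p (input_size e c b)) \<longrightarrow>
      one_sided_monte_carlo P (enc_instance e c b) (problem G c b) (a ^ k * poly q (input_size e c b))"
  proof (intro exI[of _ prog] exI[of _ "size_bound p ^ 17"] allI impI)
    fix k e G c b
    assume "k_expression_for k e G" and G: "connected_graph G" "2 \<le> card (verts G)"
      "\<forall>v\<in>verts G. 0 < c v \<and> c v \<le> poly p (input_size e c b)"
    then have e: "k_expression k e" "G = gr e" by (auto simp: k_expression_for_def)
    have V: "connected_graph (gr e)" "2 \<le> card (V e)" "\<forall>v\<in>V e. c v \<le> poly p (input_size e c b)"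
      using G unfolding e(2) gr_simps by blast+
    have "X \<noteq> {}" if "good e X" for X using nonempty[OF V(1,2) that] .
    from run_time[OF e(1) V this]
    show "one_sided_monte_carlo prog (enc_instance e c b) (problem G c b)
        (a ^ k * poly (size_bound p ^ 17) (input_size e c b))"
      unfolding e(2) problem .
  qed
qed

end

theorem theorem1:
  shows "monte_carlo_solvable_cw connected_vertex_cover 6 \<and>
         monte_carlo_solvable_cw connected_dominating_set 5"
proof
  show "monte_carlo_solvable_cw connected_vertex_cover 6"
  proof (rule cvc.solvable)
    show "connected_vertex_cover (gr e) c b \<longleftrightarrow> (\<exists>X \<subseteq> V e. good_cvc e X \<and> sum c X \<le> b)" for e c b
      by (simp add: connected_vertex_cover_def good_cvc_def conj_assoc)
  qed (erule (2) good_cvc_nonempty)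
  show "monte_carlo_solvable_cw connected_dominating_set 5"
  proof (rule cds.solvable)
    show "connected_dominating_set (gr e) c b \<longleftrightarrow> (\<exists>X \<subseteq> V e. good_cds e X \<and> sum c X \<le> b)" for e c b
      by (simp add: connected_dominating_set_def good_cds_def conj_assoc)
  next
    fix e X assume "2 \<le> card (V e)" and X: "good_cds e X"
    then have "V e \<noteq> {}" by fastforce
    then show "X \<noteq> {}" using X by (rule good_cds_nonempty)
  qed
qed

end
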